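(* Let $(M,g)$ be a smooth (pseudo-)Riemannian manifold of dimension $n\ge 3$ and let $\gamma:[t_0,t_1]\to M$ be a smooth curve whose velocity $U=\dot\gamma$ satisfies $|U|^2\neq 0$ everywhere. Let $$I[\gamma]=\int_{t_0}^{t_1}\mathcal{L}\,dt,\qquad \mathcal{L}=\frac{\langle U,E\rangle}{|U|^2},$$ where $E$ is the vector field along $\gamma$ defined in the context. Then, for a variation of $\gamma$ with variational vector field $V$, the first variation of $I$ is $$\delta I=\int_{t_0}^{t_1}|U|^{-2}\Big(\langle K,V\rangle-\langle E-2\mathcal{L}U,\ \mathcal{D}(V)\rangle\Big)dt+\mathcal{B}(V)\Big|_{t_0}^{t_1},$$ where $K$ is the vector field along $\gamma$ given, in terms of the Weyl tensor $W$ and the Schouten tensor $P$ of $g$, by $$K^e=g^{ec}\Big({W_{bca}}^{d}\,U^aU^bA_d-2|U|^2\,\nabla_{[c}P_{a]b}\,U^aU^b\Big),\qquad a,b,\dots=1,\dots,n,$$ and $$\mathcal{B}(V)=|U|^{-2}\Big(\langle U,\mathcal{D}^2(V)\rangle-\langle E-2\mathcal{L}U,\ V\rangle\Big),$$ with $\mathcal{D}$ the first order operator defined in the context.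
   Context: $\langle\cdot,\cdot\rangle$ is the inner product of $g$, $|X|^2=\langle X,X\rangle$, $\nabla$ is the Levi-Civita connection of $g$, $\nabla_U$ is the covariant derivative along $\gamma$, and $A=\nabla_UU$ is the acceleration. The Schouten tensor is $P=\frac{1}{n-2}\big(r-\frac{1}{2(n-1)}S\,g\big)$, with $r$ the Ricci tensor and $S$ the Ricci scalar of $g$. The endomorphism $P^\sharp$ of $TM$ is defined by $\langle P^\sharp(X),Y\rangle=P(X,Y)$ for all vector fields $X,Y$. $W$ is the Weyl tensor of $g$, with components ${W_{bca}}^{d}$; indices are raised and lowered with $g$, so $A_d=g_{de}A^e$. Square brackets denote antisymmetrisation (with factor $\frac12$ for two indices). The vector field $E$ along $\gamma$ is $$E=\nabla_UA-\frac{3\langle U,A\rangle}{|U|^2}A+\frac{3|A|^2}{2|U|^2}U-|U|^2P^\sharp(U)+2P(U,U)U$$ (the equation $E=0$ is the conformal geodesic equation). The operator $\mathcal{D}$ on vector fields along $\gamma$ is $$\mathcal{D}(V)=\nabla_UV+|U|^{-2}\big(\langle A,V\rangle U-\langle U,V\rangle A-\langle A,U\rangle V\big),$$ and $\mathcal{D}^2=\mathcal{D}\circ\mathcal{D}$. A variation of $\gamma$ is a one-parameter family of curves $\Gamma:[-1,1]\times[t_0,t_1]\to M$ with $\Gamma(0,t)=\gamma(t)$. Its variational vector field is $V=\partial\Gamma/\partial s|_{s=0}$, a vector field along $\gamma$, and $\delta I=\frac{d}{ds}\big|_{s=0}I[\Gamma(s,\cdot)]$.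
   Formalization: The sign of the second term of K is corrected: K^e = g^{ec}(W_{bca}^d U^a U^b A_d + 2|U|^2 ∇_{[c}P_{a]b} U^a U^b); with the printed minus the formula already fails on affinely parametrised geodesics where ∇_{[c}P_{a]b}U^aU^b ≠ 0. *)

theory Defs
  imports "HOL-Analysis.Analysis"
begin

section \<open>Smooth manifolds with a pseudo-Riemannian metric\<close>

text \<open>\<open>k\<close> times continuous differentiability on an open set \<open>S\<close>; the iterated
  derivatives are taken along all fixed directions \<open>v\<close>.\<close>

fun Ck_on :: "nat \<Rightarrow> 'a::real_normed_vector set \<Rightarrow> ('a \<Rightarrow> 'b::real_normed_vector) \<Rightarrow> bool" where
  "Ck_on 0 S f \<longleftrightarrow> continuous_on S f"
| "Ck_on (Suc k) S f \<longleftrightarrow>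
     f differentiable_on S \<and> (\<forall>v. Ck_on k S (\<lambda>x. frechet_derivative f (at x) v))"

definition smooth_on :: "'a::real_normed_vector set \<Rightarrow> ('a \<Rightarrow> 'b::real_normed_vector) \<Rightarrow> bool" where
  "smooth_on S f \<longleftrightarrow> (\<forall>k. Ck_on k S f)"

text \<open>A chart is its domain together with its coordinate map; the map is irrelevant outside
  the domain.\<close>

type_synonym ('m, 'n) chart = "'m set \<times> ('m \<Rightarrow> real ^ 'n)"

text \<open>\<open>Metric M c x\<close> is the matrix \<open>g\<^sub>a\<^sub>b\<close> in the chart \<open>c\<close> at the
  coordinate point \<open>x\<close>.\<close>

record ('m, 'n::finite) metric_manifold =
  Top :: "'m topology"
  Atlas :: "('m, 'n) chart set"
  Metric :: "('m, 'n) chart \<Rightarrow> real ^ 'n \<Rightarrow> real ^ 'n ^ 'n"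

definition transition :: "('m, 'n::finite) chart \<Rightarrow> ('m, 'n) chart \<Rightarrow> real ^ 'n \<Rightarrow> real ^ 'n" where
  "transition c c' = snd c' \<circ> inv_into (fst c) (snd c)"

definition smooth_manifold :: "('m, 'n::finite) metric_manifold \<Rightarrow> bool" where
  "smooth_manifold M \<longleftrightarrow>
     Hausdorff_space (Top M) \<and> second_countable (Top M) \<and>
     topspace (Top M) = (\<Union>c\<in>Atlas M. fst c) \<and>
     (\<forall>c\<in>Atlas M. openin (Top M) (fst c) \<and> open (snd c ` fst c) \<and>
        homeomorphic_map (subtopology (Top M) (fst c)) (top_of_set (snd c ` fst c)) (snd c)) \<and>
     (\<forall>c\<in>Atlas M. \<forall>c'\<in>Atlas M. smooth_on (snd c ` (fst c \<inter> fst c')) (transition c c'))"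

text \<open>The last clause is the transformation law of a covariant 2-tensor. Nondegeneracy and
  continuity make the signature locally constant.\<close>

definition pseudo_riemannian_manifold :: "('m, 'n::finite) metric_manifold \<Rightarrow> bool" where
  "pseudo_riemannian_manifold M \<longleftrightarrow>
     smooth_manifold M \<and>
     (\<forall>c\<in>Atlas M. smooth_on (snd c ` fst c) (Metric M c) \<and>
        (\<forall>x\<in>snd c ` fst c. transpose (Metric M c x) = Metric M c x \<and> invertible (Metric M c x))) \<and>
     (\<forall>c\<in>Atlas M. \<forall>c'\<in>Atlas M. \<forall>p\<in>fst c \<inter> fst c'. \<forall>X Y.
        (let J = frechet_derivative (transition c c') (at (snd c p))
         in X \<bullet> (Metric M c (snd c p) *v Y) = J X \<bullet> (Metric M c' (snd c' p) *v J Y)))"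

text \<open>Smoothness of a map from an arbitrary subset \<open>S\<close> of a Euclidean space (here a compact
  interval or rectangle): locally, in a chart, it is the restriction of a smooth map defined
  on an open set.\<close>

definition smooth_map_on ::
    "('m, 'n::finite) metric_manifold \<Rightarrow> 'a::euclidean_space set \<Rightarrow> ('a \<Rightarrow> 'm) \<Rightarrow> bool" where
  "smooth_map_on M S f \<longleftrightarrow>
     (\<forall>p\<in>S. \<exists>c\<in>Atlas M. \<exists>N F. open N \<and> p \<in> N \<and> f ` (S \<inter> N) \<subseteq> fst c \<and>
        smooth_on N F \<and> (\<forall>q\<in>S \<inter> N. F q = snd c (f q)))"


section \<open>Levi-Civita connection and curvature in a coordinate patch\<close>

text \<open>In this section \<open>G\<close> is the metric as a matrix-valued function of the coordinates.\<close>

definition pderiv_at :: "'n::finite \<Rightarrow> (real ^ 'n \<Rightarrow> real) \<Rightarrow> real ^ 'n \<Rightarrow> real" where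
  "pderiv_at i f x = frechet_derivative f (at x) (axis i 1)"

text \<open>\<open>christoffel G x a b c\<close> is \<open>\<Gamma>\<^sup>a\<^sub>b\<^sub>c\<close>, so that
  \<open>(\<nabla>\<^sub>b X)\<^sup>a = \<partial>\<^sub>b X\<^sup>a + \<Gamma>\<^sup>a\<^sub>b\<^sub>c X\<^sup>c\<close>.\<close>

definition christoffel ::
    "(real ^ 'n \<Rightarrow> real ^ 'n ^ 'n) \<Rightarrow> real ^ 'n \<Rightarrow> 'n::finite \<Rightarrow> 'n \<Rightarrow> 'n \<Rightarrow> real" where
  "christoffel G x a b c =
     (\<Sum>d\<in>UNIV. matrix_inv (G x) $ a $ d *
        (pderiv_at b (\<lambda>y. G y $ d $ c) x + pderiv_at c (\<lambda>y. G y $ d $ b) x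
         - pderiv_at d (\<lambda>y. G y $ b $ c) x)) / 2"

text \<open>\<open>riemann G x a b c d\<close> is \<open>R\<^sub>a\<^sub>b\<^sub>c\<^sup>d\<close> with the sign convention
  \<open>(\<nabla>\<^sub>a \<nabla>\<^sub>b - \<nabla>\<^sub>b \<nabla>\<^sub>a) \<omega>\<^sub>c = R\<^sub>a\<^sub>b\<^sub>c\<^sup>d \<omega>\<^sub>d\<close>, and
  \<open>r\<^sub>a\<^sub>c = R\<^sub>a\<^sub>b\<^sub>c\<^sup>b\<close>, which is positive on round spheres.\<close>

definition riemann ::
    "(real ^ 'n \<Rightarrow> real ^ 'n ^ 'n) \<Rightarrow> real ^ 'n \<Rightarrow> 'n::finite \<Rightarrow> 'n \<Rightarrow> 'n \<Rightarrow> 'n \<Rightarrow> real" where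
  "riemann G x a b c d =
     pderiv_at b (\<lambda>y. christoffel G y d a c) x - pderiv_at a (\<lambda>y. christoffel G y d b c) x
     + (\<Sum>e\<in>UNIV. christoffel G x d b e * christoffel G x e a c
                 - christoffel G x d a e * christoffel G x e b c)"

definition ricci ::
    "(real ^ 'n \<Rightarrow> real ^ 'n ^ 'n) \<Rightarrow> real ^ 'n \<Rightarrow> 'n::finite \<Rightarrow> 'n \<Rightarrow> real" where
  "ricci G x a c = (\<Sum>b\<in>UNIV. riemann G x a b c b)"

definition ricci_scalar :: "(real ^ 'n \<Rightarrow> real ^ 'n ^ 'n) \<Rightarrow> real ^ 'n::finite \<Rightarrow> real" where
  "ricci_scalar G x = (\<Sum>a\<in>UNIV. \<Sum>b\<in>UNIV. matrix_inv (G x) $ a $ b * ricci G x a b)"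

definition schouten ::
    "(real ^ 'n \<Rightarrow> real ^ 'n ^ 'n) \<Rightarrow> real ^ 'n \<Rightarrow> 'n::finite \<Rightarrow> 'n \<Rightarrow> real" where
  "schouten G x a b =
     (ricci G x a b - ricci_scalar G x * G x $ a $ b / (2 * (real CARD('n) - 1)))
       / (real CARD('n) - 2)"

text \<open>\<open>P\<^sup>a\<^sub>b = g\<^sup>a\<^sup>c P\<^sub>c\<^sub>b\<close>\<close>

definition schouten_mixed ::
    "(real ^ 'n \<Rightarrow> real ^ 'n ^ 'n) \<Rightarrow> real ^ 'n \<Rightarrow> 'n::finite \<Rightarrow> 'n \<Rightarrow> real" where
  "schouten_mixed G x a b = (\<Sum>c\<in>UNIV. matrix_inv (G x) $ a $ c * schouten G x c b)"

text \<open>The Weyl tensor \<open>W\<^sub>a\<^sub>b\<^sub>c\<^sup>d\<close> is the totally trace-free part of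
  \<open>R\<^sub>a\<^sub>b\<^sub>c\<^sup>d\<close>:
  \<open>R\<^sub>a\<^sub>b\<^sub>c\<^sub>d = W\<^sub>a\<^sub>b\<^sub>c\<^sub>d + g\<^sub>a\<^sub>c P\<^sub>d\<^sub>b - g\<^sub>a\<^sub>d P\<^sub>c\<^sub>b - g\<^sub>b\<^sub>c P\<^sub>d\<^sub>a + g\<^sub>b\<^sub>d P\<^sub>c\<^sub>a\<close>.\<close>

definition weyl ::
    "(real ^ 'n \<Rightarrow> real ^ 'n ^ 'n) \<Rightarrow> real ^ 'n \<Rightarrow> 'n::finite \<Rightarrow> 'n \<Rightarrow> 'n \<Rightarrow> 'n \<Rightarrow> real" where
  "weyl G x a b c d =
     riemann G x a b c d
     - (G x $ a $ c * schouten_mixed G x d b - (if a = d then schouten G x c b else 0)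
        - G x $ b $ c * schouten_mixed G x d a + (if b = d then schouten G x c a else 0))"

text \<open>\<open>nabla_schouten G x c a b\<close> is \<open>\<nabla>\<^sub>c P\<^sub>a\<^sub>b\<close>.\<close>

definition nabla_schouten ::
    "(real ^ 'n \<Rightarrow> real ^ 'n ^ 'n) \<Rightarrow> real ^ 'n \<Rightarrow> 'n::finite \<Rightarrow> 'n \<Rightarrow> 'n \<Rightarrow> real" where
  "nabla_schouten G x c a b =
     pderiv_at c (\<lambda>y. schouten G y a b) x
     - (\<Sum>e\<in>UNIV. christoffel G x e c a * schouten G x e b + christoffel G x e c b * schouten G x a e)"


section \<open>Tangent vectors and vector fields along a curve\<close>

text \<open>A tangent vector at \<open>p\<close> is given by its components in every chart of the atlas around
  \<open>p\<close> (its values at other charts are irrelevant), and a vector field along a curve is a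
  function \<open>real \<Rightarrow> ('m, 'n) tvec\<close> of the curve parameter. Scalars formed from tangent vectors at
  \<open>p\<close> do not depend on the chart around \<open>p\<close> and are evaluated in the arbitrarily chosen one
  \<open>chart_at M p\<close>.\<close>

type_synonym ('m, 'n) tvec = "('m, 'n) chart \<Rightarrow> real ^ 'n"

definition chart_at :: "('m, 'n::finite) metric_manifold \<Rightarrow> 'm \<Rightarrow> ('m, 'n) chart" where
  "chart_at M p = (SOME c. c \<in> Atlas M \<and> p \<in> fst c)"

definition ip :: "('m, 'n::finite) metric_manifold \<Rightarrow> 'm \<Rightarrow> ('m, 'n) tvec \<Rightarrow> ('m, 'n) tvec \<Rightarrow> real" where
  "ip M p X Y = (let c = chart_at M p in X c \<bullet> (Metric M c (snd c p) *v Y c))"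

definition schouten_form ::
    "('m, 'n::finite) metric_manifold \<Rightarrow> 'm \<Rightarrow> ('m, 'n) tvec \<Rightarrow> ('m, 'n) tvec \<Rightarrow> real" where
  "schouten_form M p X Y =
     (let c = chart_at M p
      in \<Sum>a\<in>UNIV. \<Sum>b\<in>UNIV. schouten (Metric M c) (snd c p) a b * X c $ a * Y c $ b)"

definition schouten_sharp ::
    "('m, 'n::finite) metric_manifold \<Rightarrow> 'm \<Rightarrow> ('m, 'n) tvec \<Rightarrow> ('m, 'n) tvec" where
  "schouten_sharp M p X =
     (\<lambda>c. \<chi> a. \<Sum>b\<in>UNIV. schouten_mixed (Metric M c) (snd c p) a b * X c $ b)"

text \<open>In the following \<open>T\<close> is the parameter interval of the curve \<open>\<gamma>\<close>; derivatives at its end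
  points are one-sided.\<close>

definition velocity :: "real set \<Rightarrow> (real \<Rightarrow> 'm) \<Rightarrow> real \<Rightarrow> ('m, 'n::finite) tvec" where
  "velocity T \<gamma> t = (\<lambda>c. vector_derivative (\<lambda>\<tau>. snd c (\<gamma> \<tau>)) (at t within T))"

definition cov_deriv ::
    "('m, 'n::finite) metric_manifold \<Rightarrow> real set \<Rightarrow> (real \<Rightarrow> 'm) \<Rightarrow>
     (real \<Rightarrow> ('m, 'n) tvec) \<Rightarrow> real \<Rightarrow> ('m, 'n) tvec" where
  "cov_deriv M T \<gamma> X t =
     (\<lambda>c. vector_derivative (\<lambda>\<tau>. X \<tau> c) (at t within T)
        + (\<chi> a. \<Sum>b\<in>UNIV. \<Sum>d\<in>UNIV. christoffel (Metric M c) (snd c (\<gamma> t)) a b d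
                                  * velocity T \<gamma> t c $ b * X t c $ d))"

definition acceleration ::
    "('m, 'n::finite) metric_manifold \<Rightarrow> real set \<Rightarrow> (real \<Rightarrow> 'm) \<Rightarrow> real \<Rightarrow> ('m, 'n) tvec" where
  "acceleration M T \<gamma> = cov_deriv M T \<gamma> (velocity T \<gamma>)"

definition conf_geodesic_E ::
    "('m, 'n::finite) metric_manifold \<Rightarrow> real set \<Rightarrow> (real \<Rightarrow> 'm) \<Rightarrow> real \<Rightarrow> ('m, 'n) tvec" where
  "conf_geodesic_E M T \<gamma> t =
     (let U = velocity T \<gamma> t; A = acceleration M T \<gamma> t; p = \<gamma> t
      in (\<lambda>c. cov_deriv M T \<gamma> (acceleration M T \<gamma>) t c
           - (3 * ip M p U A / ip M p U U) *\<^sub>R A c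
           + (3 * ip M p A A / (2 * ip M p U U)) *\<^sub>R U c
           - ip M p U U *\<^sub>R schouten_sharp M p U c
           + (2 * schouten_form M p U U) *\<^sub>R U c))"

definition lagrangian ::
    "('m, 'n::finite) metric_manifold \<Rightarrow> real set \<Rightarrow> (real \<Rightarrow> 'm) \<Rightarrow> real \<Rightarrow> real" where
  "lagrangian M T \<gamma> t =
     ip M (\<gamma> t) (velocity T \<gamma> t) (conf_geodesic_E M T \<gamma> t)
       / ip M (\<gamma> t) (velocity T \<gamma> t) (velocity T \<gamma> t)"

definition action ::
    "('m, 'n::finite) metric_manifold \<Rightarrow> real \<Rightarrow> real \<Rightarrow> (real \<Rightarrow> 'm) \<Rightarrow> real" where
  "action M t0 t1 \<gamma> = integral {t0..t1} (lagrangian M {t0..t1} \<gamma>)"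

definition op_D ::
    "('m, 'n::finite) metric_manifold \<Rightarrow> real set \<Rightarrow> (real \<Rightarrow> 'm) \<Rightarrow>
     (real \<Rightarrow> ('m, 'n) tvec) \<Rightarrow> real \<Rightarrow> ('m, 'n) tvec" where
  "op_D M T \<gamma> V t =
     (let U = velocity T \<gamma> t; A = acceleration M T \<gamma> t; p = \<gamma> t
      in (\<lambda>c. cov_deriv M T \<gamma> V t c
           + (1 / ip M p U U) *\<^sub>R
               (ip M p A (V t) *\<^sub>R U c - ip M p U (V t) *\<^sub>R A c - ip M p A U *\<^sub>R V t c)))"

text \<open>The covector in parentheses is
  \<open>W\<^sub>f\<^sub>c\<^sub>a\<^sup>d U\<^sup>a U\<^sup>f A\<^sub>d + 2 |U|\<^sup>2 \<nabla>\<^bsub>[c\<^esub> P\<^bsub>a]f\<^esub> U\<^sup>a U\<^sup>f\<close> with the bracket written out.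
  ERRATUM: the published formula for \<open>K\<close> has a minus sign in front of its second term, for which
  the first variation formula is false whatever the sign convention for \<open>W\<close>. Indeed, on an
  affinely parametrised geodesic (\<open>A = 0\<close>) the Weyl term vanishes, and the \<open>P\<close>-part of the
  formula, which comes from varying \<open>\<integral> P(U,U) dt\<close>, reads
  \<open>(\<nabla>\<^sub>V P)(U,U) + 2 P(U,\<nabla>\<^sub>U V) = |U|\<^bsup>-2\<^esup> \<langle>K,V\<rangle> + P(U,\<nabla>\<^sub>U V) + d/dt P(U,V)\<close>,
  so \<open>\<langle>K,V\<rangle> = |U|\<^sup>2 ((\<nabla>\<^sub>V P)(U,U) - (\<nabla>\<^sub>U P)(V,U))\<close>.\<close>

definition vector_K ::
    "('m, 'n::finite) metric_manifold \<Rightarrow> real set \<Rightarrow> (real \<Rightarrow> 'm) \<Rightarrow> real \<Rightarrow> ('m, 'n) tvec" where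
  "vector_K M T \<gamma> t =
     (\<lambda>\<kappa>. let G = Metric M \<kappa>; x = snd \<kappa> (\<gamma> t);
            U = velocity T \<gamma> t \<kappa>; A = acceleration M T \<gamma> t \<kappa>; A\<^sub>l = G x *v A
        in \<chi> e. \<Sum>c\<in>UNIV. matrix_inv (G x) $ e $ c *
             ((\<Sum>a\<in>UNIV. \<Sum>f\<in>UNIV. \<Sum>d\<in>UNIV. weyl G x f c a d * U $ a * U $ f * A\<^sub>l $ d)
              + 2 * ip M (\<gamma> t) (velocity T \<gamma> t) (velocity T \<gamma> t) *
                (\<Sum>a\<in>UNIV. \<Sum>f\<in>UNIV.
                   (nabla_schouten G x c a f - nabla_schouten G x a c f) / 2 * U $ a * U $ f)))"

definition E_minus_2LU ::
    "('m, 'n::finite) metric_manifold \<Rightarrow> real set \<Rightarrow> (real \<Rightarrow> 'm) \<Rightarrow> real \<Rightarrow> ('m, 'n) tvec" where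
  "E_minus_2LU M T \<gamma> t =
     (\<lambda>c. conf_geodesic_E M T \<gamma> t c - (2 * lagrangian M T \<gamma> t) *\<^sub>R velocity T \<gamma> t c)"

definition boundary_B ::
    "('m, 'n::finite) metric_manifold \<Rightarrow> real set \<Rightarrow> (real \<Rightarrow> 'm) \<Rightarrow>
     (real \<Rightarrow> ('m, 'n) tvec) \<Rightarrow> real \<Rightarrow> real" where
  "boundary_B M T \<gamma> V t =
     1 / ip M (\<gamma> t) (velocity T \<gamma> t) (velocity T \<gamma> t) *
       (ip M (\<gamma> t) (velocity T \<gamma> t) (op_D M T \<gamma> (op_D M T \<gamma> V) t)
        - ip M (\<gamma> t) (E_minus_2LU M T \<gamma> t) (V t))"

text \<open>A variation is written in curried form: \<open>\<Gamma> s t\<close>, where \<open>s\<close> is the variation parameter.\<close>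

definition is_variation ::
    "('m, 'n::finite) metric_manifold \<Rightarrow> real \<Rightarrow> real \<Rightarrow> (real \<Rightarrow> 'm) \<Rightarrow>
     (real \<Rightarrow> real \<Rightarrow> 'm) \<Rightarrow> bool" where
  "is_variation M t0 t1 \<gamma> \<Gamma> \<longleftrightarrow>
     smooth_map_on M ({-1..1} \<times> {t0..t1}) (\<lambda>(s, t). \<Gamma> s t) \<and> (\<forall>t\<in>{t0..t1}. \<Gamma> 0 t = \<gamma> t)"

definition variation_field :: "(real \<Rightarrow> real \<Rightarrow> 'm) \<Rightarrow> real \<Rightarrow> ('m, 'n::finite) tvec" where
  "variation_field \<Gamma> t = (\<lambda>c. vector_derivative (\<lambda>s. snd c (\<Gamma> s t)) (at 0))"

end

theory Submission
  imports Defs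
begin

text \<open>Throughout, \<open>U\<close> and \<open>V\<close> are the two coordinate fields of the variation \<open>\<Gamma> s t\<close> (along \<open>t\<close> and along
  \<open>s\<close>), \<open>A = \<nabla>\<^sub>U U\<close>, \<open>u = |U|\<^sup>2\<close>, \<open>P\<close> is the Schouten form, and \<open>D\<close> is the operator \<open>op_D\<close>. The Lagrangian is the scalar
  \<open>L = u\<^bsup>-1\<^esup>\<langle>U,\<nabla>\<^sub>U A\<rangle> - 3 u\<^bsup>-2\<^esup>\<langle>U,A\<rangle>\<^sup>2 + 3/2 u\<^bsup>-1\<^esup>|A|\<^sup>2 + P(U,U)\<close>.
  Its derivative in \<open>s\<close> is taken with three rules: the connection is metric (\<open>has_pd_ip\<close>),
  \<open>\<nabla>\<^sub>V U = \<nabla>\<^sub>U V\<close> (\<open>covd_vel\<close>), and \<open>\<nabla>\<^sub>V \<nabla>\<^sub>U X = \<nabla>\<^sub>U \<nabla>\<^sub>V X + R(V,U)X\<close> (\<open>covd_commute\<close>). Because \<open>R(V,U)\<close> is skew, a derivative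
  of the curvature never appears, and altogether the curvature contributes the single term
  \<open>u\<^bsup>-1\<^esup>\<langle>A, R(V,U)U\<rangle>\<close> (\<open>has_pd_s_atoms\<close>, \<open>ip_U_s_jerk\<close>). Splitting \<open>R\<close> into the Weyl tensor and products of the metric with
  \<open>P\<close> (\<open>weyl_contraction\<close>) yields the Weyl part of \<open>\<langle>K,V\<rangle>\<close>. The remaining Schouten terms combine with the
  derivative of \<open>P(U,U)\<close> into the other part of \<open>\<langle>K,V\<rangle>\<close>, into the Schouten part of \<open>\<langle>E - 2LU, DV\<rangle>\<close>, and into the total
  derivative of \<open>P(U,V)\<close>.

  For the boundary term, \<open>D\<close> satisfies \<open>DU = 0\<close> and is compatible with the product \<open>u\<^bsup>-1\<^esup>\<langle>_,_\<rangle>\<close>. Hence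
  \<open>u\<^bsup>-1\<^esup>\<langle>U,DX\<rangle>\<close> is the derivative of \<open>u\<^bsup>-1\<^esup>\<langle>U,X\<rangle>\<close> (\<open>has_pd_iu_ip\<close>), and \<open>u\<^bsup>-1\<^esup>\<langle>U,D\<^sup>2V\<rangle>\<close> is the second derivative of
  \<open>u\<^bsup>-1\<^esup>\<langle>U,V\<rangle>\<close>. Once everything is written in inner products, \<open>\<partial>\<^sub>s L\<close> equals the integrand of the theorem plus
  the derivative of the boundary term by a polynomial identity (\<open>first_variation_pointwise\<close>). Integrating over the
  parameter interval and differentiating under the integral sign gives the theorem.

  What remains is chart independence. The scalars above are evaluated, at each
  point separately, in an arbitrarily chosen chart, so they can only be differentiated once they are known
  not to depend on it. For covariant derivatives this follows from the Koszul formula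
  (\<open>chr_transform\<close>, \<open>cov_push\<close>); since the curvature is a commutator of covariant derivatives it is a
  tensor too (\<open>curv_transform\<close>), and with it its traces and the Schouten form. At the ends of the
  parameter interval derivatives are one-sided and are computed from local smooth extensions.\<close>

section \<open>Smooth maps between normed spaces\<close>

abbreviation dd :: "('a::real_normed_vector \<Rightarrow> 'b::real_normed_vector) \<Rightarrow> 'a \<Rightarrow> 'a \<Rightarrow> 'b" where
  "dd f x v \<equiv> frechet_derivative f (at x) v"

lemma frechet_derivative_cong_open:
  assumes "open S" "x \<in> S" "\<And>y. y \<in> S \<Longrightarrow> f y = g y"
  shows "frechet_derivative f (at x) = frechet_derivative g (at x)"
  unfolding frechet_derivative_def
  by (rule arg_cong[where f=Eps], rule ext)
    (metis assms has_derivative_transform_within_open)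

lemma Ck_on_cong:
  assumes "open S" "\<And>x. x \<in> S \<Longrightarrow> f x = g x"
  shows "Ck_on k S f \<longleftrightarrow> Ck_on k S g"
  using assms(2)
proof (induction k arbitrary: f g)
  case 0
  then show ?case by (simp cong: continuous_on_cong)
next
  case (Suc k)
  have d: "f differentiable_on S \<longleftrightarrow> g differentiable_on S"
    using Suc.prems by (auto simp: differentiable_on_def intro: differentiable_transform_within[OF _ zero_less_one])
  have e: "frechet_derivative f (at x) = frechet_derivative g (at x)" if "x \<in> S" for x
    by (rule frechet_derivative_cong_open[OF assms(1) that Suc.prems])
  show ?case
    using d Suc.IH[of "\<lambda>x. dd f x v" "\<lambda>x. dd g x v" for v] e
    by auto
qed

lemma Ck_on_mono: "Ck_on k S f \<Longrightarrow> S' \<subseteq> S \<Longrightarrow> Ck_on k S' f"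
  by (induction k arbitrary: f) (auto intro: continuous_on_subset differentiable_on_subset)

lemma Ck_on_SucD: "Ck_on (Suc k) S f \<Longrightarrow> Ck_on k S f"
proof (induction k arbitrary: f)
  case 0 then show ?case by (auto intro: differentiable_imp_continuous_on)
next
  case (Suc k) then show ?case by simp
qed

lemma Ck_on_const: "Ck_on k S (\<lambda>x. c)"
  by (induction k arbitrary: c) auto

lemma differentiable_on_openD:
  "f differentiable_on S \<Longrightarrow> open S \<Longrightarrow> x \<in> S \<Longrightarrow> f differentiable (at x)"
  by (metis at_within_open differentiable_on_def)

lemma differentiable_on_has_frechet_derivative:
  "f differentiable_on S \<Longrightarrow> open S \<Longrightarrow> x \<in> S \<Longrightarrow> (f has_derivative frechet_derivative f (at x)) (at x)"
  using differentiable_on_openD frechet_derivative_works by blast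

lemma Ck_on_linear:
  assumes "bounded_linear h" "Ck_on k S f" "open S"
  shows "Ck_on k S (\<lambda>x. h (f x))"
  using assms(2)
proof (induction k arbitrary: f)
  case 0 then show ?case by (auto intro: bounded_linear.continuous_on[OF assms(1)])
next
  case (Suc k)
  have d: "((\<lambda>x. h (f x)) has_derivative (\<lambda>v. h (dd f x v))) (at x)" if "x \<in> S" for x
    using Suc.prems that assms(3)
    by (auto intro!: differentiable_on_has_frechet_derivative bounded_linear.has_derivative[OF assms(1)])
  then have "frechet_derivative (\<lambda>x. h (f x)) (at x) = (\<lambda>v. h (dd f x v))" if "x \<in> S" for x
    using frechet_derivative_at[OF d[OF that]] by simp
  then have "Ck_on k S (\<lambda>x. dd (\<lambda>x. h (f x)) x v)
     = Ck_on k S (\<lambda>x. h (dd f x v))" for v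
    by (intro Ck_on_cong[OF assms(3)]) simp
  moreover have "(\<lambda>x. h (f x)) differentiable_on S"
    using d by (auto simp: differentiable_on_def intro: differentiableI has_derivative_at_withinI)
  ultimately show ?case using Suc by simp
qed

lemma Ck_on_add:
  assumes "open S" "Ck_on k S f" "Ck_on k S g"
  shows "Ck_on k S (\<lambda>x. f x + g x)"
  using assms(2,3)
proof (induction k arbitrary: f g)
  case 0 then show ?case by (auto intro: continuous_intros)
next
  case (Suc k)
  have d: "((\<lambda>x. f x + g x) has_derivative (\<lambda>v. dd f x v + dd g x v)) (at x)" if "x \<in> S" for x
    using Suc.prems that assms(1)
    by (auto intro!: differentiable_on_has_frechet_derivative has_derivative_add)
  then have "Ck_on k S (\<lambda>x. dd (\<lambda>x. f x + g x) x v)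
     = Ck_on k S (\<lambda>x. dd f x v + dd g x v)" for v
    by (intro Ck_on_cong[OF assms(1)]) (simp add: frechet_derivative_at[OF d, symmetric])
  moreover have "(\<lambda>x. f x + g x) differentiable_on S"
    using d by (auto simp: differentiable_on_def intro: differentiableI has_derivative_at_withinI)
  ultimately show ?case using Suc by simp
qed

lemma Ck_on_bilinear:
  assumes "bounded_bilinear h" "open S" "Ck_on k S f" "Ck_on k S g"
  shows "Ck_on k S (\<lambda>x. h (f x) (g x))"
  using assms(3,4)
proof (induction k arbitrary: f g)
  case 0 then show ?case by (auto intro: bounded_bilinear.continuous_on[OF assms(1)])
next
  case (Suc k)
  have d: "((\<lambda>x. h (f x) (g x)) has_derivative (\<lambda>v. h (f x) (dd g x v) + h (dd f x v) (g x))) (at x)" if "x \<in> S" for x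
    using Suc.prems that assms(2)
    by (auto intro!: differentiable_on_has_frechet_derivative bounded_bilinear.FDERIV[OF assms(1)])
  then have "Ck_on k S (\<lambda>x. dd (\<lambda>x. h (f x) (g x)) x v)
     = Ck_on k S (\<lambda>x. h (f x) (dd g x v) + h (dd f x v) (g x))" for v
    by (intro Ck_on_cong[OF assms(2)]) (simp add: frechet_derivative_at[OF d, symmetric])
  moreover have "(\<lambda>x. h (f x) (g x)) differentiable_on S"
    using d by (auto simp: differentiable_on_def intro: differentiableI has_derivative_at_withinI)
  moreover have "Ck_on k S f" "Ck_on k S g" using Suc.prems Ck_on_SucD by blast+
  ultimately show ?case using Suc.IH Suc.prems by (auto intro!: Ck_on_add assms(2))
qed

lemma Ck_on_sum:
  assumes "open S" "\<And>i. i \<in> A \<Longrightarrow> Ck_on k S (f i)"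
  shows "Ck_on k S (\<lambda>x. \<Sum>i\<in>A. f i x)"
  using assms(2) by (induction A rule: infinite_finite_induct) (auto intro: Ck_on_const Ck_on_add assms(1))

text \<open>The chain rule evaluates the derivative of \<open>f\<close> in a direction that varies with the point.
  Expanding that direction in \<open>Basis\<close> leaves derivatives in fixed directions only, the ones that
  \<open>Ck_on\<close> speaks about.\<close>

lemma Ck_on_compose:
  fixes f :: "'b::euclidean_space \<Rightarrow> 'c::real_normed_vector" and g :: "'a::real_normed_vector \<Rightarrow> 'b"
  assumes "open S" "open S'" "Ck_on k S' f" "Ck_on k S g" "g ` S \<subseteq> S'"
  shows "Ck_on k S (\<lambda>x. f (g x))"
  using assms(3,4)
proof (induction k arbitrary: f)
  case 0 then show ?case using assms(5) by (auto intro: continuous_on_compose2)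
next
  case (Suc k)
  have d: "((\<lambda>x. f (g x)) has_derivative (\<lambda>v. frechet_derivative f (at (g x)) (dd g x v))) (at x)" if "x \<in> S" for x
  proof -
    have "g x \<in> S'" using that assms(5) by auto
    then have "(f has_derivative frechet_derivative f (at (g x))) (at (g x))"
      using Suc.prems(1) assms(2) by (auto intro!: differentiable_on_has_frechet_derivative)
    moreover have "(g has_derivative frechet_derivative g (at x)) (at x)"
      using Suc.prems(2) that assms(1) by (auto intro!: differentiable_on_has_frechet_derivative)
    ultimately show ?thesis
      using diff_chain_at[of g "frechet_derivative g (at x)" x f] by (simp add: o_def)
  qed
  have e: "dd (\<lambda>x. f (g x)) x v
     = (\<Sum>b\<in>Basis. (dd g x v \<bullet> b) *\<^sub>R dd f (g x) b)" if "x \<in> S" for x v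
  proof -
    have L: "linear (frechet_derivative f (at (g x)))"
      using that assms(2,5) Suc.prems(1) by (auto intro!: linear_frechet_derivative differentiable_on_openD)
    then have *: "frechet_derivative f (at (g x)) (\<Sum>b\<in>Basis. (w \<bullet> b) *\<^sub>R b)
       = (\<Sum>b\<in>Basis. (w \<bullet> b) *\<^sub>R dd f (g x) b)" for w
      by (simp only: linear_sum[OF L] linear_cmul[OF L])
    have E: "dd f (g x) w
       = (\<Sum>b\<in>Basis. (w \<bullet> b) *\<^sub>R dd f (g x) b)" for w
      by (rule trans[OF arg_cong[where f="frechet_derivative f (at (g x))", OF euclidean_representation[of w, symmetric]] *])
    show ?thesis unfolding frechet_derivative_at[OF d[OF that], symmetric] by (rule E)
  qed
  have "Ck_on k S (\<lambda>x. \<Sum>b\<in>Basis. (dd g x v \<bullet> b) *\<^sub>R dd f (g x) b)" for v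
  proof -
    have "Ck_on k S g" using Suc.prems(2) Ck_on_SucD by blast
    then show ?thesis using Suc.prems Suc.IH[of "\<lambda>y. dd f y b" for b]
    by (intro Ck_on_sum assms(1) Ck_on_bilinear[OF bounded_bilinear_scaleR]
         Ck_on_linear[OF bounded_linear_inner_left]) auto
  qed
  then have "Ck_on k S (\<lambda>x. dd (\<lambda>x. f (g x)) x v)" for v
    by (subst Ck_on_cong[OF assms(1) e]) auto
  moreover have "(\<lambda>x. f (g x)) differentiable_on S"
    using d by (auto simp: differentiable_on_def intro: differentiableI has_derivative_at_withinI)
  ultimately show ?case by simp
qed

lemma Ck_on_inverse:
  fixes f :: "'a::real_normed_vector \<Rightarrow> real"
  assumes "open S" "Ck_on k S f" "\<And>x. x \<in> S \<Longrightarrow> f x \<noteq> 0"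
  shows "Ck_on k S (\<lambda>x. inverse (f x))"
  using assms(2)
proof (induction k)
  case 0 then show ?case using assms(3) by (auto intro!: continuous_on_inverse)
next
  case (Suc k)
  have d: "((\<lambda>x. inverse (f x)) has_derivative (\<lambda>v. - (inverse (f x) * dd f x v * inverse (f x)))) (at x)" if "x \<in> S" for x
    by (rule Deriv.has_derivative_inverse)
      (use Suc.prems that assms(1,3) in \<open>auto intro: differentiable_on_has_frechet_derivative\<close>)
  have "Ck_on k S (\<lambda>x. - (inverse (f x) * dd f x v * inverse (f x)))" for v
    using Suc.IH Suc.prems Ck_on_SucD[OF Suc.prems]
    by (auto intro!: assms(1) Ck_on_bilinear[OF bounded_bilinear_mult] Ck_on_linear[OF bounded_linear_minus[OF bounded_linear_ident]])
  then have "Ck_on k S (\<lambda>x. dd (\<lambda>x. inverse (f x)) x v)" for v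
    by (subst Ck_on_cong[OF assms(1), of _ "\<lambda>x. - (inverse (f x) * dd f x v * inverse (f x))"])
      (auto simp: frechet_derivative_at[OF d, symmetric])
  moreover have "(\<lambda>x. inverse (f x)) differentiable_on S"
    using d by (auto simp: differentiable_on_def intro: differentiableI has_derivative_at_withinI)
  ultimately show ?case by simp
qed

lemma smooth_on_cong:
  assumes "open S" "\<And>x. x \<in> S \<Longrightarrow> f x = g x"
  shows "smooth_on S f \<longleftrightarrow> smooth_on S g"
  unfolding smooth_on_def using Ck_on_cong[OF assms] by auto

lemma smooth_on_subset: "smooth_on S f \<Longrightarrow> S' \<subseteq> S \<Longrightarrow> smooth_on S' f"
  unfolding smooth_on_def using Ck_on_mono by blast

lemma smooth_on_frechet_derivative: "smooth_on S f \<Longrightarrow> smooth_on S (\<lambda>x. dd f x v)"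
  unfolding smooth_on_def by (metis Ck_on.simps(2))

lemma smooth_on_differentiable: "smooth_on S f \<Longrightarrow> open S \<Longrightarrow> x \<in> S \<Longrightarrow> f differentiable (at x)"
  unfolding smooth_on_def by (metis Ck_on.simps(2) differentiable_on_openD)

lemma smooth_on_continuous_on: "smooth_on S f \<Longrightarrow> continuous_on S f"
  unfolding smooth_on_def by (metis Ck_on.simps(1))

lemma smooth_on_const: "smooth_on S (\<lambda>x. c)"
  unfolding smooth_on_def by (simp add: Ck_on_const)

lemma smooth_on_linear: "bounded_linear h \<Longrightarrow> open S \<Longrightarrow> smooth_on S f \<Longrightarrow> smooth_on S (\<lambda>x. h (f x))"
  unfolding smooth_on_def by (simp add: Ck_on_linear)

lemma smooth_on_add: "open S \<Longrightarrow> smooth_on S f \<Longrightarrow> smooth_on S g \<Longrightarrow> smooth_on S (\<lambda>x. f x + g x)"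
  unfolding smooth_on_def by (simp add: Ck_on_add)

lemma smooth_on_bilinear: "bounded_bilinear h \<Longrightarrow> open S \<Longrightarrow> smooth_on S f \<Longrightarrow> smooth_on S g \<Longrightarrow> smooth_on S (\<lambda>x. h (f x) (g x))"
  unfolding smooth_on_def by (simp add: Ck_on_bilinear)

lemmas smooth_on_mult = smooth_on_bilinear[OF bounded_bilinear_mult]
lemmas smooth_on_scaleR = smooth_on_bilinear[OF bounded_bilinear_scaleR]
lemmas smooth_on_minus = smooth_on_linear[OF bounded_linear_minus[OF bounded_linear_ident]]
lemmas smooth_on_vec_nth = smooth_on_linear[OF bounded_linear_vec_nth]
lemma smooth_on_diff: "open S \<Longrightarrow> smooth_on S f \<Longrightarrow> smooth_on S g \<Longrightarrow> smooth_on S (\<lambda>x. f x - g x)"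
  using smooth_on_add[of S f "\<lambda>x. - g x"] smooth_on_minus[of S g] by simp

lemma smooth_on_sum: "open S \<Longrightarrow> (\<And>i. i \<in> A \<Longrightarrow> smooth_on S (f i)) \<Longrightarrow> smooth_on S (\<lambda>x. \<Sum>i\<in>A. f i x)"
  unfolding smooth_on_def by (auto intro: Ck_on_sum)

lemma smooth_on_prod:
  fixes f :: "'i \<Rightarrow> 'a::real_normed_vector \<Rightarrow> real"
  shows "open S \<Longrightarrow> (\<And>i. i \<in> A \<Longrightarrow> smooth_on S (f i)) \<Longrightarrow> smooth_on S (\<lambda>x. \<Prod>i\<in>A. f i x)"
  by (induction A rule: infinite_finite_induct) (auto intro!: smooth_on_const smooth_on_mult)

lemma smooth_on_inverse:
  fixes f :: "'a::real_normed_vector \<Rightarrow> real"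
  shows "open S \<Longrightarrow> smooth_on S f \<Longrightarrow> (\<And>x. x \<in> S \<Longrightarrow> f x \<noteq> 0) \<Longrightarrow> smooth_on S (\<lambda>x. inverse (f x))"
  unfolding smooth_on_def by (simp add: Ck_on_inverse)

lemma smooth_on_compose:
  fixes f :: "'b::euclidean_space \<Rightarrow> 'c::real_normed_vector" and g :: "'a::real_normed_vector \<Rightarrow> 'b"
  shows "open S \<Longrightarrow> open S' \<Longrightarrow> smooth_on S' f \<Longrightarrow> smooth_on S g \<Longrightarrow> g ` S \<subseteq> S' \<Longrightarrow> smooth_on S (\<lambda>x. f (g x))"
  unfolding smooth_on_def using Ck_on_compose by blast

lemma smooth_on_ident: "open S \<Longrightarrow> smooth_on S (\<lambda>x. x)"
  unfolding smooth_on_def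
proof
  fix k show "Ck_on k S (\<lambda>x. x)" if "open S"
  proof (cases k)
    case (Suc l) then show ?thesis by (simp add: differentiable_on_def frechet_derivative_ident Ck_on_const)
  qed auto
qed

lemma smooth_on_vec_lambda:
  fixes f :: "'i::finite \<Rightarrow> 'a::real_normed_vector \<Rightarrow> real"
  assumes "open S" "\<And>i. smooth_on S (f i)"
  shows "smooth_on S (\<lambda>x. \<chi> i. f i x)"
proof -
  have "(\<lambda>x. \<chi> i. f i x) = (\<lambda>x. \<Sum>i\<in>UNIV. f i x *\<^sub>R axis i 1)"
    by (auto simp: vec_eq_iff axis_def if_distrib cong: if_cong)
  then show ?thesis
    using assms by (auto intro!: smooth_on_sum smooth_on_scaleR smooth_on_const)
qed

lemma smooth_on_det:
  fixes A :: "'a::real_normed_vector \<Rightarrow> real^'n^'n"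
  assumes "open S" "\<And>i j. smooth_on S (\<lambda>x. A x $ i $ j)"
  shows "smooth_on S (\<lambda>x. det (A x))"
  unfolding det_def
  by (intro smooth_on_sum smooth_on_mult smooth_on_prod smooth_on_const assms)

lemma matrix_inv_right:
  fixes A :: "real^'n^'n"
  assumes "invertible A"
  shows "A ** matrix_inv A = mat 1"
  using assms unfolding invertible_def matrix_inv_def by (rule someI2_ex) simp

text \<open>Cramer's rule: an entry of the inverse is a quotient of two polynomials in the entries.\<close>

lemma smooth_on_matrix_inv:
  fixes A :: "'a::real_normed_vector \<Rightarrow> real^'n^'n"
  assumes "open S" "\<And>i j. smooth_on S (\<lambda>x. A x $ i $ j)" "\<And>x. x \<in> S \<Longrightarrow> invertible (A x)"
  shows "smooth_on S (\<lambda>x. matrix_inv (A x) $ i $ j)"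
proof -
  \<comment> \<open>\<open>A x\<close> with its column \<open>i\<close> replaced by the \<open>j\<close>-th unit vector\<close>
  define C where "C x = (\<chi> r s. if s = i then axis j 1 $ r else A x $ r $ s)" for x
  have "matrix_inv (A x) $ i $ j = det (C x) * inverse (det (A x))" if "x \<in> S" for x
  proof -
    have "A x *v (matrix_inv (A x) *v axis j 1) = axis j 1"
      using assms(3)[OF that] by (simp add: matrix_vector_mul_assoc matrix_inv_right)
    then have "(matrix_inv (A x) *v axis j 1) $ i = det (C x) / det (A x)"
      using cramer[of "A x" "matrix_inv (A x) *v axis j 1" "axis j 1"] assms(3)[OF that]
      by (simp add: invertible_det_nz C_def)
    then show ?thesis by (simp add: matrix_vector_mult_basis column_def field_simps)
  qed
  moreover have "smooth_on S (\<lambda>x. det (C x) * inverse (det (A x)))"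
  proof (intro smooth_on_mult smooth_on_inverse smooth_on_det assms)
    show "smooth_on S (\<lambda>x. C x $ r $ s)" for r s
      unfolding C_def using assms(2) by (cases "s = i") (simp_all add: smooth_on_const)
  qed (use assms(3) invertible_det_nz in auto)
  ultimately show ?thesis by (subst smooth_on_cong[OF assms(1)])
qed

section \<open>Symmetry of second derivatives\<close>

lemma has_derivative_along_line:
  fixes f :: "'a::real_normed_vector \<Rightarrow> real"
  assumes "f differentiable (at (y + t *\<^sub>R v))"
  shows "((\<lambda>t. f (y + t *\<^sub>R v)) has_real_derivative dd f (y + t *\<^sub>R v) v) (at t)"
proof -
  have "((\<lambda>t. y + t *\<^sub>R v) has_derivative (\<lambda>h. h *\<^sub>R v)) (at t)"
    by (auto intro!: derivative_eq_intros)
  from diff_chain_at[OF this, of f] assms frechet_derivative_works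
  have "((\<lambda>t. f (y + t *\<^sub>R v)) has_derivative (\<lambda>h. frechet_derivative f (at (y + t *\<^sub>R v)) (h *\<^sub>R v))) (at t)"
    by (auto simp: o_def)
  moreover have "frechet_derivative f (at (y + t *\<^sub>R v)) (h *\<^sub>R v) = h * dd f (y + t *\<^sub>R v) v" for h
    using linear_cmul[OF linear_frechet_derivative[OF assms]] by simp
  ultimately show ?thesis
    by (simp add: has_field_derivative_def mult.commute[of _ "frechet_derivative f _ v"])
qed

text \<open>The mean value theorem, applied in direction \<open>v\<close> to the first difference in direction \<open>w\<close>, and then in
  direction \<open>w\<close>. The second difference itself is symmetric in \<open>v\<close> and \<open>w\<close>, which is what makes the mixed
  derivatives commute.\<close>

lemma second_difference_mean_value:
  fixes f :: "'a::real_normed_vector \<Rightarrow> real"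
  assumes "0 < h" and sm: "smooth_on S f" "open S"
    and in_S: "\<And>a b. \<lbrakk>0 \<le> a; a \<le> h; 0 \<le> b; b \<le> h\<rbrakk> \<Longrightarrow> x + a *\<^sub>R v + b *\<^sub>R w \<in> S"
  obtains a b where "0 < a" "a < h" "0 < b" "b < h"
    "f (x + h *\<^sub>R v + h *\<^sub>R w) - f (x + h *\<^sub>R v) - f (x + h *\<^sub>R w) + f x
      = h * h * dd (\<lambda>y. dd f y v) (x + a *\<^sub>R v + b *\<^sub>R w) w"
proof -
  let ?g = "\<lambda>y. dd f y v"
  have sg: "smooth_on S ?g" by (rule smooth_on_frechet_derivative[OF sm(1)])
  have d1: "((\<lambda>t. f ((x + h *\<^sub>R w) + t *\<^sub>R v) - f (x + t *\<^sub>R v)) has_real_derivative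
      ?g ((x + h *\<^sub>R w) + t *\<^sub>R v) - ?g (x + t *\<^sub>R v)) (at t)" if "0 \<le> t" "t \<le> h" for t
    using in_S[of t h] in_S[of t 0] that assms(1)
    by (intro derivative_intros has_derivative_along_line smooth_on_differentiable[OF sm]) (auto simp: algebra_simps)
  obtain a where a: "0 < a" "a < h" and
    ea: "(f ((x + h *\<^sub>R w) + h *\<^sub>R v) - f (x + h *\<^sub>R v)) - (f ((x + h *\<^sub>R w) + 0 *\<^sub>R v) - f (x + 0 *\<^sub>R v))
      = (h - 0) * (?g ((x + h *\<^sub>R w) + a *\<^sub>R v) - ?g (x + a *\<^sub>R v))"
    using MVT2[OF assms(1) d1] by blast
  have d2: "((\<lambda>t. ?g ((x + a *\<^sub>R v) + t *\<^sub>R w)) has_real_derivative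
      dd ?g ((x + a *\<^sub>R v) + t *\<^sub>R w) w) (at t)" if "0 \<le> t" "t \<le> h" for t
    using in_S[of a t] that a
    by (intro has_derivative_along_line smooth_on_differentiable[OF sg sm(2)]) auto
  obtain b where b: "0 < b" "b < h" and
    eb: "?g ((x + a *\<^sub>R v) + h *\<^sub>R w) - ?g ((x + a *\<^sub>R v) + 0 *\<^sub>R w)
      = (h - 0) * dd ?g ((x + a *\<^sub>R v) + b *\<^sub>R w) w"
    using MVT2[OF assms(1) d2] by blast
  have "(x + h *\<^sub>R w) + a *\<^sub>R v = (x + a *\<^sub>R v) + h *\<^sub>R w" by simp
  with ea eb have "f (x + h *\<^sub>R v + h *\<^sub>R w) - f (x + h *\<^sub>R v) - f (x + h *\<^sub>R w) + f x
      = h * h * dd ?g (x + a *\<^sub>R v + b *\<^sub>R w) w"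
    by (simp add: algebra_simps)
  with a b show ?thesis using that by blast
qed

text \<open>Both mixed derivatives, at suitable points close to \<open>x\<close>, equal the same second difference
  quotient; if they differed at \<open>x\<close>, continuity would keep them apart near \<open>x\<close>.\<close>

lemma symmetric_second_derivative_real:
  fixes f :: "'a::real_normed_vector \<Rightarrow> real"
  assumes sm: "smooth_on S f" "open S" and "x \<in> S"
  shows "dd (\<lambda>y. dd f y v) x w
       = dd (\<lambda>y. dd f y w) x v"
    (is "?P x = ?Q x")
proof (rule ccontr)
  assume "?P x \<noteq> ?Q x"
  define e where "e = \<bar>?P x - ?Q x\<bar> / 2"
  have e: "e > 0" using \<open>?P x \<noteq> ?Q x\<close> by (simp add: e_def)
  have c: "continuous (at x) ?P" "continuous (at x) ?Q"
    using assms by (auto intro!: smooth_on_continuous_on smooth_on_frechet_derivative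
        simp: continuous_on_eq_continuous_at[OF sm(2), symmetric] dest!: bspec
        intro: continuous_on_interior[where S=S] simp: interior_open)
  obtain d1 where d1: "d1 > 0" "\<And>y. dist y x < d1 \<Longrightarrow> dist (?P y) (?P x) < e"
    using c(1) e unfolding continuous_at_eps_delta by blast
  obtain d2 where d2: "d2 > 0" "\<And>y. dist y x < d2 \<Longrightarrow> dist (?Q y) (?Q x) < e"
    using c(2) e unfolding continuous_at_eps_delta by blast
  obtain d3 where d3: "d3 > 0" "ball x d3 \<subseteq> S" using sm(2) assms(3) open_contains_ball by blast
  define d where "d = min d1 (min d2 d3)"
  \<comment> \<open>so small that the parallelogram spanned by \<open>h *\<^sub>R v\<close> and \<open>h *\<^sub>R w\<close> at \<open>x\<close> lies in the ball of radius \<open>d\<close>;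
      the \<open>1\<close> covers \<open>v = w = 0\<close>\<close>
  define h where "h = d / (2 * (norm v + norm w + 1))"
  have nn: "norm v + norm w + 1 > 0" by (smt (verit) norm_ge_zero)
  have d: "d > 0" using d1 d2 d3 by (simp add: d_def)
  have h: "h > 0" using d nn by (simp add: h_def)
  have near: "dist (x + a *\<^sub>R v + b *\<^sub>R w) x < d" if "0 \<le> a" "a \<le> h" "0 \<le> b" "b \<le> h" for a b
  proof -
    have "dist (x + a *\<^sub>R v + b *\<^sub>R w) x = norm (a *\<^sub>R v + b *\<^sub>R w)" by (simp add: dist_norm)
    also have "\<dots> \<le> a * norm v + b * norm w"
      using norm_triangle_ineq[of "a *\<^sub>R v" "b *\<^sub>R w"] that by simp
    also have "\<dots> \<le> h * norm v + h * norm w" using that by (intro add_mono mult_right_mono) auto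
    also have "\<dots> < h * (2 * (norm v + norm w + 1))" using h by (simp add: algebra_simps add_nonneg_pos)
    also have "\<dots> = d" using nn by (simp add: h_def)
    finally show ?thesis .
  qed
  have inS: "x + a *\<^sub>R v + b *\<^sub>R w \<in> S" if "0 \<le> a" "a \<le> h" "0 \<le> b" "b \<le> h" for a b
    using near[OF that] d3 by (auto simp: d_def dist_commute)
  obtain a b where ab: "0 < a" "a < h" "0 < b" "b < h"
    "f (x + h *\<^sub>R v + h *\<^sub>R w) - f (x + h *\<^sub>R v) - f (x + h *\<^sub>R w) + f x = h * h * ?P (x + a *\<^sub>R v + b *\<^sub>R w)"
    using second_difference_mean_value[OF h sm inS] by blast
  have inS': "x + b *\<^sub>R w + a *\<^sub>R v \<in> S" if "0 \<le> b" "b \<le> h" "0 \<le> a" "a \<le> h" for a b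
    using inS[OF that(3,4,1,2)] by (simp add: algebra_simps)
  obtain b' a' where ab': "0 < a'" "a' < h" "0 < b'" "b' < h"
    "f (x + h *\<^sub>R w + h *\<^sub>R v) - f (x + h *\<^sub>R w) - f (x + h *\<^sub>R v) + f x = h * h * ?Q (x + b' *\<^sub>R w + a' *\<^sub>R v)"
    using second_difference_mean_value[OF h sm inS'] by blast
  have sw: "x + h *\<^sub>R w + h *\<^sub>R v = x + h *\<^sub>R v + h *\<^sub>R w" "x + b' *\<^sub>R w + a' *\<^sub>R v = x + a' *\<^sub>R v + b' *\<^sub>R w"
    by simp_all
  have "h * h * ?P (x + a *\<^sub>R v + b *\<^sub>R w) = h * h * ?Q (x + a' *\<^sub>R v + b' *\<^sub>R w)"
    using ab(5) ab'(5) unfolding sw by linarith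
  then have "?P (x + a *\<^sub>R v + b *\<^sub>R w) = ?Q (x + a' *\<^sub>R v + b' *\<^sub>R w)" using h by simp
  moreover have "dist (?P (x + a *\<^sub>R v + b *\<^sub>R w)) (?P x) < e" "dist (?Q (x + a' *\<^sub>R v + b' *\<^sub>R w)) (?Q x) < e"
    using near[of a b] near[of a' b'] ab ab' by (auto simp: d_def intro!: d1 d2)
  ultimately have "\<bar>?P x - ?Q x\<bar> < 2 * e" unfolding dist_real_def by linarith
  then show False by (simp add: e_def)
qed

lemma frechet_derivative_inner:
  assumes "f differentiable (at x)"
  shows "dd (\<lambda>y. f y \<bullet> b) x v = dd f x v \<bullet> b"
proof -
  have "((\<lambda>y. f y \<bullet> b) has_derivative (\<lambda>v. dd f x v \<bullet> b)) (at x)"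
    using assms by (intro has_derivative_inner_left) (simp add: frechet_derivative_works)
  then show ?thesis using frechet_derivative_at by metis
qed

lemma symmetric_second_derivative:
  fixes f :: "'a::real_normed_vector \<Rightarrow> 'b::euclidean_space"
  assumes sm: "smooth_on S f" "open S" and "x \<in> S"
  shows "dd (\<lambda>y. dd f y v) x w
       = dd (\<lambda>y. dd f y w) x v"
proof (rule euclidean_eqI)
  fix b :: 'b assume "b \<in> Basis"
  have *: "dd (\<lambda>y. dd f y v) x w \<bullet> b
      = dd (\<lambda>y. dd (\<lambda>z. f z \<bullet> b) y v) x w" for v w
  proof -
    have "dd (\<lambda>y. dd f y v) x w \<bullet> b
       = dd (\<lambda>y. dd f y v \<bullet> b) x w"
      by (rule frechet_derivative_inner[symmetric])
        (rule smooth_on_differentiable[OF smooth_on_frechet_derivative[OF sm(1)] sm(2) assms(3)])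
    also have "\<dots> = dd (\<lambda>y. dd (\<lambda>z. f z \<bullet> b) y v) x w"
      by (rule fun_cong[OF frechet_derivative_cong_open[OF sm(2) assms(3)]])
        (simp add: frechet_derivative_inner smooth_on_differentiable[OF sm])
    finally show ?thesis .
  qed
  have "smooth_on S (\<lambda>z. f z \<bullet> b)"
    by (rule smooth_on_linear[OF bounded_linear_inner_left sm(2,1)])
  from symmetric_second_derivative_real[OF this sm(2) assms(3)]
  show "dd (\<lambda>y. dd f y v) x w \<bullet> b
     = dd (\<lambda>y. dd f y w) x v \<bullet> b"
    unfolding * by blast
qed

section \<open>The Levi-Civita connection along a map into a coordinate patch\<close>

lemma dd_eqI: "(f has_derivative f') (at x) \<Longrightarrow> dd f x v = f' v"
  by (simp add: frechet_derivative_at[symmetric])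

lemma smooth_on_has_derivative:
  "smooth_on S f \<Longrightarrow> open S \<Longrightarrow> x \<in> S \<Longrightarrow> (f has_derivative dd f x) (at x)"
  using smooth_on_differentiable frechet_derivative_works by blast

lemma dd_eq_sum_pderiv:
  fixes f :: "real^'n \<Rightarrow> real"
  assumes "f differentiable (at x)"
  shows "dd f x z = (\<Sum>k\<in>UNIV. z $ k * pderiv_at k f x)"
proof -
  have L: "linear (frechet_derivative f (at x))" by (rule linear_frechet_derivative[OF assms])
  have "dd f x z = dd f x (\<Sum>k\<in>UNIV. z $ k *\<^sub>R axis k 1)"
    by (subst basis_expansion[of z, unfolded scalar_mult_eq_scaleR, symmetric]) (rule refl)
  then show ?thesis by (simp add: linear_sum[OF L] linear_cmul[OF L] pderiv_at_def)
qed

lemma dd_vec_nth: "f differentiable (at x) \<Longrightarrow> dd f x v $ i = dd (\<lambda>y. f y $ i) x v"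
  by (rule dd_eqI[symmetric]) (auto intro!: bounded_linear.has_derivative[OF bounded_linear_vec_nth] simp: frechet_derivative_works)

definition bil :: "('n::finite \<Rightarrow> 'n \<Rightarrow> real) \<Rightarrow> real^'n \<Rightarrow> real^'n \<Rightarrow> real" where
  "bil c X Y = (\<Sum>a\<in>UNIV. \<Sum>b\<in>UNIV. c a b * X $ a * Y $ b)"

lemma bil_algebra:
  "bil c (X + X') Y = bil c X Y + bil c X' Y" "bil c X (Y + Y') = bil c X Y + bil c X Y'"
  "bil c (X - X') Y = bil c X Y - bil c X' Y" "bil c X (Y - Y') = bil c X Y - bil c X Y'"
  "bil c (r *\<^sub>R X) Y = r * bil c X Y" "bil c X (r *\<^sub>R Y) = r * bil c X Y"
  "bil c (- X) Y = - bil c X Y" "bil c X (- Y) = - bil c X Y"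
  "bil c 0 Y = 0" "bil c X 0 = 0"
  by (simp_all add: bil_def algebra_simps sum.distrib sum_subtractf sum_distrib_left sum_negf)

lemma bil_swap: "bil (\<lambda>a b. c b a) X Y = bil c Y X"
  unfolding bil_def by (subst sum.swap) (simp add: mult_ac)

lemma bil_axis: "bil c (axis a 1) (axis b 1) = c a b"
proof -
  have "c i j * axis a 1 $ i * axis b 1 $ j = (if j = b then (if i = a then c i b else 0) else 0)" for i j
    by (auto simp: axis_def)
  then show ?thesis by (simp add: bil_def)
qed

definition met :: "(real^'n \<Rightarrow> real^'n^'n) \<Rightarrow> real^'n \<Rightarrow> 'n::finite \<Rightarrow> 'n \<Rightarrow> real" where
  "met G x a b = G x $ a $ b"

lemma inner_matrix_eq_bil: "X \<bullet> (G x *v Y) = bil (met G x) X Y"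
  by (simp add: bil_def met_def inner_vec_def matrix_vector_mult_def sum_distrib_left mult_ac)

definition dcoef :: "(real^'n \<Rightarrow> 'n::finite \<Rightarrow> 'n \<Rightarrow> real) \<Rightarrow> real^'n \<Rightarrow> real^'n \<Rightarrow> 'n \<Rightarrow> 'n \<Rightarrow> real" where
  "dcoef c x z a b = dd (\<lambda>y. c y a b) x z"

lemma bil_has_derivative:
  fixes c :: "real^'n \<Rightarrow> 'n::finite \<Rightarrow> 'n \<Rightarrow> real" and F X Y :: "'p::real_normed_vector \<Rightarrow> real^'n"
  assumes c: "\<And>a b. (\<lambda>y. c y a b) differentiable (at (F p))"
    and F: "F differentiable (at p)" and X: "X differentiable (at p)" and Y: "Y differentiable (at p)"
  shows "((\<lambda>p. bil (c (F p)) (X p) (Y p)) has_derivative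
     (\<lambda>v. bil (dcoef c (F p) (dd F p v)) (X p) (Y p) + bil (c (F p)) (dd X p v) (Y p) + bil (c (F p)) (X p) (dd Y p v))) (at p)"
proof -
  have dc: "((\<lambda>p. c (F p) a b) has_derivative (\<lambda>v. dcoef c (F p) (dd F p v) a b)) (at p)" for a b
    using diff_chain_at[of F "dd F p" p "\<lambda>y. c y a b" "dd (\<lambda>y. c y a b) (F p)"] c F
    by (simp add: frechet_derivative_works o_def dcoef_def)
  have dX: "((\<lambda>p. X p $ a) has_derivative (\<lambda>v. dd X p v $ a)) (at p)"
    and dY: "((\<lambda>p. Y p $ a) has_derivative (\<lambda>v. dd Y p v $ a)) (at p)" for a
    using X Y by (auto intro!: bounded_linear.has_derivative[OF bounded_linear_vec_nth] simp: frechet_derivative_works)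
  show ?thesis unfolding bil_def
    by (auto intro!: derivative_eq_intros dc dX dY simp: algebra_simps sum.distrib)
qed

lemma smooth_on_bil:
  fixes c :: "real^'n \<Rightarrow> 'n::finite \<Rightarrow> 'n \<Rightarrow> real" and F X Y :: "'p::real_normed_vector \<Rightarrow> real^'n"
  assumes "open N" "open \<Omega>" "\<And>a b. smooth_on \<Omega> (\<lambda>y. c y a b)" "smooth_on N F" "F ` N \<subseteq> \<Omega>"
    "smooth_on N X" "smooth_on N Y"
  shows "smooth_on N (\<lambda>p. bil (c (F p)) (X p) (Y p))"
  unfolding bil_def
  by (intro smooth_on_sum smooth_on_mult smooth_on_vec_nth assms
        smooth_on_compose[OF assms(1,2) assms(3) assms(4,5)])

definition chr :: "(real^'n \<Rightarrow> real^'n^'n) \<Rightarrow> real^'n \<Rightarrow> real^'n \<Rightarrow> real^'n \<Rightarrow> real^'n::finite" where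
  "chr G x u w = (\<chi> a. bil (christoffel G x a) u w)"

definition dchr :: "(real^'n \<Rightarrow> real^'n^'n) \<Rightarrow> real^'n \<Rightarrow> real^'n \<Rightarrow> real^'n \<Rightarrow> real^'n \<Rightarrow> real^'n::finite" where
  "dchr G x z u w = (\<chi> a. bil (dcoef (\<lambda>y. christoffel G y a) x z) u w)"

text \<open>Covariant derivative of the bilinear form \<open>c\<close> in direction \<open>z\<close>.\<close>

definition nab :: "(real^'n \<Rightarrow> real^'n^'n) \<Rightarrow> (real^'n \<Rightarrow> 'n \<Rightarrow> 'n \<Rightarrow> real) \<Rightarrow> real^'n \<Rightarrow> real^'n \<Rightarrow> real^'n \<Rightarrow> real^'n::finite \<Rightarrow> real" where
  "nab G c x z X Y = bil (dcoef c x z) X Y - bil (c x) (chr G x z X) Y - bil (c x) X (chr G x z Y)"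

text \<open>Covariant derivative in direction \<open>w\<close> of a vector field \<open>X\<close> along a map \<open>F\<close> with an arbitrary
  parameter space. A variation has the parameters \<open>(s,t)\<close>; the identity map serves to prove tensor identities.\<close>

definition cov :: "(real^'n \<Rightarrow> real^'n^'n) \<Rightarrow> ('p::real_normed_vector \<Rightarrow> real^'n) \<Rightarrow> 'p \<Rightarrow> ('p \<Rightarrow> real^'n) \<Rightarrow> 'p \<Rightarrow> real^'n::finite" where
  "cov G F w X p = dd X p w + chr G (F p) (dd F p w) (X p)"

text \<open>The commutator of the covariant derivatives in the directions \<open>v\<close> and \<open>u\<close>, applied to \<open>w\<close>.\<close>

definition curv :: "(real^'n \<Rightarrow> real^'n^'n) \<Rightarrow> real^'n \<Rightarrow> real^'n \<Rightarrow> real^'n \<Rightarrow> real^'n \<Rightarrow> real^'n::finite" where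
  "curv G x v u w = dchr G x v u w - dchr G x u v w + chr G x v (chr G x u w) - chr G x u (chr G x v w)"

lemma chr_algebra:
  "chr G x (u + u') w = chr G x u w + chr G x u' w" "chr G x u (w + w') = chr G x u w + chr G x u w'"
  "chr G x (u - u') w = chr G x u w - chr G x u' w" "chr G x u (w - w') = chr G x u w - chr G x u w'"
  "chr G x (r *\<^sub>R u) w = r *\<^sub>R chr G x u w" "chr G x u (r *\<^sub>R w) = r *\<^sub>R chr G x u w"
  by (simp_all add: chr_def vec_eq_iff bil_algebra)

locale metric_patch =
  fixes G :: "real^'n \<Rightarrow> real^'n::finite^'n" and \<Omega> :: "(real^'n) set"
  assumes open_dom: "open \<Omega>"
    and smooth_metric: "smooth_on \<Omega> G"
    and metric_symmetric: "x \<in> \<Omega> \<Longrightarrow> transpose (G x) = G x"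
    and metric_invertible: "x \<in> \<Omega> \<Longrightarrow> invertible (G x)"
begin

lemma met_sym: "x \<in> \<Omega> \<Longrightarrow> met G x a b = met G x b a"
proof -
  assume "x \<in> \<Omega>"
  then have "transpose (G x) $ b $ a = G x $ b $ a" by (simp add: metric_symmetric)
  then show ?thesis by (simp add: met_def transpose_def)
qed

lemma met_commute: "x \<in> \<Omega> \<Longrightarrow> bil (met G x) X Y = bil (met G x) Y X"
  by (subst bil_swap[symmetric]) (simp add: met_sym)

lemma met_nondegenerate:
  assumes "x \<in> \<Omega>" "\<And>z. bil (met G x) z X = bil (met G x) z Y"
  shows "X = Y"
proof -
  have "z \<bullet> (G x *v X) = z \<bullet> (G x *v Y)" for z unfolding inner_matrix_eq_bil[of _ G x] by (rule assms(2))
  then have "G x *v X = G x *v Y" by (rule vector_eq_ldot[THEN iffD1, OF allI])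
  moreover have "inj ((*v) (G x))" using metric_invertible[OF assms(1)] by (simp add: invertible_eq_bij bij_is_inj)
  ultimately show ?thesis by (simp add: inj_def)
qed

lemma smooth_met: "smooth_on \<Omega> (\<lambda>x. met G x a b)"
  unfolding met_def by (intro smooth_on_vec_nth open_dom smooth_metric)

lemma smooth_matrix_inv: "smooth_on \<Omega> (\<lambda>x. matrix_inv (G x) $ a $ b)"
  by (intro smooth_on_matrix_inv smooth_on_vec_nth open_dom smooth_metric metric_invertible)

lemma smooth_pderiv: "smooth_on \<Omega> f \<Longrightarrow> smooth_on \<Omega> (pderiv_at i f)"
  unfolding pderiv_at_def by (rule smooth_on_frechet_derivative)

lemma smooth_christoffel: "smooth_on \<Omega> (\<lambda>x. christoffel G x a b c)"
  unfolding christoffel_def divide_inverse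
  using smooth_met unfolding met_def
  by (intro smooth_on_sum smooth_on_mult smooth_on_add smooth_on_diff smooth_pderiv open_dom
      smooth_matrix_inv smooth_on_const)

lemma smooth_riemann: "smooth_on \<Omega> (\<lambda>x. riemann G x a b c d)"
  unfolding riemann_def
  by (intro smooth_on_sum smooth_on_mult smooth_on_add smooth_on_diff smooth_pderiv open_dom smooth_christoffel)

lemma smooth_ricci: "smooth_on \<Omega> (\<lambda>x. ricci G x a c)"
  unfolding ricci_def by (intro smooth_on_sum open_dom smooth_riemann)

lemma smooth_schouten: "smooth_on \<Omega> (\<lambda>x. schouten G x a c)"
  unfolding schouten_def ricci_scalar_def divide_inverse
  using smooth_met unfolding met_def
  by (intro smooth_on_sum smooth_on_mult smooth_on_diff open_dom smooth_matrix_inv smooth_ricci smooth_on_const)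

lemma christoffel_sym: "x \<in> \<Omega> \<Longrightarrow> christoffel G x a b c = christoffel G x a c b"
proof -
  assume x: "x \<in> \<Omega>"
  have "pderiv_at d (\<lambda>y. G y $ b $ c) x = pderiv_at d (\<lambda>y. G y $ c $ b) x" for d
    unfolding pderiv_at_def
    by (rule fun_cong[OF frechet_derivative_cong_open[OF open_dom x]]) (use met_sym in \<open>simp add: met_def\<close>)
  then show ?thesis by (simp add: christoffel_def add.commute)
qed

lemma chr_sym: "x \<in> \<Omega> \<Longrightarrow> chr G x u w = chr G x w u"
proof -
  assume x: "x \<in> \<Omega>"
  have "bil (christoffel G x a) u w = bil (christoffel G x a) w u" for a
    by (subst bil_swap[symmetric]) (simp add: christoffel_sym[OF x])
  then show ?thesis by (simp add: chr_def)
qed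

lemma dchr_sym: "x \<in> \<Omega> \<Longrightarrow> dchr G x z u w = dchr G x z w u"
proof -
  assume x: "x \<in> \<Omega>"
  have "dcoef (\<lambda>y. christoffel G y a) x z b c = dcoef (\<lambda>y. christoffel G y a) x z c b" for a b c
    unfolding dcoef_def
    by (rule fun_cong[OF frechet_derivative_cong_open[OF open_dom x]]) (simp add: christoffel_sym)
  then have "bil (dcoef (\<lambda>y. christoffel G y a) x z) u w = bil (dcoef (\<lambda>y. christoffel G y a) x z) w u" for a
    by (subst bil_swap[symmetric]) simp
  then show ?thesis by (simp add: dchr_def)
qed

text \<open>Lowering the first index cancels the inverse metric in the definition of the Christoffel symbols.\<close>

lemma christoffel_lower:
  assumes "x \<in> \<Omega>"
  shows "(\<Sum>a\<in>UNIV. G x $ e $ a * christoffel G x a b c) =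
    (pderiv_at b (\<lambda>y. G y $ e $ c) x + pderiv_at c (\<lambda>y. G y $ e $ b) x - pderiv_at e (\<lambda>y. G y $ b $ c) x) / 2"
proof -
  define k where "k d = pderiv_at b (\<lambda>y. G y $ d $ c) x + pderiv_at c (\<lambda>y. G y $ d $ b) x - pderiv_at d (\<lambda>y. G y $ b $ c) x" for d
  have "(\<Sum>a\<in>UNIV. G x $ e $ a * matrix_inv (G x) $ a $ d) = (if e = d then 1 else 0)" for d
    using matrix_inv_right[OF metric_invertible[OF assms]]
    by (simp add: matrix_matrix_mult_def mat_def vec_eq_iff)
  then have "(\<Sum>d\<in>UNIV. (\<Sum>a\<in>UNIV. G x $ e $ a * matrix_inv (G x) $ a $ d) * k d) = (\<Sum>d\<in>UNIV. if e = d then k d else 0)"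
    by (intro sum.cong) auto
  moreover have "(\<Sum>a\<in>UNIV. G x $ e $ a * christoffel G x a b c)
      = (\<Sum>a\<in>UNIV. \<Sum>d\<in>UNIV. G x $ e $ a * matrix_inv (G x) $ a $ d * k d) / 2"
    by (simp add: christoffel_def k_def sum_distrib_left sum_divide_distrib mult_ac)
  moreover have "(\<Sum>a\<in>UNIV. \<Sum>d\<in>UNIV. G x $ e $ a * matrix_inv (G x) $ a $ d * k d)
      = (\<Sum>d\<in>UNIV. (\<Sum>a\<in>UNIV. G x $ e $ a * matrix_inv (G x) $ a $ d) * k d)"
    by (subst sum.swap) (simp add: sum_distrib_right)
  ultimately show ?thesis by (simp add: k_def)
qed

lemma dcoef_met: "x \<in> \<Omega> \<Longrightarrow> dcoef (met G) x z a b = (\<Sum>k\<in>UNIV. z $ k * pderiv_at k (\<lambda>y. G y $ a $ b) x)"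
  unfolding dcoef_def
  by (subst dd_eq_sum_pderiv) (auto intro: smooth_on_differentiable[OF smooth_met[unfolded met_def] open_dom] simp: met_def)

text \<open>The Koszul formula. Since the metric is nondegenerate it characterises the Christoffel symbols
  without an inverse matrix; metric compatibility and the transformation law under a change of chart
  are read off from it.\<close>

lemma koszul:
  assumes x: "x \<in> \<Omega>"
  shows "bil (met G x) z (chr G x u w) =
    (bil (dcoef (met G) x u) z w + bil (dcoef (met G) x w) z u - bil (dcoef (met G) x z) u w) / 2"
proof -
  have "bil (met G x) z (chr G x u w)
     = (\<Sum>e\<in>UNIV. \<Sum>a\<in>UNIV. \<Sum>b\<in>UNIV. \<Sum>c\<in>UNIV. (G x $ e $ a * christoffel G x a b c) * (z $ e * u $ b * w $ c))"
    by (simp add: bil_def met_def chr_def sum_distrib_left mult_ac)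
  also have "\<dots> = (\<Sum>e\<in>UNIV. \<Sum>b\<in>UNIV. \<Sum>c\<in>UNIV. \<Sum>a\<in>UNIV. (G x $ e $ a * christoffel G x a b c) * (z $ e * u $ b * w $ c))"
    by (rule sum.cong[OF refl]) (subst sum.swap, rule sum.cong[OF refl], rule sum.swap)
  also have "\<dots> = (\<Sum>e\<in>UNIV. \<Sum>b\<in>UNIV. \<Sum>c\<in>UNIV. (pderiv_at b (\<lambda>y. G y $ e $ c) x + pderiv_at c (\<lambda>y. G y $ e $ b) x - pderiv_at e (\<lambda>y. G y $ b $ c) x) / 2 * (z $ e * u $ b * w $ c))"
    by (simp only: sum_distrib_right[symmetric] christoffel_lower[OF x])
  also have "\<dots> = ((\<Sum>e\<in>UNIV. \<Sum>b\<in>UNIV. \<Sum>c\<in>UNIV. pderiv_at b (\<lambda>y. G y $ e $ c) x * (z $ e * u $ b * w $ c))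
      + (\<Sum>e\<in>UNIV. \<Sum>b\<in>UNIV. \<Sum>c\<in>UNIV. pderiv_at c (\<lambda>y. G y $ e $ b) x * (z $ e * u $ b * w $ c))
      - (\<Sum>e\<in>UNIV. \<Sum>b\<in>UNIV. \<Sum>c\<in>UNIV. pderiv_at e (\<lambda>y. G y $ b $ c) x * (z $ e * u $ b * w $ c))) / 2"
    by (simp add: sum.distrib sum_subtractf sum_divide_distrib diff_divide_distrib add_divide_distrib algebra_simps)
  also have "(\<Sum>e\<in>UNIV. \<Sum>b\<in>UNIV. \<Sum>c\<in>UNIV. pderiv_at b (\<lambda>y. G y $ e $ c) x * (z $ e * u $ b * w $ c))
     = bil (dcoef (met G) x u) z w"
    unfolding bil_def dcoef_met[OF x] sum_distrib_right
    by (rule sum.cong[OF refl]) (subst sum.swap, simp add: mult_ac)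
  also have "(\<Sum>e\<in>UNIV. \<Sum>b\<in>UNIV. \<Sum>c\<in>UNIV. pderiv_at c (\<lambda>y. G y $ e $ b) x * (z $ e * u $ b * w $ c))
     = bil (dcoef (met G) x w) z u"
    unfolding bil_def dcoef_met[OF x] sum_distrib_right by (simp add: mult_ac)
  also have "(\<Sum>e\<in>UNIV. \<Sum>b\<in>UNIV. \<Sum>c\<in>UNIV. pderiv_at e (\<lambda>y. G y $ b $ c) x * (z $ e * u $ b * w $ c))
     = bil (dcoef (met G) x z) u w"
    unfolding bil_def dcoef_met[OF x] sum_distrib_right
    by (subst sum.swap, rule sum.cong[OF refl], subst sum.swap, simp add: mult_ac)
  finally show ?thesis .
qed

lemma dcoef_met_sym: "x \<in> \<Omega> \<Longrightarrow> bil (dcoef (met G) x z) u w = bil (dcoef (met G) x z) w u"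
proof -
  assume x: "x \<in> \<Omega>"
  have "dcoef (met G) x z b c = dcoef (met G) x z c b" for b c
    unfolding dcoef_def
    by (rule fun_cong[OF frechet_derivative_cong_open[OF open_dom x]]) (simp add: met_sym)
  then show ?thesis by (subst bil_swap[symmetric]) simp
qed

text \<open>The Levi-Civita connection is metric: in the sum of the two Koszul formulas everything but the
  derivative of the metric cancels.\<close>

lemma nab_metric: "x \<in> \<Omega> \<Longrightarrow> nab G (met G) x z X Y = 0"
  unfolding nab_def
  by (subst met_commute[where X="chr G x z X"], assumption)
    (simp add: koszul dcoef_met_sym[of x z Y X] dcoef_met_sym[of x X Y z] dcoef_met_sym[of x Y X z] field_simps)

context
  fixes N :: "'p::real_normed_vector set" and F :: "'p \<Rightarrow> real^'n"
  assumes N: "open N" and F: "smooth_on N F" and FN: "F ` N \<subseteq> \<Omega>"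
begin

lemma F_in: "p \<in> N \<Longrightarrow> F p \<in> \<Omega>" using FN by auto

lemma smooth_chr:
  assumes "smooth_on N X" "smooth_on N Y"
  shows "smooth_on N (\<lambda>p. chr G (F p) (X p) (Y p))"
  unfolding chr_def
  by (intro smooth_on_vec_lambda N smooth_on_bil[OF N open_dom _ F FN assms] smooth_christoffel)

lemma smooth_cov: "smooth_on N X \<Longrightarrow> smooth_on N (cov G F w X)"
  unfolding cov_def[abs_def]
  by (intro smooth_on_add N smooth_chr smooth_on_frechet_derivative F)

lemma bil_leibniz:
  assumes c: "\<And>a b. smooth_on \<Omega> (\<lambda>y. c y a b)" and X: "smooth_on N X" and Y: "smooth_on N Y" and p: "p \<in> N"
  shows "dd (\<lambda>p. bil (c (F p)) (X p) (Y p)) p v =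
    nab G c (F p) (dd F p v) (X p) (Y p) + bil (c (F p)) (cov G F v X p) (Y p) + bil (c (F p)) (X p) (cov G F v Y p)"
  by (subst dd_eqI[OF bil_has_derivative])
    (auto intro: smooth_on_differentiable[OF c open_dom] smooth_on_differentiable[OF _ N] F_in F X Y p
      simp: nab_def cov_def bil_algebra)

lemma dd_chr:
  assumes X: "smooth_on N X" and Y: "smooth_on N Y" and p: "p \<in> N"
  shows "dd (\<lambda>p. chr G (F p) (X p) (Y p)) p v =
     dchr G (F p) (dd F p v) (X p) (Y p) + chr G (F p) (dd X p v) (Y p) + chr G (F p) (X p) (dd Y p v)"
proof (subst vec_eq_iff, intro allI)
  fix a
  have "dd (\<lambda>p. chr G (F p) (X p) (Y p)) p v $ a = dd (\<lambda>p. bil (christoffel G (F p) a) (X p) (Y p)) p v"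
    by (subst dd_vec_nth[OF smooth_on_differentiable[OF smooth_chr[OF X Y] N p]]) (simp add: chr_def)
  also have "\<dots> = (dchr G (F p) (dd F p v) (X p) (Y p) + chr G (F p) (dd X p v) (Y p) + chr G (F p) (X p) (dd Y p v)) $ a"
    by (subst dd_eqI[OF bil_has_derivative[where c="\<lambda>y. christoffel G y a"]])
      (auto intro: smooth_on_differentiable[OF smooth_christoffel open_dom] smooth_on_differentiable[OF _ N] F_in F X Y p
        simp: chr_def dchr_def)
  finally show "dd (\<lambda>p. chr G (F p) (X p) (Y p)) p v $ a = (dchr G (F p) (dd F p v) (X p) (Y p) + chr G (F p) (dd X p v) (Y p) + chr G (F p) (X p) (dd Y p v)) $ a" .
qed

text \<open>Both terms of \<open>cov\<close> are symmetric: second derivatives commute, and so do the lower indices of the Christoffel symbols.\<close>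

lemma cov_torsion_free:
  assumes p: "p \<in> N"
  shows "cov G F v (\<lambda>p. dd F p w) p = cov G F w (\<lambda>p. dd F p v) p"
  unfolding cov_def
  by (simp add: symmetric_second_derivative[OF F N p, of w v] chr_sym[OF F_in[OF p], of "dd F p v"])

text \<open>In the difference the second derivatives of \<open>X\<close> and of \<open>F\<close> and all terms with a first derivative
  of \<open>X\<close> cancel by symmetry; what remains is tensorial.\<close>

lemma cov_commutator:
  assumes X: "smooth_on N X" and p: "p \<in> N"
  shows "cov G F v (cov G F w X) p - cov G F w (cov G F v X) p = curv G (F p) (dd F p v) (dd F p w) (X p)"
proof -
  have *: "cov G F v (cov G F w X) p = dd (\<lambda>p. dd X p w) p v
     + (dchr G (F p) (dd F p v) (dd F p w) (X p) + chr G (F p) (dd (\<lambda>p. dd F p w) p v) (X p) + chr G (F p) (dd F p w) (dd X p v))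
     + chr G (F p) (dd F p v) (dd X p w + chr G (F p) (dd F p w) (X p))" for v w
  proof -
    have s: "smooth_on N (\<lambda>p. dd X p w)" "smooth_on N (\<lambda>p. dd F p w)"
      by (intro smooth_on_frechet_derivative X F)+
    have "((\<lambda>p. dd X p w + chr G (F p) (dd F p w) (X p)) has_derivative
       (\<lambda>v. dd (\<lambda>p. dd X p w) p v + dd (\<lambda>p. chr G (F p) (dd F p w) (X p)) p v)) (at p)"
      by (intro has_derivative_add smooth_on_has_derivative[OF _ N p] s smooth_chr X)
    from dd_eqI[OF this, of v] show ?thesis
      unfolding cov_def[of G F v] unfolding cov_def[abs_def] by (simp add: dd_chr[OF s(2) X p])
  qed
  show ?thesis unfolding *[of v w] *[of w v]
    by (simp add: symmetric_second_derivative[OF F N p, of w v] symmetric_second_derivative[OF X N p, of w v]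
        chr_algebra curv_def algebra_simps)
qed

end

end

section \<open>Symmetries of the curvature\<close>

definition sharp :: "(real^'n \<Rightarrow> real^'n^'n) \<Rightarrow> real^'n \<Rightarrow> real^'n \<Rightarrow> real^'n::finite" where
  "sharp G x X = (\<chi> a. \<Sum>b\<in>UNIV. schouten_mixed G x a b * X $ b)"

context metric_patch
begin

text \<open>The minus sign comes from the convention for \<open>riemann\<close>, which is defined by the commutator on
  covectors, whereas \<open>curv\<close> is the commutator on vectors.\<close>

lemma curv_riemann:
  assumes x: "x \<in> \<Omega>"
  shows "curv G x v u w $ d = - (\<Sum>a\<in>UNIV. \<Sum>b\<in>UNIV. \<Sum>c\<in>UNIV. riemann G x a b c d * v $ a * u $ b * w $ c)"
proof -
  have dg: "dcoef (\<lambda>y. christoffel G y d) x z b c = (\<Sum>a\<in>UNIV. z $ a * pderiv_at a (\<lambda>y. christoffel G y d b c) x)" for z b c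
    unfolding dcoef_def
    by (rule dd_eq_sum_pderiv) (rule smooth_on_differentiable[OF smooth_christoffel open_dom x])
  have 1: "dchr G x v u w $ d = (\<Sum>a\<in>UNIV. \<Sum>b\<in>UNIV. \<Sum>c\<in>UNIV. pderiv_at a (\<lambda>y. christoffel G y d b c) x * v $ a * u $ b * w $ c)" for v u w
  proof -
    have "dchr G x v u w $ d = (\<Sum>b\<in>UNIV. \<Sum>c\<in>UNIV. \<Sum>a\<in>UNIV. pderiv_at a (\<lambda>y. christoffel G y d b c) x * v $ a * u $ b * w $ c)"
      unfolding dchr_def vec_lambda_beta bil_def dg sum_distrib_right by (simp add: mult_ac)
    also have "\<dots> = (\<Sum>b\<in>UNIV. \<Sum>a\<in>UNIV. \<Sum>c\<in>UNIV. pderiv_at a (\<lambda>y. christoffel G y d b c) x * v $ a * u $ b * w $ c)"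
      by (rule sum.cong[OF refl]) (rule sum.swap)
    also have "\<dots> = (\<Sum>a\<in>UNIV. \<Sum>b\<in>UNIV. \<Sum>c\<in>UNIV. pderiv_at a (\<lambda>y. christoffel G y d b c) x * v $ a * u $ b * w $ c)"
      by (rule sum.swap)
    finally show ?thesis .
  qed
  have 2: "chr G x v (chr G x u w) $ d = (\<Sum>a\<in>UNIV. \<Sum>b\<in>UNIV. \<Sum>c\<in>UNIV. (\<Sum>e\<in>UNIV. christoffel G x d a e * christoffel G x e b c) * v $ a * u $ b * w $ c)" for v u w
  proof -
    have "chr G x v (chr G x u w) $ d = (\<Sum>a\<in>UNIV. \<Sum>e\<in>UNIV. \<Sum>b\<in>UNIV. \<Sum>c\<in>UNIV. christoffel G x d a e * christoffel G x e b c * v $ a * u $ b * w $ c)"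
      by (simp add: chr_def bil_def sum_distrib_left sum_distrib_right mult_ac)
    also have "\<dots> = (\<Sum>a\<in>UNIV. \<Sum>b\<in>UNIV. \<Sum>c\<in>UNIV. \<Sum>e\<in>UNIV. christoffel G x d a e * christoffel G x e b c * v $ a * u $ b * w $ c)"
      by (rule sum.cong[OF refl]) (subst sum.swap, rule sum.cong[OF refl], rule sum.swap)
    finally show ?thesis by (simp add: sum_distrib_right)
  qed
  have sw: "(\<Sum>a\<in>UNIV. \<Sum>b\<in>UNIV. \<Sum>c\<in>UNIV. f a b c * u $ a * v $ b * w $ c) = (\<Sum>a\<in>UNIV. \<Sum>b\<in>UNIV. \<Sum>c\<in>UNIV. f b a c * v $ a * u $ b * w $ c)" for f
    by (subst sum.swap) (simp add: mult_ac)
  have "curv G x v u w $ d = (\<Sum>a\<in>UNIV. \<Sum>b\<in>UNIV. \<Sum>c\<in>UNIV. (pderiv_at a (\<lambda>y. christoffel G y d b c) x - pderiv_at b (\<lambda>y. christoffel G y d a c) x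
     + (\<Sum>e\<in>UNIV. christoffel G x d a e * christoffel G x e b c) - (\<Sum>e\<in>UNIV. christoffel G x d b e * christoffel G x e a c)) * v $ a * u $ b * w $ c)"
    unfolding curv_def vector_minus_component vector_add_component 1 2 sw[of "\<lambda>a b c. pderiv_at a (\<lambda>y. christoffel G y d b c) x"]
      sw[of "\<lambda>a b c. \<Sum>e\<in>UNIV. christoffel G x d a e * christoffel G x e b c"]
    by (simp add: sum.distrib sum_subtractf left_diff_distrib distrib_right)
  also have "\<dots> = (\<Sum>a\<in>UNIV. \<Sum>b\<in>UNIV. \<Sum>c\<in>UNIV. - riemann G x a b c d * v $ a * u $ b * w $ c)"
    by (intro sum.cong refl) (simp add: riemann_def sum_subtractf algebra_simps)
  finally show ?thesis by (simp add: sum_negf)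
qed

lemma curv_add:
  "curv G x (v + v') u w = curv G x v u w + curv G x v' u w" "curv G x v (u + u') w = curv G x v u w + curv G x v u' w"
  "curv G x v u (w + w') = curv G x v u w + curv G x v u w'" if "x \<in> \<Omega>"
  by (simp_all add: vec_eq_iff curv_riemann[OF that] algebra_simps sum.distrib)

lemma curv_scaleR:
  "curv G x (r *\<^sub>R v) u w = r *\<^sub>R curv G x v u w" "curv G x v (r *\<^sub>R u) w = r *\<^sub>R curv G x v u w"
  "curv G x v u (r *\<^sub>R w) = r *\<^sub>R curv G x v u w" if "x \<in> \<Omega>"
  by (simp_all add: vec_eq_iff curv_riemann[OF that] sum_distrib_left mult_ac)

lemma linear_curv2: "x \<in> \<Omega> \<Longrightarrow> linear (\<lambda>u. curv G x v u w)"
  by (rule linearI) (simp_all add: curv_add curv_scaleR)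

lemma linear_curv3: "x \<in> \<Omega> \<Longrightarrow> linear (\<lambda>w. curv G x v u w)"
  by (rule linearI) (simp_all add: curv_add curv_scaleR)

lemma curv_antisym: "curv G x v u w = - curv G x u v w"
  by (simp add: curv_def algebra_simps)

lemma curv_bianchi: "x \<in> \<Omega> \<Longrightarrow> curv G x v u w + curv G x u w v + curv G x w v u = 0"
  by (simp add: curv_def dchr_sym[of x v w u] dchr_sym[of x u v w] dchr_sym[of x w u v]
    chr_sym[of x w u] chr_sym[of x v u] chr_sym[of x w v])

text \<open>The second derivatives of the inner product of two constant fields commute. Writing them out with
  the Leibniz rule along the identity map leaves exactly the two curvature terms.\<close>

lemma curv_skew:
  assumes x: "x \<in> \<Omega>"
  shows "bil (met G x) (curv G x v u X) Y + bil (met G x) X (curv G x v u Y) = 0"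
proof -
  let ?F = "\<lambda>y::real^'n. y" and ?X = "\<lambda>y::real^'n. X" and ?Y = "\<lambda>y::real^'n. Y"
  have F: "smooth_on \<Omega> ?F" "?F ` \<Omega> \<subseteq> \<Omega>" by (auto intro: smooth_on_ident open_dom)
  have c: "smooth_on \<Omega> ?X" "smooth_on \<Omega> ?Y" by (auto intro: smooth_on_const)
  note sm = smooth_met smooth_cov[OF open_dom F]
  note lz = bil_leibniz[OF open_dom F, where c="met G"]
  have D: "dd (\<lambda>y. bil (met G y) (A y) (B y)) y w = bil (met G y) (cov G ?F w A y) (B y) + bil (met G y) (A y) (cov G ?F w B y)"
    if "smooth_on \<Omega> A" "smooth_on \<Omega> B" "y \<in> \<Omega>" for A B y w
    using lz[OF smooth_met that] nab_metric[OF that(3)] by simp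
  have D2: "dd (\<lambda>y. dd (\<lambda>y. bil (met G y) X Y) y w) x v =
      bil (met G x) (cov G ?F v (cov G ?F w ?X) x) Y + bil (met G x) (cov G ?F w ?X x) (cov G ?F v ?Y x)
    + bil (met G x) (cov G ?F v ?X x) (cov G ?F w ?Y x) + bil (met G x) X (cov G ?F v (cov G ?F w ?Y) x)" for v w
  proof -
    have "dd (\<lambda>y. dd (\<lambda>y. bil (met G y) X Y) y w) x v
      = dd (\<lambda>y. bil (met G y) (cov G ?F w ?X y) Y + bil (met G y) X (cov G ?F w ?Y y)) x v"
      by (rule fun_cong[OF frechet_derivative_cong_open[OF open_dom x]]) (rule D[OF c])
    also have "\<dots> = dd (\<lambda>y. bil (met G y) (cov G ?F w ?X y) Y) x v + dd (\<lambda>y. bil (met G y) X (cov G ?F w ?Y y)) x v"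
      by (intro dd_eqI has_derivative_add smooth_on_has_derivative[OF _ open_dom x]
          smooth_on_bil[OF open_dom open_dom smooth_met F] sm c)
    finally show ?thesis
      by (simp add: D[OF sm(2)[OF c(1)] c(2) x] D[OF c(1) sm(2)[OF c(2)] x])
  qed
  have "smooth_on \<Omega> (\<lambda>y. bil (met G y) X Y)"
    by (intro smooth_on_bil[OF open_dom open_dom smooth_met F] c)
  from symmetric_second_derivative[OF this open_dom x, of u v]
  have "bil (met G x) (cov G ?F v (cov G ?F u ?X) x - cov G ?F u (cov G ?F v ?X) x) Y
     + bil (met G x) X (cov G ?F v (cov G ?F u ?Y) x - cov G ?F u (cov G ?F v ?Y) x) = 0"
    unfolding D2 by (simp add: bil_algebra)
  then show ?thesis
    unfolding cov_commutator[OF open_dom F c(1) x] cov_commutator[OF open_dom F c(2) x]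
    by (simp add: frechet_derivative_ident)
qed

lemma matrix_inv_left: "x \<in> \<Omega> \<Longrightarrow> matrix_inv (G x) ** G x = mat 1"
  using matrix_inv_right[OF metric_invertible] matrix_left_right_inverse by blast

lemma matrix_inv_sym: "x \<in> \<Omega> \<Longrightarrow> transpose (matrix_inv (G x)) = matrix_inv (G x)"
proof -
  assume x: "x \<in> \<Omega>"
  have "transpose (matrix_inv (G x)) ** G x = transpose (transpose (G x) ** matrix_inv (G x))"
    by (simp add: matrix_transpose_mul)
  also have "\<dots> = mat 1" using metric_symmetric[OF x] matrix_inv_right[OF metric_invertible[OF x]]
    by (simp add: transpose_mat)
  finally have "transpose (matrix_inv (G x)) ** G x ** matrix_inv (G x) = matrix_inv (G x)" by simp
  then show ?thesis
    by (simp add: matrix_mul_assoc[symmetric] matrix_inv_right[OF metric_invertible[OF x]])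
qed

text \<open>By \<open>curv_skew\<close>, \<open>curv G x v u\<close> is an endomorphism that is skew for the metric, and such an endomorphism has trace zero.\<close>

lemma trace_curv3: "x \<in> \<Omega> \<Longrightarrow> (\<Sum>b\<in>UNIV. curv G x v u (axis b 1) $ b) = 0"
proof -
  assume x: "x \<in> \<Omega>"
  define C where "C = matrix (\<lambda>w. curv G x v u w)"
  define M where "M = G x ** C"
  have C: "curv G x v u w = C *v w" for w
    unfolding C_def by (rule fun_cong[OF matrix_vector_mul(2)[OF linear_curv3[OF x]], symmetric])
  have M: "bil (met G x) X (C *v Y) = X \<bullet> (M *v Y)" for X Y
    unfolding inner_matrix_eq_bil[of _ G x, symmetric] by (simp add: M_def matrix_vector_mul_assoc)
  have "X \<bullet> (M *v Y) = - (Y \<bullet> (M *v X))" for X Y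
    using curv_skew[OF x, of v u X Y] met_commute[OF x, of "C *v X" Y] unfolding C M by linarith
  note skew = this
  have "axis i 1 \<bullet> (M *v axis j 1) = M $ i $ j" for i j
    by (simp add: inner_axis' matrix_vector_mult_basis column_def)
  then have Mij: "M $ i $ j = - M $ j $ i" for i j
    using skew[of "axis i 1" "axis j 1"] by metis
  have Mt: "M = - transpose M"
    unfolding vec_eq_iff vector_uminus_component transpose_def vec_lambda_beta using Mij by blast
  have "C = matrix_inv (G x) ** M"
    by (simp add: M_def matrix_mul_assoc matrix_inv_left[OF x])
  then have "trace C = trace (transpose (matrix_inv (G x) ** M))" by (simp add: trace_def transpose_def)
  also have "\<dots> = trace (transpose M ** matrix_inv (G x))" by (simp add: matrix_transpose_mul matrix_inv_sym[OF x])
  also have "\<dots> = trace (matrix_inv (G x) ** transpose M)" by (rule trace_mul_sym)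
  also have "\<dots> = - trace (matrix_inv (G x) ** M)"
    by (subst (2) Mt) (simp add: trace_def matrix_matrix_mult_def sum_negf)
  also have "matrix_inv (G x) ** M = C" by (simp add: M_def matrix_mul_assoc matrix_inv_left[OF x])
  finally have "trace C = 0" by simp
  then show ?thesis unfolding C trace_def by (simp add: matrix_vector_mult_basis column_def)
qed

lemma ricci_eq_trace:
  assumes x: "x \<in> \<Omega>"
  shows "bil (ricci G x) v w = - (\<Sum>b\<in>UNIV. curv G x v (axis b 1) w $ b)"
proof -
  have *: "riemann G x a b' c b * v $ a * axis b 1 $ b' * w $ c = (if b' = b then riemann G x a b c b * v $ a * w $ c else 0)" for a b b' c
    by (simp add: axis_def)
  have **: "(\<Sum>b'\<in>UNIV. \<Sum>c\<in>UNIV. if b' = b then g c else 0) = (\<Sum>c\<in>UNIV. g c)" for g :: "'n \<Rightarrow> real" and b :: 'n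
    by (subst sum.swap) simp
  have "(\<Sum>b\<in>UNIV. curv G x v (axis b 1) w $ b) = - (\<Sum>b\<in>UNIV. \<Sum>a\<in>UNIV. \<Sum>c\<in>UNIV. riemann G x a b c b * v $ a * w $ c)"
    unfolding curv_riemann[OF x] * ** by (simp add: sum_negf)
  also have "(\<Sum>b\<in>UNIV. \<Sum>a\<in>UNIV. \<Sum>c\<in>UNIV. riemann G x a b c b * v $ a * w $ c) = bil (ricci G x) v w"
    unfolding bil_def ricci_def sum_distrib_right
    by (subst sum.swap, rule sum.cong[OF refl], rule sum.swap)
  finally show ?thesis by simp
qed

text \<open>Trace of the first Bianchi identity; the term that would spoil the symmetry is the trace of a skew endomorphism.\<close>

lemma ricci_sym: "x \<in> \<Omega> \<Longrightarrow> ricci G x a c = ricci G x c a"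
proof -
  assume x: "x \<in> \<Omega>"
  have "bil (ricci G x) v w = bil (ricci G x) w v" for v w
  proof -
    have "curv G x v (axis b 1) w $ b = - curv G x w v (axis b 1) $ b + curv G x w (axis b 1) v $ b" for b
      using arg_cong[OF curv_bianchi[OF x, of v "axis b 1" w], of "\<lambda>z. z $ b"]
        curv_antisym[of x "axis b 1" w v] by simp
    then show ?thesis unfolding ricci_eq_trace[OF x] by (simp add: sum.distrib sum_negf sum_subtractf trace_curv3[OF x])
  qed
  from this[of "axis a 1" "axis c 1"] show ?thesis by (simp add: bil_axis)
qed

lemma schouten_sym: "x \<in> \<Omega> \<Longrightarrow> schouten G x a c = schouten G x c a"
  using met_sym[of x a c] by (simp add: schouten_def ricci_sym[of x a c] met_def)

lemma schouten_commute: "x \<in> \<Omega> \<Longrightarrow> bil (schouten G x) X Y = bil (schouten G x) Y X"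
  by (subst bil_swap[symmetric]) (simp add: schouten_sym)

lemma bil_schouten: "bil (schouten G x) X Y =
    (bil (ricci G x) X Y - ricci_scalar G x * bil (met G x) X Y / (2 * (real CARD('n) - 1))) / (real CARD('n) - 2)"
  unfolding bil_def schouten_def met_def
  by (simp add: sum_divide_distrib sum_subtractf[symmetric] sum_distrib_left algebra_simps diff_divide_distrib)

lemma met_sharp: "x \<in> \<Omega> \<Longrightarrow> bil (met G x) Z (sharp G x X) = bil (schouten G x) Z X"
proof -
  assume x: "x \<in> \<Omega>"
  define P where "P = (\<chi> a b. schouten G x a b)"
  have P: "bil (schouten G x) Z X = Z \<bullet> (P *v X)"
    by (simp add: bil_def P_def inner_vec_def matrix_vector_mult_def sum_distrib_left mult_ac)
  have "sharp G x X = matrix_inv (G x) *v (P *v X)"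
    unfolding matrix_vector_mul_assoc
    by (simp add: sharp_def schouten_mixed_def P_def matrix_vector_mult_def matrix_matrix_mult_def)
  then have "G x *v sharp G x X = P *v X"
    by (simp add: matrix_vector_mul_assoc matrix_mul_assoc matrix_inv_right[OF metric_invertible[OF x]])
  then show ?thesis unfolding P inner_matrix_eq_bil[of _ G x, symmetric] by simp
qed

lemma nab_schouten_sum:
  assumes x: "x \<in> \<Omega>"
  shows "nab G (schouten G) x z X Y = (\<Sum>c\<in>UNIV. z $ c * (\<Sum>a\<in>UNIV. \<Sum>b\<in>UNIV. nabla_schouten G x c a b * X $ a * Y $ b))"
proof -
  have dg: "dcoef (schouten G) x z b c = (\<Sum>a\<in>UNIV. z $ a * pderiv_at a (\<lambda>y. schouten G y b c) x)" for z b c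
    unfolding dcoef_def
    by (rule dd_eq_sum_pderiv) (rule smooth_on_differentiable[OF smooth_schouten open_dom x])
  have 1: "bil (dcoef (schouten G) x z) X Y = (\<Sum>c\<in>UNIV. \<Sum>a\<in>UNIV. \<Sum>b\<in>UNIV. z $ c * pderiv_at c (\<lambda>y. schouten G y a b) x * X $ a * Y $ b)"
    unfolding bil_def dg sum_distrib_right
    by (subst (2) sum.swap) (rule sum.cong[OF refl], rule sum.swap)
  have 2: "bil (schouten G x) (chr G x z X) Y = (\<Sum>c\<in>UNIV. \<Sum>a\<in>UNIV. \<Sum>b\<in>UNIV. z $ c * (\<Sum>e\<in>UNIV. christoffel G x e c a * schouten G x e b) * X $ a * Y $ b)"
  proof -
    have "bil (schouten G x) (chr G x z X) Y = (\<Sum>e\<in>UNIV. \<Sum>b\<in>UNIV. \<Sum>c\<in>UNIV. \<Sum>a\<in>UNIV. z $ c * christoffel G x e c a * schouten G x e b * X $ a * Y $ b)"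
      by (simp add: chr_def bil_def sum_distrib_left sum_distrib_right mult_ac)
    also have "\<dots> = (\<Sum>b\<in>UNIV. \<Sum>c\<in>UNIV. \<Sum>a\<in>UNIV. \<Sum>e\<in>UNIV. z $ c * christoffel G x e c a * schouten G x e b * X $ a * Y $ b)"
      by (subst sum.swap, rule sum.cong[OF refl], subst sum.swap, rule sum.cong[OF refl], rule sum.swap)
    also have "\<dots> = (\<Sum>c\<in>UNIV. \<Sum>a\<in>UNIV. \<Sum>b\<in>UNIV. \<Sum>e\<in>UNIV. z $ c * christoffel G x e c a * schouten G x e b * X $ a * Y $ b)"
      by (subst sum.swap, rule sum.cong[OF refl], rule sum.swap)
    finally show ?thesis by (simp add: sum_distrib_left sum_distrib_right mult_ac)
  qed
  have 3: "bil (schouten G x) X (chr G x z Y) = (\<Sum>c\<in>UNIV. \<Sum>a\<in>UNIV. \<Sum>b\<in>UNIV. z $ c * (\<Sum>e\<in>UNIV. christoffel G x e c b * schouten G x a e) * X $ a * Y $ b)"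
  proof -
    have "bil (schouten G x) X (chr G x z Y) = (\<Sum>a\<in>UNIV. \<Sum>e\<in>UNIV. \<Sum>c\<in>UNIV. \<Sum>b\<in>UNIV. z $ c * christoffel G x e c b * schouten G x a e * X $ a * Y $ b)"
      by (simp add: chr_def bil_def sum_distrib_left sum_distrib_right mult_ac)
    also have "\<dots> = (\<Sum>a\<in>UNIV. \<Sum>c\<in>UNIV. \<Sum>b\<in>UNIV. \<Sum>e\<in>UNIV. z $ c * christoffel G x e c b * schouten G x a e * X $ a * Y $ b)"
      by (rule sum.cong[OF refl], subst sum.swap, rule sum.cong[OF refl], rule sum.swap)
    also have "\<dots> = (\<Sum>c\<in>UNIV. \<Sum>a\<in>UNIV. \<Sum>b\<in>UNIV. \<Sum>e\<in>UNIV. z $ c * christoffel G x e c b * schouten G x a e * X $ a * Y $ b)"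
      by (rule sum.swap)
    finally show ?thesis by (simp add: sum_distrib_left sum_distrib_right mult_ac)
  qed
  show ?thesis unfolding nab_def 1 2 3 nabla_schouten_def
    by (simp add: sum_subtractf[symmetric] sum.distrib sum_distrib_left algebra_simps)
qed

end

context metric_patch
begin

text \<open>The contraction of the Weyl tensor that enters \<open>K\<close>, split into its Riemann part and the four
  products of the metric with the Schouten tensor. The summands are treated one by one below; each
  factorises because the metric or the Kronecker delta ties two of the four summation indices.\<close>

lemma weyl_contraction:
  assumes x: "x \<in> \<Omega>"
  shows "(\<Sum>c\<in>UNIV. V $ c * (\<Sum>a\<in>UNIV. \<Sum>f\<in>UNIV. \<Sum>d\<in>UNIV. weyl G x f c a d * U $ a * U $ f * (G x *v A) $ d)) =
    bil (met G x) A (curv G x V U U)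
    - (bil (met G x) U U * bil (schouten G x) A V - bil (met G x) U A * bil (schouten G x) U V
       - bil (met G x) V U * bil (schouten G x) A U + bil (met G x) A V * bil (schouten G x) U U)"
proof -
  let ?l = "G x *v A"
  have m: "bil (met G x) X A = (\<Sum>d\<in>UNIV. X $ d * ?l $ d)" for X
    by (simp add: inner_matrix_eq_bil[of _ G x, symmetric] inner_vec_def)
  have R: "(\<Sum>c\<in>UNIV. \<Sum>a\<in>UNIV. \<Sum>f\<in>UNIV. \<Sum>d\<in>UNIV. V $ c * (riemann G x f c a d * U $ a * U $ f * ?l $ d))
      = bil (met G x) A (curv G x V U U)"
  proof -
    have "bil (met G x) A (curv G x V U U) = bil (met G x) (- curv G x U V U) A"
      by (subst met_commute[OF x]) (simp add: curv_antisym[of x V])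
    also have "\<dots> = (\<Sum>d\<in>UNIV. \<Sum>f\<in>UNIV. \<Sum>c\<in>UNIV. \<Sum>a\<in>UNIV. V $ c * (riemann G x f c a d * U $ a * U $ f * ?l $ d))"
      unfolding m vector_uminus_component curv_riemann[OF x] minus_minus sum_distrib_right by (simp only: mult_ac)
    also have "\<dots> = (\<Sum>f\<in>UNIV. \<Sum>c\<in>UNIV. \<Sum>a\<in>UNIV. \<Sum>d\<in>UNIV. V $ c * (riemann G x f c a d * U $ a * U $ f * ?l $ d))"
      by (subst sum.swap, rule sum.cong[OF refl], subst sum.swap, rule sum.cong[OF refl], rule sum.swap)
    also have "\<dots> = (\<Sum>c\<in>UNIV. \<Sum>a\<in>UNIV. \<Sum>f\<in>UNIV. \<Sum>d\<in>UNIV. V $ c * (riemann G x f c a d * U $ a * U $ f * ?l $ d))"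
      by (subst sum.swap, rule sum.cong[OF refl], rule sum.swap)
    finally show ?thesis by simp
  qed
  have PA: "bil (schouten G x) Y A = (\<Sum>c\<in>UNIV. \<Sum>d\<in>UNIV. schouten_mixed G x d c * Y $ c * ?l $ d)" for Y
  proof -
    have "bil (schouten G x) Y A = bil (met G x) (sharp G x Y) A"
      by (simp add: schouten_commute[OF x, of Y] met_commute[OF x, of _ A] met_sharp[OF x])
    also have "\<dots> = (\<Sum>d\<in>UNIV. \<Sum>c\<in>UNIV. schouten_mixed G x d c * Y $ c * ?l $ d)"
      by (simp add: m sharp_def sum_distrib_right)
    finally show ?thesis by (subst sum.swap)
  qed
  have T1: "(\<Sum>c\<in>UNIV. \<Sum>a\<in>UNIV. \<Sum>f\<in>UNIV. \<Sum>d\<in>UNIV. V $ c * (G x $ f $ a * schouten_mixed G x d c * U $ a * U $ f * ?l $ d))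
     = bil (met G x) U U * bil (schouten G x) A V"
  proof -
    have "(\<Sum>c\<in>UNIV. \<Sum>a\<in>UNIV. \<Sum>f\<in>UNIV. \<Sum>d\<in>UNIV. V $ c * (G x $ f $ a * schouten_mixed G x d c * U $ a * U $ f * ?l $ d))
      = (\<Sum>c\<in>UNIV. (\<Sum>a\<in>UNIV. \<Sum>f\<in>UNIV. G x $ f $ a * U $ f * U $ a) * (\<Sum>d\<in>UNIV. schouten_mixed G x d c * V $ c * ?l $ d))"
      unfolding sum_distrib_right unfolding sum_distrib_left by (simp only: mult_ac)
    also have "(\<Sum>a\<in>UNIV. \<Sum>f\<in>UNIV. G x $ f $ a * U $ f * U $ a) = bil (met G x) U U"
      unfolding bil_def met_def by (rule sum.swap)
    finally show ?thesis by (simp add: sum_distrib_left[symmetric] PA schouten_commute[OF x, of A])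
  qed
  have T2: "(\<Sum>c\<in>UNIV. \<Sum>a\<in>UNIV. \<Sum>f\<in>UNIV. \<Sum>d\<in>UNIV. V $ c * ((if f = d then schouten G x a c else 0) * U $ a * U $ f * ?l $ d))
     = bil (met G x) U A * bil (schouten G x) U V"
  proof -
    have e: "(\<Sum>d\<in>UNIV. V $ c * ((if f = d then schouten G x a c else 0) * U $ a * U $ f * ?l $ d))
        = schouten G x a c * U $ a * V $ c * (U $ f * ?l $ f)" for a c f
    proof -
      have "(\<Sum>d\<in>UNIV. V $ c * ((if f = d then schouten G x a c else 0) * U $ a * U $ f * ?l $ d))
        = (\<Sum>d\<in>UNIV. if f = d then schouten G x a c * U $ a * V $ c * (U $ f * ?l $ f) else 0)"
        by (intro sum.cong) auto
      then show ?thesis by simp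
    qed
    have "(\<Sum>c\<in>UNIV. \<Sum>a\<in>UNIV. \<Sum>f\<in>UNIV. \<Sum>d\<in>UNIV. V $ c * ((if f = d then schouten G x a c else 0) * U $ a * U $ f * ?l $ d))
       = (\<Sum>c\<in>UNIV. \<Sum>a\<in>UNIV. schouten G x a c * U $ a * V $ c) * (\<Sum>f\<in>UNIV. U $ f * ?l $ f)"
      unfolding e by (simp add: sum_distrib_left[symmetric] sum_distrib_right[symmetric])
    also have "(\<Sum>c\<in>UNIV. \<Sum>a\<in>UNIV. schouten G x a c * U $ a * V $ c) = bil (schouten G x) U V"
      unfolding bil_def by (rule sum.swap)
    finally show ?thesis by (simp add: m)
  qed
  have T3: "(\<Sum>c\<in>UNIV. \<Sum>a\<in>UNIV. \<Sum>f\<in>UNIV. \<Sum>d\<in>UNIV. V $ c * (G x $ c $ a * schouten_mixed G x d f * U $ a * U $ f * ?l $ d))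
     = bil (met G x) V U * bil (schouten G x) A U"
  proof -
    have "(\<Sum>c\<in>UNIV. \<Sum>a\<in>UNIV. \<Sum>f\<in>UNIV. \<Sum>d\<in>UNIV. V $ c * (G x $ c $ a * schouten_mixed G x d f * U $ a * U $ f * ?l $ d))
      = (\<Sum>c\<in>UNIV. \<Sum>a\<in>UNIV. G x $ c $ a * V $ c * U $ a) * (\<Sum>f\<in>UNIV. \<Sum>d\<in>UNIV. schouten_mixed G x d f * U $ f * ?l $ d)"
      unfolding sum_distrib_right unfolding sum_distrib_left by (simp only: mult_ac)
    then show ?thesis by (simp add: bil_def[of "met G x"] met_def PA schouten_commute[OF x, of A])
  qed
  have T4: "(\<Sum>c\<in>UNIV. \<Sum>a\<in>UNIV. \<Sum>f\<in>UNIV. \<Sum>d\<in>UNIV. V $ c * ((if c = d then schouten G x a f else 0) * U $ a * U $ f * ?l $ d))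
     = bil (met G x) A V * bil (schouten G x) U U"
  proof -
    have e: "(\<Sum>d\<in>UNIV. V $ c * ((if c = d then schouten G x a f else 0) * U $ a * U $ f * ?l $ d))
        = (V $ c * ?l $ c) * (schouten G x a f * U $ a * U $ f)" for a c f
    proof -
      have "(\<Sum>d\<in>UNIV. V $ c * ((if c = d then schouten G x a f else 0) * U $ a * U $ f * ?l $ d))
        = (\<Sum>d\<in>UNIV. if c = d then (V $ c * ?l $ c) * (schouten G x a f * U $ a * U $ f) else 0)"
        by (intro sum.cong) auto
      then show ?thesis by simp
    qed
    have "(\<Sum>c\<in>UNIV. \<Sum>a\<in>UNIV. \<Sum>f\<in>UNIV. \<Sum>d\<in>UNIV. V $ c * ((if c = d then schouten G x a f else 0) * U $ a * U $ f * ?l $ d))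
       = (\<Sum>c\<in>UNIV. V $ c * ?l $ c) * bil (schouten G x) U U"
      unfolding e by (simp add: bil_def sum_distrib_left[symmetric] sum_distrib_right[symmetric])
    then show ?thesis by (simp add: m[symmetric] met_commute[OF x, of A])
  qed
  have "(\<Sum>c\<in>UNIV. V $ c * (\<Sum>a\<in>UNIV. \<Sum>f\<in>UNIV. \<Sum>d\<in>UNIV. weyl G x f c a d * U $ a * U $ f * ?l $ d)) =
     (\<Sum>c\<in>UNIV. \<Sum>a\<in>UNIV. \<Sum>f\<in>UNIV. \<Sum>d\<in>UNIV. V $ c * (riemann G x f c a d * U $ a * U $ f * ?l $ d)
       - V $ c * (G x $ f $ a * schouten_mixed G x d c * U $ a * U $ f * ?l $ d)
       + V $ c * ((if f = d then schouten G x a c else 0) * U $ a * U $ f * ?l $ d)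
       + V $ c * (G x $ c $ a * schouten_mixed G x d f * U $ a * U $ f * ?l $ d)
       - V $ c * ((if c = d then schouten G x a f else 0) * U $ a * U $ f * ?l $ d))"
    unfolding sum_distrib_left weyl_def by (intro sum.cong refl) (simp only: algebra_simps)
  also have "\<dots> = bil (met G x) A (curv G x V U U)
    - bil (met G x) U U * bil (schouten G x) A V + bil (met G x) U A * bil (schouten G x) U V
       + bil (met G x) V U * bil (schouten G x) A U - bil (met G x) A V * bil (schouten G x) U U"
    by (simp only: sum.distrib sum_subtractf R T1 T2 T3 T4)
  finally show ?thesis by simp
qed

end

section \<open>Change of chart\<close>

locale chart_change = P: metric_patch G \<Omega> + P': metric_patch G' \<Omega>'
  for G :: "real^'n::finite \<Rightarrow> real^'n^'n" and \<Omega> and G' :: "real^'n \<Rightarrow> real^'n^'n" and \<Omega>' +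
  fixes \<phi> :: "real^'n \<Rightarrow> real^'n" and D :: "(real^'n) set"
  assumes open_D: "open D" and D_sub: "D \<subseteq> \<Omega>" and smooth_phi: "smooth_on D \<phi>" and phi_D: "\<phi> ` D \<subseteq> \<Omega>'"
    and isometry: "x \<in> D \<Longrightarrow> bil (met G x) X Y = bil (met G' (\<phi> x)) (dd \<phi> x X) (dd \<phi> x Y)"
begin

lemma D_in: "x \<in> D \<Longrightarrow> x \<in> \<Omega>" and phi_in: "x \<in> D \<Longrightarrow> \<phi> x \<in> \<Omega>'"
  using D_sub phi_D by auto

lemma linear_J: "x \<in> D \<Longrightarrow> linear (dd \<phi> x)"
  by (rule linear_frechet_derivative[OF smooth_on_differentiable[OF smooth_phi open_D]])

lemma inj_J: "x \<in> D \<Longrightarrow> inj (dd \<phi> x)"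
proof (subst linear_injective_0[OF linear_J], assumption, intro allI impI)
  fix X assume x: "x \<in> D" and "dd \<phi> x X = 0"
  then have "bil (met G x) z X = bil (met G x) z 0" for z by (simp add: isometry bil_algebra)
  then show "X = 0" by (rule P.met_nondegenerate[OF D_in[OF x]])
qed

lemma surj_J: "x \<in> D \<Longrightarrow> surj (dd \<phi> x)"
  by (rule linear_injective_imp_surjective[OF linear_J inj_J refl])

lemma met'_eqI:
  assumes "x \<in> D" "\<And>z. bil (met G' (\<phi> x)) (dd \<phi> x z) X = bil (met G' (\<phi> x)) (dd \<phi> x z) Y"
  shows "X = Y"
proof (rule P'.met_nondegenerate[OF phi_in[OF assms(1)]])
  fix z obtain z' where "z = dd \<phi> x z'" using surj_J[OF assms(1)] by (metis surjD)
  then show "bil (met G' (\<phi> x)) z X = bil (met G' (\<phi> x)) z Y" using assms(2) by simp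
qed

definition hess :: "real^'n \<Rightarrow> real^'n \<Rightarrow> real^'n \<Rightarrow> real^'n" where
  "hess x u w = dd (\<lambda>y. dd \<phi> y w) x u"

lemma hess_sym: "x \<in> D \<Longrightarrow> hess x u w = hess x w u"
  unfolding hess_def by (rule symmetric_second_derivative[OF smooth_phi open_D])

lemma linear_hess1: "x \<in> D \<Longrightarrow> linear (\<lambda>u. hess x u w)"
  unfolding hess_def
  by (rule linear_frechet_derivative[OF smooth_on_differentiable[OF smooth_on_frechet_derivative[OF smooth_phi] open_D]])

lemma linear_hess2: "x \<in> D \<Longrightarrow> linear (\<lambda>w. hess x u w)"
  using linear_hess1[of x u] by (simp add: hess_sym[of x u])

lemma dcoef_transform:
  assumes x: "x \<in> D"
  shows "bil (dcoef (met G) x u) X Y = bil (dcoef (met G') (\<phi> x) (dd \<phi> x u)) (dd \<phi> x X) (dd \<phi> x Y)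
     + bil (met G' (\<phi> x)) (hess x u X) (dd \<phi> x Y) + bil (met G' (\<phi> x)) (dd \<phi> x X) (hess x u Y)"
proof -
  have s: "smooth_on D (\<lambda>y. dd \<phi> y X)" for X by (rule smooth_on_frechet_derivative[OF smooth_phi])
  have "dd (\<lambda>y. bil (met G y) X Y) x u = dd (\<lambda>y. bil (met G' (\<phi> y)) (dd \<phi> y X) (dd \<phi> y Y)) x u"
    by (rule fun_cong[OF frechet_derivative_cong_open[OF open_D x]]) (rule isometry)
  moreover have "dd (\<lambda>y. bil (met G y) X Y) x u = bil (dcoef (met G) x u) X Y"
    by (subst dd_eqI[OF bil_has_derivative[where F="\<lambda>y. y" and X="\<lambda>_. X" and Y="\<lambda>_. Y"]])
      (auto intro: smooth_on_differentiable[OF P.smooth_met P.open_dom D_in[OF x]] simp: bil_algebra frechet_derivative_ident)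
  moreover have "dd (\<lambda>y. bil (met G' (\<phi> y)) (dd \<phi> y X) (dd \<phi> y Y)) x u =
     bil (dcoef (met G') (\<phi> x) (dd \<phi> x u)) (dd \<phi> x X) (dd \<phi> x Y)
     + bil (met G' (\<phi> x)) (hess x u X) (dd \<phi> x Y) + bil (met G' (\<phi> x)) (dd \<phi> x X) (hess x u Y)"
    unfolding hess_def
    by (rule dd_eqI[OF bil_has_derivative])
     (intro smooth_on_differentiable[OF P'.smooth_met P'.open_dom phi_in[OF x]] smooth_on_differentiable[OF s open_D x]
       smooth_on_differentiable[OF smooth_phi open_D x])+
  ultimately show ?thesis by simp
qed

text \<open>Differentiating the isometry condition expresses the derivatives of the metric by those of the
  other metric and by Hessians of \<open>\<phi>\<close>. In the Koszul combination two of the three pairs of Hessian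
  terms cancel.\<close>

lemma chr_transform:
  assumes x: "x \<in> D"
  shows "dd \<phi> x (chr G x u w) = hess x u w + chr G' (\<phi> x) (dd \<phi> x u) (dd \<phi> x w)"
proof (rule met'_eqI[OF x])
  fix z
  note c = P'.met_commute[OF phi_in[OF x]]
  show "bil (met G' (\<phi> x)) (dd \<phi> x z) (dd \<phi> x (chr G x u w)) =
        bil (met G' (\<phi> x)) (dd \<phi> x z) (hess x u w + chr G' (\<phi> x) (dd \<phi> x u) (dd \<phi> x w))"
    unfolding isometry[OF x, symmetric] P.koszul[OF D_in[OF x]] bil_algebra P'.koszul[OF phi_in[OF x]]
      dcoef_transform[OF x] hess_sym[OF x, of z u] hess_sym[OF x, of z w] hess_sym[OF x, of w u]
      c[of "dd \<phi> x u" "hess x w z"]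
    by (simp add: field_simps)
qed

lemma dd_eq_sum_axis: "x \<in> D \<Longrightarrow> dd \<phi> x w = (\<Sum>k\<in>UNIV. w $ k *\<^sub>R dd \<phi> x (axis k 1))"
  using linear_sum[OF linear_J, of x "\<lambda>k. w $ k *\<^sub>R axis k 1" UNIV] basis_expansion[of w, unfolded scalar_mult_eq_scaleR]
  by (simp add: linear_cmul[OF linear_J])

context
  fixes N :: "'p::real_normed_vector set" and F :: "'p \<Rightarrow> real^'n"
  assumes N: "open N" and F: "smooth_on N F" and FN: "F ` N \<subseteq> D"
begin

lemma smooth_push: "smooth_on N X \<Longrightarrow> smooth_on N (\<lambda>p. dd \<phi> (F p) (X p))"
proof -
  assume X: "smooth_on N X"
  have "smooth_on N (\<lambda>p. \<Sum>k\<in>UNIV. X p $ k *\<^sub>R dd \<phi> (F p) (axis k 1))"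
    by (intro smooth_on_sum smooth_on_scaleR smooth_on_vec_nth N X
      smooth_on_compose[OF N open_D smooth_on_frechet_derivative[OF smooth_phi] F FN])
  then show ?thesis using FN by (subst smooth_on_cong[OF N dd_eq_sum_axis]) auto
qed

text \<open>The vector \<open>X p\<close> varies with \<open>p\<close>, so it is expanded in the standard basis before differentiating.\<close>

lemma dd_push:
  assumes X: "smooth_on N X" and p: "p \<in> N"
  shows "dd (\<lambda>p. dd \<phi> (F p) (X p)) p w = hess (F p) (dd F p w) (X p) + dd \<phi> (F p) (dd X p w)"
proof -
  have Fp: "F p \<in> D" using p FN by auto
  have dF: "((\<lambda>p. dd \<phi> (F p) (axis k 1)) has_derivative (\<lambda>w. hess (F p) (dd F p w) (axis k 1))) (at p)" for k
    using diff_chain_at[OF smooth_on_has_derivative[OF F N p] smooth_on_has_derivative[OF smooth_on_frechet_derivative[OF smooth_phi] open_D Fp]]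
    by (simp add: o_def hess_def)
  have dX: "((\<lambda>p. X p $ k) has_derivative (\<lambda>w. dd X p w $ k)) (at p)" for k
    by (rule bounded_linear.has_derivative[OF bounded_linear_vec_nth smooth_on_has_derivative[OF X N p]])
  have "dd (\<lambda>p. dd \<phi> (F p) (X p)) p w = dd (\<lambda>p. \<Sum>k\<in>UNIV. X p $ k *\<^sub>R dd \<phi> (F p) (axis k 1)) p w"
    by (rule fun_cong[OF frechet_derivative_cong_open[OF N p]], rule dd_eq_sum_axis) (use FN in auto)
  also have "\<dots> = (\<Sum>k\<in>UNIV. X p $ k *\<^sub>R hess (F p) (dd F p w) (axis k 1) + dd X p w $ k *\<^sub>R dd \<phi> (F p) (axis k 1))"
    by (rule dd_eqI) (intro has_derivative_sum has_derivative_scaleR dF dX)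
  also have "\<dots> = hess (F p) (dd F p w) (X p) + dd \<phi> (F p) (dd X p w)"
    using linear_sum[OF linear_hess2[OF Fp, of "dd F p w"], of "\<lambda>k. X p $ k *\<^sub>R axis k 1" UNIV]
      basis_expansion[of "X p", unfolded scalar_mult_eq_scaleR]
    by (simp add: linear_cmul[OF linear_hess2[OF Fp]] sum.distrib dd_eq_sum_axis[OF Fp, of "dd X p w"])
  finally show ?thesis .
qed

text \<open>Covariant derivatives are vectors: the Hessian terms in \<open>dd_push\<close> and \<open>chr_transform\<close> cancel.\<close>

lemma cov_push:
  assumes X: "smooth_on N X" and p: "p \<in> N"
  shows "cov G' (\<lambda>p. \<phi> (F p)) w (\<lambda>p. dd \<phi> (F p) (X p)) p = dd \<phi> (F p) (cov G F w X p)"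
proof -
  have Fp: "F p \<in> D" using p FN by auto
  have "dd (\<lambda>p. \<phi> (F p)) p w = dd \<phi> (F p) (dd F p w)"
    using dd_eqI[OF diff_chain_at[OF smooth_on_has_derivative[OF F N p] smooth_on_has_derivative[OF smooth_phi open_D Fp]]]
    by (simp add: o_def)
  then show ?thesis
    by (simp add: cov_def dd_push[OF X p] linear_add[OF linear_J[OF Fp]] chr_transform[OF Fp])
qed

end

text \<open>Curvature is a commutator of covariant derivatives (along the identity map, of constant fields),
  and these transform as vectors. This avoids differentiating the transformation law of the
  Christoffel symbols.\<close>

lemma curv_transform:
  assumes x: "x \<in> D"
  shows "dd \<phi> x (curv G x v u w) = curv G' (\<phi> x) (dd \<phi> x v) (dd \<phi> x u) (dd \<phi> x w)"
proof -
  let ?I = "\<lambda>y::real^'n. y" and ?W = "\<lambda>y::real^'n. w"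
  have I: "smooth_on D ?I" "?I ` D \<subseteq> D" "?I ` D \<subseteq> \<Omega>" using D_sub by (auto intro: smooth_on_ident open_D)
  have W: "smooth_on D ?W" by (rule smooth_on_const)
  have c: "cov G' \<phi> v (cov G' \<phi> u (\<lambda>y. dd \<phi> y w)) x = dd \<phi> x (cov G ?I v (cov G ?I u ?W) x)" for v u
  proof -
    have e: "cov G' \<phi> u (\<lambda>y. dd \<phi> y w) y = dd \<phi> y (cov G ?I u ?W y)" if "y \<in> D" for y
      using cov_push[OF open_D I(1,2) W that] by simp
    have "cov G' \<phi> v (cov G' \<phi> u (\<lambda>y. dd \<phi> y w)) x = cov G' \<phi> v (\<lambda>y. dd \<phi> y (cov G ?I u ?W y)) x"
      unfolding cov_def[of G' \<phi> v] e[OF x]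
      by (rule arg_cong2[where f="(+)", OF fun_cong[OF frechet_derivative_cong_open[OF open_D x e]] refl])
    also have "\<dots> = dd \<phi> x (cov G ?I v (cov G ?I u ?W) x)"
      using cov_push[OF open_D I(1,2) P.smooth_cov[OF open_D I(1,3) W] x] by simp
    finally show ?thesis .
  qed
  have "curv G' (\<phi> x) (dd \<phi> x v) (dd \<phi> x u) (dd \<phi> x w)
    = cov G' \<phi> v (cov G' \<phi> u (\<lambda>y. dd \<phi> y w)) x - cov G' \<phi> u (cov G' \<phi> v (\<lambda>y. dd \<phi> y w)) x"
    by (rule P'.cov_commutator[OF open_D smooth_phi phi_D smooth_on_frechet_derivative[OF smooth_phi] x, symmetric])
  also have "\<dots> = dd \<phi> x (cov G ?I v (cov G ?I u ?W) x - cov G ?I u (cov G ?I v ?W) x)"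
    unfolding c by (simp add: linear_diff[OF linear_J[OF x]])
  also have "cov G ?I v (cov G ?I u ?W) x - cov G ?I u (cov G ?I v ?W) x = curv G x v u w"
    using P.cov_commutator[OF open_D I(1,3) W x] by (simp add: frechet_derivative_ident)
  finally show ?thesis by simp
qed

lemma trace_conj:
  fixes f f' :: "real^'n \<Rightarrow> real^'n"
  assumes x: "x \<in> D" and f: "linear f" "linear f'" and e: "\<And>u. dd \<phi> x (f u) = f' (dd \<phi> x u)"
  shows "(\<Sum>b\<in>UNIV. f (axis b 1) $ b) = (\<Sum>b\<in>UNIV. f' (axis b 1) $ b)"
proof -
  define J where "J = matrix (dd \<phi> x)"
  have tr: "(\<Sum>b\<in>UNIV. g (axis b 1) $ b) = trace (matrix g)" for g :: "real^'n \<Rightarrow> real^'n"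
    by (simp add: trace_def matrix_def)
  obtain J' where J': "J' ** J = mat 1" "J ** J' = mat 1"
    using inj_J[OF x] surj_J[OF x] linear_J[OF x] invertible_eq_bij[of J] unfolding J_def invertible_def
    by (auto simp: bij_def)
  have "J *v (matrix f *v u) = matrix f' *v (J *v u)" for u
    using e by (simp add: J_def f linear_J[OF x])
  then have "J ** matrix f = matrix f' ** J"
    by (simp add: matrix_eq flip: matrix_vector_mul_assoc)
  then have "J' ** (J ** matrix f) = J' ** (matrix f' ** J)" by simp
  then have "matrix f = J' ** matrix f' ** J" by (simp add: matrix_mul_assoc J')
  then have "trace (matrix f) = trace (matrix f' ** J ** J')"
    by (metis trace_mul_sym matrix_mul_assoc)
  then show ?thesis by (simp add: tr J' flip: matrix_mul_assoc)
qed

text \<open>The Ricci form is a trace of the curvature, and traces are invariant under conjugation with the Jacobian.\<close>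

lemma ricci_transform:
  assumes x: "x \<in> D"
  shows "bil (ricci G x) v w = bil (ricci G' (\<phi> x)) (dd \<phi> x v) (dd \<phi> x w)"
  unfolding P.ricci_eq_trace[OF D_in[OF x]] P'.ricci_eq_trace[OF phi_in[OF x]]
  by (rule arg_cong[where f=uminus], rule trace_conj[OF x P.linear_curv2[OF D_in[OF x]] P'.linear_curv2[OF phi_in[OF x]]])
    (rule curv_transform[OF x])

text \<open>The scalar curvature is the trace of the endomorphism \<open>f\<close> that corresponds to the Ricci form under
  the metric; the Jacobian conjugates the two endomorphisms \<open>f\<close> and \<open>f'\<close> of the two charts.\<close>

lemma ricci_scalar_transform:
  assumes x: "x \<in> D"
  shows "ricci_scalar G x = ricci_scalar G' (\<phi> x)"
proof -
  have s: "ricci_scalar G x = (\<Sum>b\<in>UNIV. (matrix_inv (G x) *v (\<chi> c. bil (ricci G x) (axis c 1) (axis b 1))) $ b)"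
    if "transpose (matrix_inv (G x)) = matrix_inv (G x)" for G :: "real^'n \<Rightarrow> real^'n^'n" and x
  proof -
    have "matrix_inv (G x) $ a $ b = matrix_inv (G x) $ b $ a" for a b
      using arg_cong[OF that, of "\<lambda>M. M $ b $ a"] by (simp add: transpose_def)
    then show ?thesis unfolding ricci_scalar_def by (subst sum.swap) (simp add: matrix_vector_mult_def bil_axis)
  qed
  define f where "f = (\<lambda>w. matrix_inv (G x) *v (\<chi> c. bil (ricci G x) (axis c 1) w))"
  define f' where "f' = (\<lambda>w. matrix_inv (G' (\<phi> x)) *v (\<chi> c. bil (ricci G' (\<phi> x)) (axis c 1) w))"
  have lin: "linear (\<lambda>w. M *v (\<chi> c. bil r (axis c 1) w))" for M :: "real^'n^'n" and r
  proof -
    have "linear (\<lambda>w. (\<chi> c. bil r (axis c 1) w) :: real^'n)"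
      by (rule linearI) (simp_all add: vec_eq_iff bil_algebra)
    then show ?thesis
      by (rule linear_compose[unfolded o_def, OF _ matrix_vector_mul_linear])
  qed
  have key: "bil (met G x) z (matrix_inv (G x) *v (\<chi> c. bil r (axis c 1) w)) = bil r z w"
    if "invertible (G x)" for G :: "real^'n \<Rightarrow> real^'n^'n" and x r w z
  proof -
    have "bil (met G x) z (matrix_inv (G x) *v (\<chi> c. bil r (axis c 1) w)) = z \<bullet> (\<chi> c. bil r (axis c 1) w)"
      by (simp add: inner_matrix_eq_bil[of _ G x, symmetric] matrix_vector_mul_assoc matrix_inv_right[OF that])
    also have "\<dots> = bil r z w"
    proof -
      have "bil r (axis c 1) w = (\<Sum>b\<in>UNIV. r c b * w $ b)" for c
      proof -
        have "r a b * axis c 1 $ a * w $ b = (if a = c then r c b * w $ b else 0)" for a b by (simp add: axis_def)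
        then show ?thesis unfolding bil_def by (subst sum.swap) simp
      qed
      then show ?thesis by (simp add: inner_vec_def bil_def sum_distrib_left mult_ac)
    qed
    finally show ?thesis .
  qed
  have "(\<Sum>b\<in>UNIV. f (axis b 1) $ b) = (\<Sum>b\<in>UNIV. f' (axis b 1) $ b)"
  proof (rule trace_conj[OF x])
    fix u show "dd \<phi> x (f u) = f' (dd \<phi> x u)"
    proof (rule met'_eqI[OF x])
      fix z
      show "bil (met G' (\<phi> x)) (dd \<phi> x z) (dd \<phi> x (f u)) = bil (met G' (\<phi> x)) (dd \<phi> x z) (f' (dd \<phi> x u))"
        unfolding isometry[OF x, symmetric] f_def f'_def
          key[where G=G and x=x, OF P.metric_invertible[OF D_in[OF x]]] key[where G=G' and x="\<phi> x", OF P'.metric_invertible[OF phi_in[OF x]]]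
        by (rule ricci_transform[OF x])
    qed
  qed (auto simp: f_def f'_def lin)
  then show ?thesis
    unfolding f_def f'_def s[where G=G and x=x, OF P.matrix_inv_sym[OF D_in[OF x]]] s[where G=G' and x="\<phi> x", OF P'.matrix_inv_sym[OF phi_in[OF x]]] .
qed

lemma schouten_transform:
  "x \<in> D \<Longrightarrow> bil (schouten G x) v w = bil (schouten G' (\<phi> x)) (dd \<phi> x v) (dd \<phi> x w)"
  by (simp add: P.bil_schouten P'.bil_schouten ricci_transform ricci_scalar_transform isometry)

end

section \<open>Vector fields along a variation\<close>

locale pr_manifold =
  fixes M :: "('m, 'n::finite) metric_manifold"
  assumes pseudo_riemannian: "pseudo_riemannian_manifold M"
begin

lemma manifold_smooth: "smooth_manifold M" using pseudo_riemannian by (simp add: pseudo_riemannian_manifold_def)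

lemma chart_inj: "c \<in> Atlas M \<Longrightarrow> inj_on (snd c) (fst c)"
proof -
  assume c: "c \<in> Atlas M"
  have "topspace (subtopology (Top M) (fst c)) = fst c"
    using c manifold_smooth openin_subset[of "Top M" "fst c"] by (auto simp: smooth_manifold_def)
  moreover have "homeomorphic_map (subtopology (Top M) (fst c)) (top_of_set (snd c ` fst c)) (snd c)"
    using c manifold_smooth by (simp add: smooth_manifold_def)
  ultimately show ?thesis using homeomorphic_imp_injective_map by metis
qed

lemma chart_image_open: "c \<in> Atlas M \<Longrightarrow> open (snd c ` fst c)"
  using manifold_smooth by (simp add: smooth_manifold_def)

lemma overlap_open:
  assumes c: "c \<in> Atlas M" and c': "c' \<in> Atlas M"
  shows "open (snd c ` (fst c \<inter> fst c'))"
proof -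
  have "homeomorphic_map (subtopology (Top M) (fst c)) (top_of_set (snd c ` fst c)) (snd c)"
    using c manifold_smooth by (simp add: smooth_manifold_def)
  then have "open_map (subtopology (Top M) (fst c)) (top_of_set (snd c ` fst c)) (snd c)"
    by (rule homeomorphic_imp_open_map)
  moreover have "openin (subtopology (Top M) (fst c)) (fst c \<inter> fst c')"
    using c' manifold_smooth by (auto simp: smooth_manifold_def openin_subtopology_Int2)
  ultimately have "openin (top_of_set (snd c ` fst c)) (snd c ` (fst c \<inter> fst c'))"
    by (simp add: open_map_def)
  then show ?thesis using chart_image_open[OF c] openin_open_trans by blast
qed

lemma transition_apply:
  assumes "c \<in> Atlas M" "p \<in> fst c"
  shows "transition c c' (snd c p) = snd c' p"
  using inv_into_f_f[OF chart_inj[OF assms(1)] assms(2)] by (simp add: transition_def)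

lemma in_overlap_iff:
  assumes "c \<in> Atlas M" "p \<in> fst c"
  shows "snd c p \<in> snd c ` (fst c \<inter> fst c') \<longleftrightarrow> p \<in> fst c'"
  using inj_on_image_mem_iff[OF chart_inj[OF assms(1)] assms(2), of "fst c \<inter> fst c'"] assms(2) by simp

lemma metric_patch_chart: "c \<in> Atlas M \<Longrightarrow> metric_patch (Metric M c) (snd c ` fst c)"
  using pseudo_riemannian by (auto simp: metric_patch_def pseudo_riemannian_manifold_def smooth_manifold_def)

lemma chart_change_charts:
  assumes c: "c \<in> Atlas M" and c': "c' \<in> Atlas M"
  shows "chart_change (Metric M c) (snd c ` fst c) (Metric M c') (snd c' ` fst c') (transition c c') (snd c ` (fst c \<inter> fst c'))"
proof -
  interpret P: metric_patch "Metric M c" "snd c ` fst c" by (rule metric_patch_chart[OF c])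
  interpret P': metric_patch "Metric M c'" "snd c' ` fst c'" by (rule metric_patch_chart[OF c'])
  show ?thesis
  proof unfold_locales
    show "open (snd c ` (fst c \<inter> fst c'))" by (rule overlap_open[OF c c'])
    show "smooth_on (snd c ` (fst c \<inter> fst c')) (transition c c')"
      using manifold_smooth c c' by (simp add: smooth_manifold_def)
    show "transition c c' ` snd c ` (fst c \<inter> fst c') \<subseteq> snd c' ` fst c'"
      by (auto simp: transition_apply[OF c])
    have law: "\<forall>c\<in>Atlas M. \<forall>c'\<in>Atlas M. \<forall>p\<in>fst c \<inter> fst c'. \<forall>X Y.
        (let J = frechet_derivative (transition c c') (at (snd c p))
         in X \<bullet> (Metric M c (snd c p) *v Y) = J X \<bullet> (Metric M c' (snd c' p) *v J Y))"
      using pseudo_riemannian unfolding pseudo_riemannian_manifold_def by blast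
    fix x X Y assume "x \<in> snd c ` (fst c \<inter> fst c')"
    then obtain p where p: "p \<in> fst c \<inter> fst c'" "x = snd c p" by auto
    have "X \<bullet> (Metric M c x *v Y) = dd (transition c c') x X \<bullet> (Metric M c' (snd c' p) *v dd (transition c c') x Y)"
      using law[rule_format, OF c c' p(1), of X Y] unfolding Let_def p(2) .
    then show "bil (met (Metric M c) x) X Y = bil (met (Metric M c') (transition c c' x)) (dd (transition c c') x X) (dd (transition c c') x Y)"
      using p by (simp add: transition_apply[OF c] inner_matrix_eq_bil[of _ "Metric M c" "snd c p", symmetric]
          inner_matrix_eq_bil[of _ "Metric M c'" "snd c' p", symmetric])
  qed auto
qed

text \<open>\<open>tvec\<close> admits unrelated components in different charts; this is the transformation law of a genuine tangent vector.\<close>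

definition tensorial :: "'m \<Rightarrow> ('m, 'n) tvec \<Rightarrow> bool" where
  "tensorial p X \<longleftrightarrow> (\<forall>c\<in>Atlas M. \<forall>c'\<in>Atlas M. p \<in> fst c \<longrightarrow> p \<in> fst c' \<longrightarrow>
     X c' = dd (transition c c') (snd c p) (X c))"

lemma tensorialD: "tensorial p X \<Longrightarrow> c \<in> Atlas M \<Longrightarrow> c' \<in> Atlas M \<Longrightarrow> p \<in> fst c \<Longrightarrow> p \<in> fst c' \<Longrightarrow>
     X c' = dd (transition c c') (snd c p) (X c)"
  unfolding tensorial_def by blast

lemma linear_transition:
  "c \<in> Atlas M \<Longrightarrow> c' \<in> Atlas M \<Longrightarrow> p \<in> fst c \<Longrightarrow> p \<in> fst c' \<Longrightarrow> linear (dd (transition c c') (snd c p))"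
  by (rule chart_change.linear_J[OF chart_change_charts]) auto

lemma tensorialI:
  "(\<And>c c'. c \<in> Atlas M \<Longrightarrow> c' \<in> Atlas M \<Longrightarrow> p \<in> fst c \<Longrightarrow> p \<in> fst c' \<Longrightarrow>
     X c' = dd (transition c c') (snd c p) (X c)) \<Longrightarrow> tensorial p X"
  unfolding tensorial_def by blast

lemma tensorial_add:
  assumes X: "tensorial p X" and Y: "tensorial p Y"
  shows "tensorial p (\<lambda>c. X c + Y c)"
proof (rule tensorialI)
  fix c c' assume c: "c \<in> Atlas M" "c' \<in> Atlas M" "p \<in> fst c" "p \<in> fst c'"
  show "X c' + Y c' = dd (transition c c') (snd c p) (X c + Y c)"
    unfolding linear_add[OF linear_transition[OF c]] tensorialD[OF X c] tensorialD[OF Y c] ..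
qed

lemma tensorial_scaleR:
  assumes X: "tensorial p X"
  shows "tensorial p (\<lambda>c. r *\<^sub>R X c)"
proof (rule tensorialI)
  fix c c' assume c: "c \<in> Atlas M" "c' \<in> Atlas M" "p \<in> fst c" "p \<in> fst c'"
  show "r *\<^sub>R X c' = dd (transition c c') (snd c p) (r *\<^sub>R X c)"
    unfolding linear_cmul[OF linear_transition[OF c]] tensorialD[OF X c] ..
qed

lemma chart_at:
  assumes "c \<in> Atlas M" "p \<in> fst c"
  shows "chart_at M p \<in> Atlas M" "p \<in> fst (chart_at M p)"
  using someI[of "\<lambda>c. c \<in> Atlas M \<and> p \<in> fst c" c] assms by (auto simp: chart_at_def)

lemma ip_chart_at: "ip M p X Y = bil (met (Metric M (chart_at M p)) (snd (chart_at M p) p)) (X (chart_at M p)) (Y (chart_at M p))"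
  by (simp add: ip_def Let_def inner_matrix_eq_bil[of _ "Metric M (chart_at M p)"])

text \<open>Near a given point a single chart may be used, although \<open>chart_at\<close> can jump from one point to the
  next; this is what makes inner products smooth functions of the parameters.\<close>

lemma ip_chart:
  assumes c: "c \<in> Atlas M" "p \<in> fst c" and "tensorial p X" "tensorial p Y"
  shows "ip M p X Y = bil (met (Metric M c) (snd c p)) (X c) (Y c)"
proof -
  note d = chart_at[OF c]
  have "bil (met (Metric M c) (snd c p)) (X c) (Y c) = ip M p X Y"
    using chart_change.isometry[OF chart_change_charts[OF c(1) d(1)], of "snd c p" "X c" "Y c"] c d
    by (simp add: ip_chart_at transition_apply tensorialD[OF assms(3) c(1) d(1)] tensorialD[OF assms(4) c(1) d(1)])
  then show ?thesis by simp
qed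

lemma schouten_form_chart_at: "schouten_form M p X Y = bil (schouten (Metric M (chart_at M p)) (snd (chart_at M p) p)) (X (chart_at M p)) (Y (chart_at M p))"
  by (simp add: schouten_form_def Let_def bil_def)

lemma schouten_form_chart:
  assumes c: "c \<in> Atlas M" "p \<in> fst c" and "tensorial p X" "tensorial p Y"
  shows "schouten_form M p X Y = bil (schouten (Metric M c) (snd c p)) (X c) (Y c)"
proof -
  note d = chart_at[OF c]
  have "bil (schouten (Metric M c) (snd c p)) (X c) (Y c) = schouten_form M p X Y"
    using chart_change.schouten_transform[OF chart_change_charts[OF c(1) d(1)], of "snd c p" "X c" "Y c"] c d
    by (simp add: schouten_form_chart_at transition_apply tensorialD[OF assms(3) c(1) d(1)] tensorialD[OF assms(4) c(1) d(1)])
  then show ?thesis by simp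
qed

lemma schouten_sharp_eq: "schouten_sharp M p X c = sharp (Metric M c) (snd c p) (X c)"
  by (simp add: schouten_sharp_def sharp_def)

lemma ip_algebra:
  "ip M p (\<lambda>c. X c + X' c) Y = ip M p X Y + ip M p X' Y" "ip M p X (\<lambda>c. Y c + Y' c) = ip M p X Y + ip M p X Y'"
  "ip M p (\<lambda>c. X c - X' c) Y = ip M p X Y - ip M p X' Y" "ip M p X (\<lambda>c. Y c - Y' c) = ip M p X Y - ip M p X Y'"
  "ip M p (\<lambda>c. r *\<^sub>R X c) Y = r * ip M p X Y" "ip M p X (\<lambda>c. r *\<^sub>R Y c) = r * ip M p X Y"
  by (simp_all add: ip_chart_at bil_algebra)

lemma schouten_form_algebra:
  "schouten_form M p X (\<lambda>c. Y c + Y' c) = schouten_form M p X Y + schouten_form M p X Y'"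
  "schouten_form M p X (\<lambda>c. Y c - Y' c) = schouten_form M p X Y - schouten_form M p X Y'"
  "schouten_form M p X (\<lambda>c. r *\<^sub>R Y c) = r * schouten_form M p X Y"
  by (simp_all add: schouten_form_chart_at bil_algebra)

context
  fixes p c assumes c: "c \<in> Atlas M" "p \<in> fst c"
begin

lemma ip_commute: "ip M p X Y = ip M p Y X"
  unfolding ip_chart_at
  by (rule metric_patch.met_commute[OF metric_patch_chart]) (use chart_at[OF c] in auto)

lemma schouten_form_commute: "schouten_form M p X Y = schouten_form M p Y X"
  unfolding schouten_form_chart_at
  by (rule metric_patch.schouten_commute[OF metric_patch_chart]) (use chart_at[OF c] in auto)

lemma ip_schouten_sharp: "ip M p X (schouten_sharp M p Y) = schouten_form M p X Y"
  unfolding ip_chart_at schouten_form_chart_at schouten_sharp_eq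
  by (rule metric_patch.met_sharp[OF metric_patch_chart]) (use chart_at[OF c] in auto)

end

end

text \<open>One-sided derivatives at the boundary of the parameter rectangle are read off from a smooth
  extension to an open neighbourhood.\<close>

lemma has_vector_derivative_slice:
  fixes fh :: "real \<times> real \<Rightarrow> 'b::real_normed_vector"
  assumes N: "open N" "(s, t) \<in> N" and fh: "smooth_on N fh"
    and eq: "\<And>q. q \<in> I \<times> T \<Longrightarrow> q \<in> N \<Longrightarrow> fh q = f (fst q) (snd q)" and st: "s \<in> I" "t \<in> T"
  shows "((f s) has_vector_derivative dd fh (s, t) (0, 1)) (at t within T)"
    and "((\<lambda>\<sigma>. f \<sigma> t) has_vector_derivative dd fh (s, t) (1, 0)) (at s within I)"
proof -
  have D: "(fh has_derivative dd fh (s, t)) (at (s, t))" by (rule smooth_on_has_derivative[OF fh N])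
  have L: "linear (dd fh (s, t))" using D by (rule has_derivative_linear)
  obtain d where d: "d > 0" "ball (s, t) d \<subseteq> N" using N open_contains_ball by blast
  have "((\<lambda>\<tau>. (s, \<tau>)) has_derivative (\<lambda>h. h *\<^sub>R (0, 1))) (at t)"
    by (auto intro!: derivative_eq_intros)
  from diff_chain_at[OF this D] have "((\<lambda>\<tau>. fh (s, \<tau>)) has_vector_derivative dd fh (s, t) (0, 1)) (at t)"
    by (simp add: has_vector_derivative_def o_def linear_cmul[OF L, symmetric])
  then have "((\<lambda>\<tau>. fh (s, \<tau>)) has_vector_derivative dd fh (s, t) (0, 1)) (at t within T)"
    by (rule has_vector_derivative_at_within)
  then show "((f s) has_vector_derivative dd fh (s, t) (0, 1)) (at t within T)"
    by (rule has_vector_derivative_transform_within[OF _ d(1) st(2)])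
      (use eq d st in \<open>force simp: dist_Pair_Pair dist_commute subset_iff\<close>)
  have "((\<lambda>\<sigma>. (\<sigma>, t)) has_derivative (\<lambda>h. h *\<^sub>R (1, 0))) (at s)"
    by (auto intro!: derivative_eq_intros)
  from diff_chain_at[OF this D] have "((\<lambda>\<sigma>. fh (\<sigma>, t)) has_vector_derivative dd fh (s, t) (1, 0)) (at s)"
    by (simp add: has_vector_derivative_def o_def linear_cmul[OF L, symmetric])
  then have "((\<lambda>\<sigma>. fh (\<sigma>, t)) has_vector_derivative dd fh (s, t) (1, 0)) (at s within I)"
    by (rule has_vector_derivative_at_within)
  then show "((\<lambda>\<sigma>. f \<sigma> t) has_vector_derivative dd fh (s, t) (1, 0)) (at s within I)"
    by (rule has_vector_derivative_transform_within[OF _ d(1) st(1)])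
      (use eq d st in \<open>force simp: dist_Pair_Pair dist_commute subset_iff\<close>)
qed

text \<open>A Boolean selects one of the two parameters of a variation: \<open>True\<close> stands for the curve parameter
  \<open>t\<close> and \<open>False\<close> for the variation parameter \<open>s\<close>. In this way both are treated by the same lemmas.\<close>

definition coord_dir :: "bool \<Rightarrow> real \<times> real" where
  "coord_dir e = (if e then (0, 1) else (1, 0))"

locale surface = pr_manifold M for M :: "('m, 'n::finite) metric_manifold" +
  fixes a b t0 t1 :: real and \<Gamma> :: "real \<Rightarrow> real \<Rightarrow> 'm"
  assumes ab: "a < b" and t01: "t0 < t1"
    and smooth_surface: "smooth_map_on M ({a..b} \<times> {t0..t1}) (\<lambda>(s, t). \<Gamma> s t)"
begin

abbreviation "S \<equiv> {a..b} \<times> {t0..t1}"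

definition vel :: "bool \<Rightarrow> real \<Rightarrow> real \<Rightarrow> ('m, 'n) tvec" where
  "vel e s t = (if e then velocity {t0..t1} (\<Gamma> s) t else velocity {a..b} (\<lambda>\<sigma>. \<Gamma> \<sigma> t) s)"

definition covd :: "bool \<Rightarrow> (real \<Rightarrow> real \<Rightarrow> ('m, 'n) tvec) \<Rightarrow> real \<Rightarrow> real \<Rightarrow> ('m, 'n) tvec" where
  "covd e X s t = (if e then cov_deriv M {t0..t1} (\<Gamma> s) (X s) t
     else cov_deriv M {a..b} (\<lambda>\<sigma>. \<Gamma> \<sigma> t) (\<lambda>\<sigma>. X \<sigma> t) s)"

definition has_pd :: "bool \<Rightarrow> (real \<Rightarrow> real \<Rightarrow> real) \<Rightarrow> real \<Rightarrow> real \<Rightarrow> real \<Rightarrow> bool" where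
  "has_pd e f D s t \<longleftrightarrow> (if e then (f s has_real_derivative D) (at t within {t0..t1})
     else ((\<lambda>\<sigma>. f \<sigma> t) has_real_derivative D) (at s within {a..b}))"

text \<open>The parameter rectangle is closed, so smoothness at its boundary means that a smooth extension to an
  open set exists. \<open>chart_ext\<close> is this for the surface itself, with the image kept inside the chart so
  that the metric may be evaluated along the extension; \<open>smooth_ext\<close> is the notion for scalar
  functions and components of vector fields.\<close>

definition chart_ext :: "('m, 'n) chart \<Rightarrow> (real \<times> real) set \<Rightarrow> (real \<times> real \<Rightarrow> real^'n) \<Rightarrow> bool" where
  "chart_ext c N F \<longleftrightarrow> open N \<and> smooth_on N F \<and> F ` N \<subseteq> snd c ` fst c \<and>
     (\<forall>s t. (s, t) \<in> S \<inter> N \<longrightarrow> \<Gamma> s t \<in> fst c \<and> F (s, t) = snd c (\<Gamma> s t))"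

definition smooth_ext :: "(real \<times> real) set \<Rightarrow> (real \<times> real \<Rightarrow> 'b::real_normed_vector) \<Rightarrow> (real \<Rightarrow> real \<Rightarrow> 'b) \<Rightarrow> bool" where
  "smooth_ext N fh f \<longleftrightarrow> open N \<and> smooth_on N fh \<and> (\<forall>s t. (s, t) \<in> S \<inter> N \<longrightarrow> fh (s, t) = f s t)"

definition smooth_scalar :: "(real \<Rightarrow> real \<Rightarrow> real) \<Rightarrow> bool" where
  "smooth_scalar f \<longleftrightarrow> (\<forall>s t. (s, t) \<in> S \<longrightarrow> (\<exists>N fh. (s, t) \<in> N \<and> smooth_ext N fh f))"

definition smooth_field :: "(real \<Rightarrow> real \<Rightarrow> ('m, 'n) tvec) \<Rightarrow> bool" where
  "smooth_field X \<longleftrightarrow> (\<forall>s t. (s, t) \<in> S \<longrightarrow> tensorial (\<Gamma> s t) (X s t) \<and>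
     (\<forall>c\<in>Atlas M. \<Gamma> s t \<in> fst c \<longrightarrow> (\<exists>N Xh. (s, t) \<in> N \<and> smooth_ext N Xh (\<lambda>s t. X s t c))))"

text \<open>The extension that comes with a smooth map lives in some chart of the atlas; composing it with a
  transition map gives one in the prescribed chart.\<close>

lemma chart_ext_exists:
  assumes c: "c \<in> Atlas M" and st: "(s, t) \<in> S" and cs: "\<Gamma> s t \<in> fst c"
  obtains N F where "(s, t) \<in> N" "chart_ext c N F"
proof -
  obtain c0 N0 F0 where c0: "c0 \<in> Atlas M" and N0: "open N0" "(s, t) \<in> N0" and
    im: "(\<lambda>(s, t). \<Gamma> s t) ` (S \<inter> N0) \<subseteq> fst c0" and F0: "smooth_on N0 F0"
    and eq: "\<And>q. q \<in> S \<inter> N0 \<Longrightarrow> F0 q = snd c0 (case q of (s, t) \<Rightarrow> \<Gamma> s t)"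
    using smooth_surface st unfolding smooth_map_on_def by meson
  interpret C: chart_change "Metric M c0" "snd c0 ` fst c0" "Metric M c" "snd c ` fst c" "transition c0 c" "snd c0 ` (fst c0 \<inter> fst c)"
    by (rule chart_change_charts[OF c0 c])
  define N where "N = N0 \<inter> F0 -` (snd c0 ` (fst c0 \<inter> fst c))"
  have N: "open N"
    unfolding N_def by (rule continuous_open_preimage[OF smooth_on_continuous_on[OF F0] N0(1) C.open_D])
  have mem: "\<Gamma> s t \<in> fst c \<and> F0 (s, t) = snd c0 (\<Gamma> s t) \<and> \<Gamma> s t \<in> fst c0" if "(s, t) \<in> S \<inter> N" for s t
  proof -
    have 1: "F0 (s, t) = snd c0 (\<Gamma> s t)" using eq[of "(s, t)"] that by (auto simp: N_def)
    have "(case (s, t) of (s, t) \<Rightarrow> \<Gamma> s t) \<in> fst c0"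
      by (rule subsetD[OF im imageI]) (use that in \<open>simp add: N_def\<close>)
    then have 2: "\<Gamma> s t \<in> fst c0" by simp
    have "snd c0 (\<Gamma> s t) \<in> snd c0 ` (fst c0 \<inter> fst c)" using that 1 by (auto simp: N_def)
    then have "\<Gamma> s t \<in> fst c" using in_overlap_iff[OF c0 2] by blast
    then show ?thesis using 1 2 by simp
  qed
  have "chart_ext c N (\<lambda>q. transition c0 c (F0 q))"
    unfolding chart_ext_def
  proof (intro conjI allI impI N)
    show "smooth_on N (\<lambda>q. transition c0 c (F0 q))"
      by (rule smooth_on_compose[OF N C.open_D C.smooth_phi smooth_on_subset[OF F0]]) (auto simp: N_def)
    show "(\<lambda>q. transition c0 c (F0 q)) ` N \<subseteq> snd c ` fst c"
      using C.phi_D by (auto simp: N_def image_subset_iff)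
  qed (use mem transition_apply[OF c0] in auto)
  moreover have "(case (s, t) of (s, t) \<Rightarrow> \<Gamma> s t) \<in> fst c0"
    by (rule subsetD[OF im imageI]) (use st N0 in simp)
  then have "(s, t) \<in> N"
    using N0 st eq[of "(s, t)"] cs by (simp add: N_def)
  ultimately show ?thesis using that by blast
qed

lemma chart_ext_subset: "chart_ext c N F \<Longrightarrow> open N' \<Longrightarrow> N' \<subseteq> N \<Longrightarrow> chart_ext c N' F"
  unfolding chart_ext_def by (blast intro: smooth_on_subset)

lemma ext_subset: "smooth_ext N f g \<Longrightarrow> open N' \<Longrightarrow> N' \<subseteq> N \<Longrightarrow> smooth_ext N' f g"
  unfolding smooth_ext_def by (blast intro: smooth_on_subset)

lemma ext_open: "smooth_ext N f g \<Longrightarrow> open N" and chart_ext_open: "chart_ext c N F \<Longrightarrow> open N"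
  by (simp_all add: smooth_ext_def chart_ext_def)

lemma ext_derivative:
  assumes r: "smooth_ext N fh f" and st: "(s, t) \<in> S \<inter> N"
  shows "((f s) has_vector_derivative dd fh (s, t) (coord_dir True)) (at t within {t0..t1})"
    and "((\<lambda>\<sigma>. f \<sigma> t) has_vector_derivative dd fh (s, t) (coord_dir False)) (at s within {a..b})"
  using has_vector_derivative_slice[of N s t fh "{a..b}" "{t0..t1}" f] r st unfolding smooth_ext_def coord_dir_def
  by auto

lemma ext_vector_derivative:
  assumes r: "smooth_ext N fh f" and st: "(s, t) \<in> S \<inter> N"
  shows "vector_derivative (f s) (at t within {t0..t1}) = dd fh (s, t) (coord_dir True)"
    and "vector_derivative (\<lambda>\<sigma>. f \<sigma> t) (at s within {a..b}) = dd fh (s, t) (coord_dir False)"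
  using vector_derivative_within_cbox[of t0 t1 t "f s"] vector_derivative_within_cbox[of a b s "\<lambda>\<sigma>. f \<sigma> t"]
    ext_derivative[OF r st] ab t01 st by auto

lemma ext_has_pd:
  assumes r: "smooth_ext N fh f" and st: "(s, t) \<in> S \<inter> N"
  shows "has_pd e f (dd fh (s, t) (coord_dir e)) s t"
  using ext_derivative[OF assms] by (cases e) (simp_all add: has_pd_def has_real_derivative_iff_has_vector_derivative)

lemma vel_ext:
  assumes r: "chart_ext c N F" and st: "(s, t) \<in> S \<inter> N"
  shows "vel e s t c = dd F (s, t) (coord_dir e)"
proof -
  have "smooth_ext N F (\<lambda>s t. snd c (\<Gamma> s t))" using r by (simp add: chart_ext_def smooth_ext_def)
  from ext_vector_derivative[OF this st] show ?thesis by (cases e) (simp_all add: vel_def velocity_def)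
qed

lemma covd_ext:
  assumes r: "chart_ext c N F" and X: "smooth_ext N Xh (\<lambda>s t. X s t c)" and st: "(s, t) \<in> S \<inter> N"
  shows "covd e X s t c = cov (Metric M c) F (coord_dir e) Xh (s, t)"
proof -
  have "F (s, t) = snd c (\<Gamma> s t)" "Xh (s, t) = X s t c" using r X st by (auto simp: chart_ext_def smooth_ext_def)
  note eq = this
  have v: "velocity {t0..t1} (\<Gamma> s) t c = dd F (s, t) (coord_dir True)"
    "velocity {a..b} (\<lambda>\<sigma>. \<Gamma> \<sigma> t) s c = dd F (s, t) (coord_dir False)"
    using vel_ext[OF r st, of True] vel_ext[OF r st, of False] by (simp_all add: vel_def)
  show ?thesis
    by (cases e) (simp_all only: covd_def if_True if_False cov_deriv_def v ext_vector_derivative[OF X st] cov_def chr_def bil_def eq)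
qed

lemma chart_exists:
  assumes "(s, t) \<in> S"
  shows "\<exists>c\<in>Atlas M. \<Gamma> s t \<in> fst c"
proof -
  obtain c N where "c \<in> Atlas M" "(s, t) \<in> N" and im: "(\<lambda>(s, t). \<Gamma> s t) ` (S \<inter> N) \<subseteq> fst c"
    using smooth_surface assms unfolding smooth_map_on_def by meson
  moreover have "(case (s, t) of (s, t) \<Rightarrow> \<Gamma> s t) \<in> fst c"
    by (rule subsetD[OF im imageI]) (use assms calculation in simp)
  ultimately show ?thesis by auto
qed

lemma chart_at_surface: "(s, t) \<in> S \<Longrightarrow> chart_at M (\<Gamma> s t) \<in> Atlas M" "(s, t) \<in> S \<Longrightarrow> \<Gamma> s t \<in> fst (chart_at M (\<Gamma> s t))"
  using chart_exists chart_at by blast+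

lemma smooth_field_tensorial: "smooth_field X \<Longrightarrow> (s, t) \<in> S \<Longrightarrow> tensorial (\<Gamma> s t) (X s t)"
  by (simp add: smooth_field_def)

lemma field_ext:
  assumes X: "smooth_field X" and c: "c \<in> Atlas M" and st: "(s, t) \<in> S" and cs: "\<Gamma> s t \<in> fst c"
  obtains N F Xh where "(s, t) \<in> N" "chart_ext c N F" "smooth_ext N Xh (\<lambda>s t. X s t c)"
proof -
  obtain N1 F where 1: "(s, t) \<in> N1" "chart_ext c N1 F" using chart_ext_exists[OF c st cs] .
  obtain N2 Xh where 2: "(s, t) \<in> N2" "smooth_ext N2 Xh (\<lambda>s t. X s t c)" using X c st cs unfolding smooth_field_def by meson
  have "open (N1 \<inter> N2)" using 1 2 by (auto dest: chart_ext_open ext_open)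
  then show ?thesis using that[of "N1 \<inter> N2"] 1 2 by (auto intro: chart_ext_subset ext_subset)
qed

lemma field_ext2:
  assumes X: "smooth_field X" and Y: "smooth_field Y" and c: "c \<in> Atlas M" and st: "(s, t) \<in> S" and cs: "\<Gamma> s t \<in> fst c"
  obtains N F Xh Yh where "(s, t) \<in> N" "chart_ext c N F" "smooth_ext N Xh (\<lambda>s t. X s t c)" "smooth_ext N Yh (\<lambda>s t. Y s t c)"
proof -
  obtain N1 F Xh where 1: "(s, t) \<in> N1" "chart_ext c N1 F" "smooth_ext N1 Xh (\<lambda>s t. X s t c)" using field_ext[OF X c st cs] .
  obtain N2 Yh where 2: "(s, t) \<in> N2" "smooth_ext N2 Yh (\<lambda>s t. Y s t c)" using Y c st cs unfolding smooth_field_def by meson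
  have "open (N1 \<inter> N2)" using 1 2 by (auto dest: chart_ext_open ext_open)
  then show ?thesis using that[of "N1 \<inter> N2"] 1 2 by (auto intro: chart_ext_subset ext_subset)
qed

lemma chart_ext_change:
  assumes c: "c \<in> Atlas M" "c' \<in> Atlas M" and r: "chart_ext c N F" and st: "(s, t) \<in> S \<inter> N" and c'st: "\<Gamma> s t \<in> fst c'"
  obtains N' where "(s, t) \<in> N'" "open N'" "N' \<subseteq> N" "F ` N' \<subseteq> snd c ` (fst c \<inter> fst c')"
    "chart_ext c' N' (\<lambda>q. transition c c' (F q))"
proof -
  interpret C: chart_change "Metric M c" "snd c ` fst c" "Metric M c'" "snd c' ` fst c'" "transition c c'" "snd c ` (fst c \<inter> fst c')"
    by (rule chart_change_charts[OF c])
  define N' where "N' = N \<inter> F -` (snd c ` (fst c \<inter> fst c'))"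
  have F: "smooth_on N F" "open N" using r by (auto simp: chart_ext_def)
  have N: "open N'"
    unfolding N'_def by (rule continuous_open_preimage[OF smooth_on_continuous_on[OF F(1)] F(2) C.open_D])
  have mem: "\<Gamma> s t \<in> fst c' \<and> F (s, t) = snd c (\<Gamma> s t) \<and> \<Gamma> s t \<in> fst c" if "(s, t) \<in> S \<inter> N'" for s t
  proof -
    have 1: "F (s, t) = snd c (\<Gamma> s t)" "\<Gamma> s t \<in> fst c" using r that by (auto simp: N'_def chart_ext_def)
    have "snd c (\<Gamma> s t) \<in> snd c ` (fst c \<inter> fst c')" using that 1 by (auto simp: N'_def)
    then have "\<Gamma> s t \<in> fst c'" using in_overlap_iff[OF c(1) 1(2)] by blast
    then show ?thesis using 1 by simp
  qed
  have "chart_ext c' N' (\<lambda>q. transition c c' (F q))"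
    unfolding chart_ext_def
  proof (intro conjI allI impI N)
    show "smooth_on N' (\<lambda>q. transition c c' (F q))"
      by (rule smooth_on_compose[OF N C.open_D C.smooth_phi smooth_on_subset[OF F(1)]]) (auto simp: N'_def)
    show "(\<lambda>q. transition c c' (F q)) ` N' \<subseteq> snd c' ` fst c'"
      using C.phi_D by (auto simp: N'_def image_subset_iff)
  qed (use mem transition_apply[OF c(1)] in auto)
  moreover have "(s, t) \<in> N'"
    using st r c'st by (auto simp: N'_def chart_ext_def)
  ultimately show ?thesis
    by (intro that[of N'] N) (auto simp: N'_def)
qed

text \<open>In one chart a covariant derivative is computed from smooth extensions by \<open>cov\<close>, hence is smooth.
  For two charts the extension in the first one is pushed forward to the second one, and \<open>cov_push\<close>
  compares the results.\<close>

lemma smooth_field_covd: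
  assumes X: "smooth_field X"
  shows "smooth_field (covd e X)"
  unfolding smooth_field_def tensorial_def
proof (intro allI impI conjI ballI)
  fix s t assume st: "(s, t) \<in> S"
  { fix c c' assume c: "c \<in> Atlas M" "c' \<in> Atlas M" and cs: "\<Gamma> s t \<in> fst c" "\<Gamma> s t \<in> fst c'"
    interpret C: chart_change "Metric M c" "snd c ` fst c" "Metric M c'" "snd c' ` fst c'" "transition c c'" "snd c ` (fst c \<inter> fst c')"
      by (rule chart_change_charts[OF c])
    obtain N F Xh where N: "(s, t) \<in> N" "chart_ext c N F" "smooth_ext N Xh (\<lambda>s t. X s t c)"
      using field_ext[OF X c(1) st cs(1)] .
    obtain N' where N': "(s, t) \<in> N'" "open N'" "N' \<subseteq> N" "F ` N' \<subseteq> snd c ` (fst c \<inter> fst c')"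
      "chart_ext c' N' (\<lambda>q. transition c c' (F q))"
      using chart_ext_change[OF c N(2) _ cs(2)] N(1) st by blast
    have sm: "smooth_on N' F" "smooth_on N' Xh"
      using N N'(3) by (auto simp: chart_ext_def smooth_ext_def intro: smooth_on_subset)
    have "smooth_ext N' (\<lambda>q. dd (transition c c') (F q) (Xh q)) (\<lambda>s t. X s t c')"
      unfolding smooth_ext_def
    proof (intro conjI allI impI N'(2) C.smooth_push[OF N'(2) sm(1) N'(4) sm(2)])
      fix s t assume q: "(s, t) \<in> S \<inter> N'"
      have "X s t c' = dd (transition c c') (snd c (\<Gamma> s t)) (X s t c)"
        by (rule tensorialD[OF smooth_field_tensorial[OF X] c]) (use q N N' in \<open>auto simp: chart_ext_def\<close>)
      moreover have "F (s, t) = snd c (\<Gamma> s t)" "Xh (s, t) = X s t c"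
        using q N N'(3) by (auto simp: chart_ext_def smooth_ext_def)
      ultimately show "dd (transition c c') (F (s, t)) (Xh (s, t)) = X s t c'" by simp
    qed
    from covd_ext[where X=X and c=c', OF N'(5) this] have "covd e X s t c' = dd (transition c c') (F (s, t)) (cov (Metric M c) F (coord_dir e) Xh (s, t))"
      using N' st by (simp add: C.cov_push[OF N'(2) sm(1) N'(4) sm(2)])
    then show "covd e X s t c' = dd (transition c c') (snd c (\<Gamma> s t)) (covd e X s t c)"
      using covd_ext[where X=X and c=c, OF N(2,3)] N st by (simp add: chart_ext_def) }
  fix c assume c: "c \<in> Atlas M" and cs: "\<Gamma> s t \<in> fst c"
  obtain N F Xh where N: "(s, t) \<in> N" "chart_ext c N F" "smooth_ext N Xh (\<lambda>s t. X s t c)"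
    using field_ext[OF X c(1) st cs(1)] .
  have "smooth_ext N (cov (Metric M c) F (coord_dir e) Xh) (\<lambda>s t. covd e X s t c)"
    using covd_ext[where X=X and c=c, OF N(2,3)] N metric_patch.smooth_cov[OF metric_patch_chart[OF c]]
    by (auto simp: chart_ext_def smooth_ext_def)
  then show "\<exists>N Xh. (s, t) \<in> N \<and> smooth_ext N Xh (\<lambda>s t. covd e X s t c)" using N by blast
qed

lemma smooth_field_vel: "smooth_field (vel e)"
  unfolding smooth_field_def tensorial_def
proof (intro allI impI conjI ballI)
  fix s t assume st: "(s, t) \<in> S"
  { fix c c' assume c: "c \<in> Atlas M" "c' \<in> Atlas M" and cs: "\<Gamma> s t \<in> fst c" "\<Gamma> s t \<in> fst c'"
    interpret C: chart_change "Metric M c" "snd c ` fst c" "Metric M c'" "snd c' ` fst c'" "transition c c'" "snd c ` (fst c \<inter> fst c')"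
      by (rule chart_change_charts[OF c])
    obtain N F where N: "(s, t) \<in> N" "chart_ext c N F" using chart_ext_exists[OF c(1) st cs(1)] .
    obtain N' where N': "(s, t) \<in> N'" "open N'" "N' \<subseteq> N" "F ` N' \<subseteq> snd c ` (fst c \<inter> fst c')"
      "chart_ext c' N' (\<lambda>q. transition c c' (F q))"
      using chart_ext_change[OF c N(2) _ cs(2)] N(1) st by blast
    have F: "smooth_on N' F" using N N'(3) by (auto simp: chart_ext_def intro: smooth_on_subset)
    have "(F has_derivative dd F (s, t)) (at (s, t))" by (rule smooth_on_has_derivative[OF F N'(2,1)])
    moreover have "(transition c c' has_derivative dd (transition c c') (F (s, t))) (at (F (s, t)))"
      by (rule smooth_on_has_derivative[OF C.smooth_phi C.open_D]) (use N' in auto)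
    ultimately have "dd (\<lambda>q. transition c c' (F q)) (s, t) w = dd (transition c c') (F (s, t)) (dd F (s, t) w)" for w
      using dd_eqI[OF diff_chain_at] by (fastforce simp: o_def)
    then show "vel e s t c' = dd (transition c c') (snd c (\<Gamma> s t)) (vel e s t c)"
      using vel_ext[OF N'(5), of s t e] vel_ext[OF N(2), of s t e] N N' st by (simp add: chart_ext_def) }
  fix c assume c: "c \<in> Atlas M" and cs: "\<Gamma> s t \<in> fst c"
  obtain N F where N: "(s, t) \<in> N" "chart_ext c N F" using chart_ext_exists[OF c(1) st cs(1)] .
  have "smooth_ext N (\<lambda>q. dd F q (coord_dir e)) (\<lambda>s t. vel e s t c)"
    using vel_ext[OF N(2), of _ _ e] N by (auto simp: chart_ext_def smooth_ext_def intro: smooth_on_frechet_derivative)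
  then show "\<exists>N Xh. (s, t) \<in> N \<and> smooth_ext N Xh (\<lambda>s t. vel e s t c)" using N by blast
qed

lemma ext_ip:
  assumes X: "smooth_field X" and Y: "smooth_field Y" and c: "c \<in> Atlas M"
    and N: "chart_ext c N F" "smooth_ext N Xh (\<lambda>s t. X s t c)" "smooth_ext N Yh (\<lambda>s t. Y s t c)"
  shows "smooth_ext N (\<lambda>q. bil (met (Metric M c) (F q)) (Xh q) (Yh q)) (\<lambda>s t. ip M (\<Gamma> s t) (X s t) (Y s t))"
    and "smooth_ext N (\<lambda>q. bil (schouten (Metric M c) (F q)) (Xh q) (Yh q)) (\<lambda>s t. schouten_form M (\<Gamma> s t) (X s t) (Y s t))"
proof -
  interpret P: metric_patch "Metric M c" "snd c ` fst c" by (rule metric_patch_chart[OF c])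
  have sm: "open N" "smooth_on N F" "F ` N \<subseteq> snd c ` fst c" "smooth_on N Xh" "smooth_on N Yh"
    using N by (auto simp: chart_ext_def smooth_ext_def)
  have at: "\<Gamma> s t \<in> fst c" "F (s, t) = snd c (\<Gamma> s t)" "Xh (s, t) = X s t c" "Yh (s, t) = Y s t c" if "(s, t) \<in> S \<inter> N" for s t
    using that N by (auto simp: chart_ext_def smooth_ext_def)
  show "smooth_ext N (\<lambda>q. bil (met (Metric M c) (F q)) (Xh q) (Yh q)) (\<lambda>s t. ip M (\<Gamma> s t) (X s t) (Y s t))"
    unfolding smooth_ext_def
    by (intro conjI allI impI sm smooth_on_bil[OF sm(1) P.open_dom P.smooth_met sm(2-)])
      (simp add: at ip_chart[OF c] smooth_field_tensorial[OF X] smooth_field_tensorial[OF Y])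
  show "smooth_ext N (\<lambda>q. bil (schouten (Metric M c) (F q)) (Xh q) (Yh q)) (\<lambda>s t. schouten_form M (\<Gamma> s t) (X s t) (Y s t))"
    unfolding smooth_ext_def
    by (intro conjI allI impI sm smooth_on_bil[OF sm(1) P.open_dom P.smooth_schouten sm(2-)])
      (simp add: at schouten_form_chart[OF c] smooth_field_tensorial[OF X] smooth_field_tensorial[OF Y])
qed

lemma smooth_scalar_ip:
  assumes X: "smooth_field X" and Y: "smooth_field Y"
  shows "smooth_scalar (\<lambda>s t. ip M (\<Gamma> s t) (X s t) (Y s t))" "smooth_scalar (\<lambda>s t. schouten_form M (\<Gamma> s t) (X s t) (Y s t))"
proof -
  have "\<exists>N fh gh. (s, t) \<in> N \<and> smooth_ext N fh (\<lambda>s t. ip M (\<Gamma> s t) (X s t) (Y s t)) \<and> smooth_ext N gh (\<lambda>s t. schouten_form M (\<Gamma> s t) (X s t) (Y s t))"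
    if st: "(s, t) \<in> S" for s t
  proof -
    note c = chart_at_surface[OF st]
    obtain N F Xh Yh where N: "(s, t) \<in> N" "chart_ext (chart_at M (\<Gamma> s t)) N F" "smooth_ext N Xh (\<lambda>s' t'. X s' t' (chart_at M (\<Gamma> s t)))" "smooth_ext N Yh (\<lambda>s' t'. Y s' t' (chart_at M (\<Gamma> s t)))"
      using field_ext2[OF X Y c(1) st c(2)] .
    from ext_ip[OF X Y c(1) N(2-)] N(1) show ?thesis by blast
  qed
  then show "smooth_scalar (\<lambda>s t. ip M (\<Gamma> s t) (X s t) (Y s t))" "smooth_scalar (\<lambda>s t. schouten_form M (\<Gamma> s t) (X s t) (Y s t))"
    unfolding smooth_scalar_def by meson+
qed

text \<open>Metric compatibility of the covariant derivative along a curve, and the same rule for the Schouten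
  form, which in general is not parallel.\<close>

lemma has_pd_ip:
  assumes X: "smooth_field X" and Y: "smooth_field Y" and st: "(s, t) \<in> S"
  shows "has_pd e (\<lambda>s t. ip M (\<Gamma> s t) (X s t) (Y s t)) (ip M (\<Gamma> s t) (covd e X s t) (Y s t) + ip M (\<Gamma> s t) (X s t) (covd e Y s t)) s t"
    and "c = chart_at M (\<Gamma> s t) \<Longrightarrow> has_pd e (\<lambda>s t. schouten_form M (\<Gamma> s t) (X s t) (Y s t))
      (nab (Metric M c) (schouten (Metric M c)) (snd c (\<Gamma> s t)) (vel e s t c) (X s t c) (Y s t c)
       + schouten_form M (\<Gamma> s t) (covd e X s t) (Y s t) + schouten_form M (\<Gamma> s t) (X s t) (covd e Y s t)) s t"
proof -
  let ?c = "chart_at M (\<Gamma> s t)"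
  note c = chart_at_surface[OF st]
  interpret P: metric_patch "Metric M ?c" "snd ?c ` fst ?c" by (rule metric_patch_chart[OF c(1)])
  obtain N F Xh Yh where N: "(s, t) \<in> N" "chart_ext ?c N F" "smooth_ext N Xh (\<lambda>s' t'. X s' t' ?c)" "smooth_ext N Yh (\<lambda>s' t'. Y s' t' ?c)"
    using field_ext2[OF X Y c(1) st c(2)] .
  have sm: "open N" "smooth_on N F" "F ` N \<subseteq> snd ?c ` fst ?c" "smooth_on N Xh" "smooth_on N Yh"
    using N by (auto simp: chart_ext_def smooth_ext_def)
  have stN: "(s, t) \<in> S \<inter> N" using st N by auto
  have at: "F (s, t) = snd ?c (\<Gamma> s t)" "Xh (s, t) = X s t ?c" "Yh (s, t) = Y s t ?c"
    "cov (Metric M ?c) F (coord_dir e) Xh (s, t) = covd e X s t ?c" "cov (Metric M ?c) F (coord_dir e) Yh (s, t) = covd e Y s t ?c"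
    "dd F (s, t) (coord_dir e) = vel e s t ?c"
    using stN N covd_ext[where X=X and c="?c", OF N(2,3) stN] covd_ext[where X=Y and c="?c", OF N(2,4) stN] vel_ext[OF N(2) stN] by (auto simp: chart_ext_def smooth_ext_def)
  show "has_pd e (\<lambda>s t. ip M (\<Gamma> s t) (X s t) (Y s t)) (ip M (\<Gamma> s t) (covd e X s t) (Y s t) + ip M (\<Gamma> s t) (X s t) (covd e Y s t)) s t"
    using ext_has_pd[OF ext_ip(1)[OF X Y c(1) N(2-)] stN, of e] c(2)
    unfolding P.bil_leibniz[OF sm(1-3) P.smooth_met sm(4,5) N(1)] at
    by (simp add: P.nab_metric ip_chart_at)
  show "has_pd e (\<lambda>s t. schouten_form M (\<Gamma> s t) (X s t) (Y s t))
      (nab (Metric M c) (schouten (Metric M c)) (snd c (\<Gamma> s t)) (vel e s t c) (X s t c) (Y s t c)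
       + schouten_form M (\<Gamma> s t) (covd e X s t) (Y s t) + schouten_form M (\<Gamma> s t) (X s t) (covd e Y s t)) s t"
    if "c = chart_at M (\<Gamma> s t)"
    using ext_has_pd[OF ext_ip(2)[OF X Y c(1) N(2-)] stN, of e]
    unfolding P.bil_leibniz[OF sm(1-3) P.smooth_schouten sm(4,5) N(1)] at
    by (simp add: schouten_form_chart_at that)
qed

lemma covd_vel:
  assumes st: "(s, t) \<in> S" and c: "c \<in> Atlas M" "\<Gamma> s t \<in> fst c"
  shows "covd True (vel False) s t c = covd False (vel True) s t c"
proof -
  interpret P: metric_patch "Metric M c" "snd c ` fst c" by (rule metric_patch_chart[OF c(1)])
  obtain N F where N: "(s, t) \<in> N" "chart_ext c N F" using chart_ext_exists[OF c(1) st c(2)] .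
  have "smooth_ext N (\<lambda>q. dd F q (coord_dir e)) (\<lambda>s t. vel e s t c)" for e
    using vel_ext[OF N(2), of _ _ e] N by (auto simp: chart_ext_def smooth_ext_def intro: smooth_on_frechet_derivative)
  from covd_ext[where c=c and X="vel True", OF N(2) this[of True], of s t False]
    covd_ext[where c=c and X="vel False", OF N(2) this[of False], of s t True] show ?thesis
    using st N P.cov_torsion_free[of N F "(s, t)"] by (simp add: chart_ext_def)
qed

lemma covd_commute:
  assumes X: "smooth_field X" and st: "(s, t) \<in> S" and c: "c \<in> Atlas M" "\<Gamma> s t \<in> fst c"
  shows "covd False (covd True X) s t c = covd True (covd False X) s t c
     + curv (Metric M c) (snd c (\<Gamma> s t)) (vel False s t c) (vel True s t c) (X s t c)"
proof -
  interpret P: metric_patch "Metric M c" "snd c ` fst c" by (rule metric_patch_chart[OF c(1)])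
  obtain N F Xh where N: "(s, t) \<in> N" "chart_ext c N F" "smooth_ext N Xh (\<lambda>s t. X s t c)"
    using field_ext[OF X c(1) st c(2)] .
  have sm: "open N" "smooth_on N F" "F ` N \<subseteq> snd c ` fst c" "smooth_on N Xh"
    using N by (auto simp: chart_ext_def smooth_ext_def)
  have stN: "(s, t) \<in> S \<inter> N" using st N by auto
  have "smooth_ext N (cov (Metric M c) F (coord_dir e) Xh) (\<lambda>s t. covd e X s t c)" for e
    using covd_ext[where X=X and c=c, OF N(2,3), of _ _ e] sm P.smooth_cov[OF sm(1-4)] by (auto simp: smooth_ext_def)
  then have 2: "covd e (covd e' X) s t c = cov (Metric M c) F (coord_dir e) (cov (Metric M c) F (coord_dir e') Xh) (s, t)" for e e'
    by (rule covd_ext[where X="covd e' X" and c=c, OF N(2) _ stN])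
  have at: "F (s, t) = snd c (\<Gamma> s t)" "Xh (s, t) = X s t c" using N stN by (auto simp: chart_ext_def smooth_ext_def)
  show ?thesis
    using P.cov_commutator[OF sm(1-4) N(1), of "coord_dir False" "coord_dir True"]
    unfolding vel_ext[OF N(2) stN, symmetric] 2[symmetric] at by (simp add: algebra_simps)
qed

lemma smooth_scalar_const: "smooth_scalar (\<lambda>s t. r)"
  unfolding smooth_scalar_def smooth_ext_def using smooth_on_const by blast

lemma smooth_scalar_binary:
  assumes f: "smooth_scalar f" and g: "smooth_scalar g"
    and h: "\<And>N (fh :: real \<times> real \<Rightarrow> real) gh. open N \<Longrightarrow> smooth_on N fh \<Longrightarrow> smooth_on N gh \<Longrightarrow> smooth_on N (\<lambda>q. h (fh q) (gh q))"
  shows "smooth_scalar (\<lambda>s t. h (f s t) (g s t))"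
  unfolding smooth_scalar_def
proof (intro allI impI)
  fix s t assume st: "(s, t) \<in> S"
  obtain N fh where 1: "(s, t) \<in> N" "smooth_ext N fh f" using f st unfolding smooth_scalar_def by meson
  obtain N' gh where 2: "(s, t) \<in> N'" "smooth_ext N' gh g" using g st unfolding smooth_scalar_def by meson
  have o: "open (N \<inter> N')" using 1 2 by (auto dest: ext_open)
  have "smooth_ext (N \<inter> N') fh f" "smooth_ext (N \<inter> N') gh g" using 1 2 o by (auto intro: ext_subset)
  then have "smooth_ext (N \<inter> N') (\<lambda>q. h (fh q) (gh q)) (\<lambda>s t. h (f s t) (g s t))"
    using h[of "N \<inter> N'" fh gh] by (simp add: smooth_ext_def)
  then show "\<exists>N fh. (s, t) \<in> N \<and> smooth_ext N fh (\<lambda>s t. h (f s t) (g s t))" using 1 2 by blast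
qed

lemma smooth_scalar_add: "smooth_scalar f \<Longrightarrow> smooth_scalar g \<Longrightarrow> smooth_scalar (\<lambda>s t. f s t + g s t)"
  by (rule smooth_scalar_binary) (auto intro: smooth_on_add)

lemma smooth_scalar_diff: "smooth_scalar f \<Longrightarrow> smooth_scalar g \<Longrightarrow> smooth_scalar (\<lambda>s t. f s t - g s t)"
  by (rule smooth_scalar_binary) (auto intro: smooth_on_diff)

lemma smooth_scalar_mult: "smooth_scalar f \<Longrightarrow> smooth_scalar g \<Longrightarrow> smooth_scalar (\<lambda>s t. f s t * g s t)"
  by (rule smooth_scalar_binary) (auto intro: smooth_on_mult)

lemma smooth_scalar_inverse:
  assumes f: "smooth_scalar f" and nz: "\<And>s t. (s, t) \<in> S \<Longrightarrow> f s t \<noteq> 0"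
  shows "smooth_scalar (\<lambda>s t. inverse (f s t))"
  unfolding smooth_scalar_def
proof (intro allI impI)
  fix s t assume st: "(s, t) \<in> S"
  obtain N fh where 1: "(s, t) \<in> N" "smooth_ext N fh f" using f st unfolding smooth_scalar_def by meson
  have fh: "open N" "smooth_on N fh" using 1 by (auto simp: smooth_ext_def)
  define N' where "N' = N \<inter> fh -` (- {0})"
  have o: "open N'" unfolding N'_def
    by (rule continuous_open_preimage[OF smooth_on_continuous_on[OF fh(2)] fh(1)]) auto
  have "smooth_on N' (\<lambda>q. inverse (fh q))"
    by (rule smooth_on_inverse[OF o smooth_on_subset[OF fh(2)]]) (auto simp: N'_def)
  then have "smooth_ext N' (\<lambda>q. inverse (fh q)) (\<lambda>s t. inverse (f s t))"
    using 1 o by (auto simp: smooth_ext_def N'_def)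
  moreover have "(s, t) \<in> N'" using 1 st nz[OF st] by (auto simp: N'_def smooth_ext_def)
  ultimately show "\<exists>N fh. (s, t) \<in> N \<and> smooth_ext N fh (\<lambda>s t. inverse (f s t))" by blast
qed

lemma smooth_scalar_continuous_on: "smooth_scalar f \<Longrightarrow> continuous_on S (\<lambda>q. f (fst q) (snd q))"
proof (subst continuous_on_eq_continuous_within, intro ballI)
  fix q assume f: "smooth_scalar f" and q: "q \<in> S"
  obtain N fh where 1: "q \<in> N" "smooth_ext N fh f" using f q unfolding smooth_scalar_def by (cases q) meson
  have N: "open N" "smooth_on N fh" using 1 by (auto simp: smooth_ext_def)
  have "continuous (at q) fh"
    using smooth_on_continuous_on[OF N(2)] 1(1) unfolding continuous_on_eq_continuous_at[OF N(1)] by blast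
  then have "continuous (at q within S) fh" by (rule continuous_at_imp_continuous_at_within)
  note cont = this
  obtain d where d: "d > 0" "ball q d \<subseteq> N" using openE[OF N(1) 1(1)] .
  show "continuous (at q within S) (\<lambda>q. f (fst q) (snd q))"
  proof (rule continuous_transform_within[OF cont d(1) q])
    fix x assume x: "x \<in> S" "dist x q < d"
    then have "(fst x, snd x) \<in> S \<inter> N" using d(2) by (auto simp: dist_commute)
    then have "fh (fst x, snd x) = f (fst x) (snd x)" using 1(2) unfolding smooth_ext_def by blast
    then show "fh x = f (fst x) (snd x)" by simp
  qed
qed

text \<open>The derivative is the directional derivative of any local smooth extension. This provides the joint
  continuity that is needed for differentiating under the integral sign.\<close>

lemma smooth_scalar_has_pd:
  assumes f: "smooth_scalar f" and D: "\<And>s t. (s, t) \<in> S \<Longrightarrow> has_pd False f (f' s t) s t"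
  shows "smooth_scalar f'"
  unfolding smooth_scalar_def
proof (intro allI impI)
  fix s t assume st: "(s, t) \<in> S"
  obtain N fh where 1: "(s, t) \<in> N" "smooth_ext N fh f" using f st unfolding smooth_scalar_def by meson
  have "f' s t = dd fh (s, t) (coord_dir False)" if q: "(s, t) \<in> S \<inter> N" for s t
  proof -
    have "(s, t) \<in> S" using q by auto
    from D[OF this] have "((\<lambda>\<sigma>. f \<sigma> t) has_vector_derivative f' s t) (at s within {a..b})"
      by (simp add: has_pd_def has_real_derivative_iff_has_vector_derivative)
    then have "vector_derivative (\<lambda>\<sigma>. f \<sigma> t) (at s within {a..b}) = f' s t"
      using vector_derivative_within_cbox[of a b s "\<lambda>\<sigma>. f \<sigma> t"] ab q by auto
    then show ?thesis using ext_vector_derivative(2)[OF 1(2) q] by simp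
  qed
  then have "smooth_ext N (\<lambda>q. dd fh q (coord_dir False)) f'"
    using 1 by (auto simp: smooth_ext_def intro: smooth_on_frechet_derivative)
  then show "\<exists>N fh. (s, t) \<in> N \<and> smooth_ext N fh f'" using 1 by blast
qed

lemma smooth_field_add:
  assumes X: "smooth_field X" and Y: "smooth_field Y"
  shows "smooth_field (\<lambda>s t c. X s t c + Y s t c)"
  unfolding smooth_field_def
proof (intro allI impI conjI ballI)
  fix s t assume st: "(s, t) \<in> S"
  show "tensorial (\<Gamma> s t) (\<lambda>c. X s t c + Y s t c)"
    by (intro tensorial_add smooth_field_tensorial[OF _ st] X Y)
  fix c assume c: "c \<in> Atlas M" "\<Gamma> s t \<in> fst c"
  obtain N F Xh Yh where N: "(s, t) \<in> N" "chart_ext c N F" "smooth_ext N Xh (\<lambda>s t. X s t c)" "smooth_ext N Yh (\<lambda>s t. Y s t c)"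
    using field_ext2[OF X Y c(1) st c(2)] .
  then have "smooth_ext N (\<lambda>q. Xh q + Yh q) (\<lambda>s t. X s t c + Y s t c)" by (auto simp: smooth_ext_def intro: smooth_on_add)
  then show "\<exists>N Xh. (s, t) \<in> N \<and> smooth_ext N Xh (\<lambda>s t. X s t c + Y s t c)" using N by blast
qed

lemma smooth_field_scaleR:
  assumes f: "smooth_scalar f" and X: "smooth_field X"
  shows "smooth_field (\<lambda>s t c. f s t *\<^sub>R X s t c)"
  unfolding smooth_field_def
proof (intro allI impI conjI ballI)
  fix s t assume st: "(s, t) \<in> S"
  show "tensorial (\<Gamma> s t) (\<lambda>c. f s t *\<^sub>R X s t c)"
    by (intro tensorial_scaleR smooth_field_tensorial[OF _ st] X)
  fix c assume c: "c \<in> Atlas M" "\<Gamma> s t \<in> fst c"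
  obtain N F Xh where N: "(s, t) \<in> N" "chart_ext c N F" "smooth_ext N Xh (\<lambda>s t. X s t c)"
    using field_ext[OF X c(1) st c(2)] .
  obtain N' fh where 1: "(s, t) \<in> N'" "smooth_ext N' fh f" using f st unfolding smooth_scalar_def by meson
  have o: "open (N \<inter> N')" using 1 N by (auto dest: ext_open)
  have "smooth_ext (N \<inter> N') Xh (\<lambda>s t. X s t c)" "smooth_ext (N \<inter> N') fh f" using 1 N o by (auto intro: ext_subset)
  then have "smooth_ext (N \<inter> N') (\<lambda>q. fh q *\<^sub>R Xh q) (\<lambda>s t. f s t *\<^sub>R X s t c)" by (auto simp: smooth_ext_def intro: smooth_on_scaleR)
  then show "\<exists>N Xh. (s, t) \<in> N \<and> smooth_ext N Xh (\<lambda>s t. f s t *\<^sub>R X s t c)" using N 1 by blast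
qed

lemma smooth_field_diff: "smooth_field X \<Longrightarrow> smooth_field Y \<Longrightarrow> smooth_field (\<lambda>s t c. X s t c - Y s t c)"
  using smooth_field_add[of X "\<lambda>s t c. (- 1) *\<^sub>R Y s t c"] smooth_field_scaleR[OF smooth_scalar_const, of Y "- 1"] by simp

end

section \<open>The pointwise first variation\<close>

text \<open>The terms with \<open>G\<close> and its inverse cancel in \<open>\<langle>V,K\<rangle>\<close>; the Weyl term is \<open>weyl_contraction\<close>, and the bracket
  in the second term of \<open>K\<close> is the difference of two covariant derivatives of the Schouten tensor.\<close>

lemma (in metric_patch) K_contraction:
  assumes x: "x \<in> \<Omega>"
    and K: "K = (\<chi> e. \<Sum>c\<in>UNIV. matrix_inv (G x) $ e $ c * k c)"
    and k: "\<And>c. k c = (\<Sum>a\<in>UNIV. \<Sum>f\<in>UNIV. \<Sum>d\<in>UNIV. weyl G x f c a d * U $ a * U $ f * (G x *v A) $ d)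
      + 2 * bil (met G x) U U * (\<Sum>a\<in>UNIV. \<Sum>f\<in>UNIV. (nabla_schouten G x c a f - nabla_schouten G x a c f) / 2 * U $ a * U $ f)"
  shows "bil (met G x) V K = bil (met G x) A (curv G x V U U)
    - (bil (met G x) U U * bil (schouten G x) A V - bil (met G x) U A * bil (schouten G x) U V
       - bil (met G x) V U * bil (schouten G x) A U + bil (met G x) A V * bil (schouten G x) U U)
    + bil (met G x) U U * (nab G (schouten G) x V U U - nab G (schouten G) x U V U)"
proof -
  have "K = matrix_inv (G x) *v (\<chi> c. k c)"
    by (simp add: K matrix_vector_mult_def)
  then have "G x *v K = (\<chi> c. k c)"
    by (simp add: matrix_vector_mul_assoc matrix_inv_right[OF metric_invertible[OF x]])
  then have VK: "bil (met G x) V K = (\<Sum>c\<in>UNIV. V $ c * k c)"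
    unfolding inner_matrix_eq_bil[of _ G x, symmetric] by (simp add: inner_vec_def)
  define h where "h c = (\<Sum>a\<in>UNIV. \<Sum>f\<in>UNIV. nabla_schouten G x c a f * U $ a * U $ f)
       - (\<Sum>a\<in>UNIV. \<Sum>f\<in>UNIV. nabla_schouten G x a c f * U $ a * U $ f)" for c
  have half: "2 * r * (\<Sum>a\<in>UNIV. \<Sum>f\<in>UNIV. (nabla_schouten G x c a f - nabla_schouten G x a c f) / 2 * U $ a * U $ f) = r * h c" for r c
    unfolding h_def sum_subtractf[symmetric] sum_distrib_left by (intro sum.cong refl) (simp add: field_simps)
  have "(\<Sum>c\<in>UNIV. V $ c * h c) = nab G (schouten G) x V U U - (\<Sum>c\<in>UNIV. \<Sum>a\<in>UNIV. U $ a * (\<Sum>f\<in>UNIV. nabla_schouten G x a c f * V $ c * U $ f))"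
    unfolding nab_schouten_sum[OF x] h_def right_diff_distrib sum_subtractf
    by (simp add: sum_distrib_left mult_ac)
  also have "(\<Sum>c\<in>UNIV. \<Sum>a\<in>UNIV. U $ a * (\<Sum>f\<in>UNIV. nabla_schouten G x a c f * V $ c * U $ f)) = nab G (schouten G) x U V U"
    unfolding nab_schouten_sum[OF x] by (subst sum.swap) (simp add: sum_distrib_left)
  finally have h: "(\<Sum>c\<in>UNIV. V $ c * h c) = nab G (schouten G) x V U U - nab G (schouten G) x U V U" .
  have "bil (met G x) V K = (\<Sum>c\<in>UNIV. V $ c * (\<Sum>a\<in>UNIV. \<Sum>f\<in>UNIV. \<Sum>d\<in>UNIV. weyl G x f c a d * U $ a * U $ f * (G x *v A) $ d))
     + bil (met G x) U U * (\<Sum>c\<in>UNIV. V $ c * h c)"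
    unfolding VK k half by (simp add: distrib_left sum.distrib sum_distrib_left mult_ac)
  then show ?thesis unfolding weyl_contraction[OF x] h .
qed

text \<open>The following three computations are calculus of one real variable. The function names hint at the
  inner products for which they will stand: \<open>u\<close> for \<open>\<langle>U,U\<rangle>\<close> and \<open>i\<close> for its inverse, \<open>al\<close> for \<open>\<langle>U,A\<rangle>\<close>, \<open>be\<close> for
  \<open>\<langle>A,A\<rangle>\<close>, \<open>ub\<close> and \<open>ab\<close> for the products of \<open>U\<close> and \<open>A\<close> with the derivative of \<open>A\<close>; \<open>pa, pb, pc, pd\<close> for the products of
  \<open>U\<close> with \<open>V\<close> and its first three covariant derivatives, and \<open>qa, qb, qc\<close> and \<open>ra, rb\<close> likewise with \<open>A\<close> and
  the derivative of \<open>A\<close> in place of \<open>U\<close>. Finally \<open>pi\<close> stands for \<open>P(U,U)\<close> and \<open>P\<close> for \<open>P(V,U)\<close>.\<close>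

lemma lagrangian_derivative_real:
  fixes u ub al be pi :: "real \<Rightarrow> real"
  assumes "(u has_real_derivative du) (at x within J)" "(ub has_real_derivative dub) (at x within J)" "(al has_real_derivative dal) (at x within J)"
      "(be has_real_derivative dbe) (at x within J)" "(pi has_real_derivative dpi) (at x within J)" "u x \<noteq> 0"
  shows "((\<lambda>x. inverse (u x) * ub x - 3 * (inverse (u x))\<^sup>2 * (al x)\<^sup>2 + 3 / 2 * inverse (u x) * be x + pi x) has_real_derivative
     (- (inverse (u x))\<^sup>2 * du * ub x + inverse (u x) * dub + 6 * (inverse (u x))^3 * du * (al x)\<^sup>2 - 6 * (inverse (u x))\<^sup>2 * al x * dal
      - 3 / 2 * (inverse (u x))\<^sup>2 * du * be x + 3 / 2 * inverse (u x) * dbe + dpi)) (at x within J)"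
  by (rule derivative_eq_intros assms refl)+ (simp add: algebra_simps power2_eq_square power3_eq_cube)

lemma second_D_derivative_real:
  fixes i al be pa pb qa :: "real \<Rightarrow> real"
  assumes "(i has_real_derivative - 2 * al x * (i x)\<^sup>2) (at x within J)" "(al has_real_derivative be x + ub) (at x within J)"
      "(pa has_real_derivative qa x + pb x) (at x within J)" "(pb has_real_derivative qb + pc) (at x within J)" "(qa has_real_derivative ra + qb) (at x within J)"
  shows "((\<lambda>x. i x * (qa x + pb x) - 2 * al x * (i x)\<^sup>2 * pa x) has_real_derivative
      (- 2 * (be x + ub) * (i x)\<^sup>2 * pa x + 8 * (al x)\<^sup>2 * (i x)^3 * pa x - 4 * al x * (i x)\<^sup>2 * (qa x + pb x) + i x * (ra + 2 * qb + pc))) (at x within J)"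
  by (rule derivative_eq_intros assms refl)+ (simp add: algebra_simps power2_eq_square power3_eq_cube)

lemma boundary_derivative_real:
  fixes i al be pa pb pc qa qb P :: "real \<Rightarrow> real"
  assumes "(i has_real_derivative - 2 * al x * (i x)\<^sup>2) (at x within J)" "(al has_real_derivative be x + ub) (at x within J)" "(be has_real_derivative 2 * ab) (at x within J)"
      "(pa has_real_derivative qa x + pb x) (at x within J)" "(pb has_real_derivative qb x + pc x) (at x within J)" "(pc has_real_derivative qc + pd) (at x within J)"
      "(qa has_real_derivative ra + qb x) (at x within J)" "(qb has_real_derivative rb + qc) (at x within J)" "(P has_real_derivative dP) (at x within J)"
  shows "((\<lambda>x. - 1 / 2 * be x * (i x)\<^sup>2 * pa x + 2 * (al x)\<^sup>2 * (i x)^3 * pa x - al x * (i x)\<^sup>2 * qa x - 4 * al x * (i x)\<^sup>2 * pb x + 2 * i x * qb x + i x * pc x + P x)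
     has_real_derivative (- ab * (i x)\<^sup>2 * pa x + 2 * be x * al x * (i x)^3 * pa x - 1 / 2 * be x * (i x)\<^sup>2 * (qa x + pb x)
   + 4 * al x * (be x + ub) * (i x)^3 * pa x - 12 * (al x)^3 * (i x)^4 * pa x + 2 * (al x)\<^sup>2 * (i x)^3 * (qa x + pb x)
   - (be x + ub) * (i x)\<^sup>2 * qa x + 4 * (al x)\<^sup>2 * (i x)^3 * qa x - al x * (i x)\<^sup>2 * (ra + qb x)
   - 4 * (be x + ub) * (i x)\<^sup>2 * pb x + 16 * (al x)\<^sup>2 * (i x)^3 * pb x - 4 * al x * (i x)\<^sup>2 * (qb x + pc x)
   - 4 * al x * (i x)\<^sup>2 * qb x + 2 * i x * (rb + qc) - 2 * al x * (i x)\<^sup>2 * pc x + i x * (qc + pd) + dP)) (at x within J)"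
  by (rule derivative_eq_intros assms refl)+ (simp add: algebra_simps power2_eq_square power3_eq_cube power4_eq_xxxx)

context surface
begin

abbreviation "T \<equiv> {t0..t1}"
abbreviation "U \<equiv> vel True"
abbreviation "V \<equiv> vel False"
abbreviation "Dt \<equiv> covd True"
abbreviation "Ds \<equiv> covd False"
abbreviation "A \<equiv> covd True (vel True)"
abbreviation g where "g X Y s t \<equiv> ip M (\<Gamma> s t) (X s t) (Y s t)"
abbreviation P where "P X Y s t \<equiv> schouten_form M (\<Gamma> s t) (X s t) (Y s t)"

lemmas smooth_field_intros = smooth_field_vel smooth_field_covd

lemma has_pd_unique: "(s, t) \<in> S \<Longrightarrow> has_pd e f D s t \<Longrightarrow> has_pd e f D' s t \<Longrightarrow> D = D'"
  using vector_derivative_within_cbox[of t0 t1 t "f s"] vector_derivative_within_cbox[of a b s "\<lambda>\<sigma>. f \<sigma> t"] ab t01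
  by (cases e) (auto simp: has_pd_def has_real_derivative_iff_has_vector_derivative)

lemma has_pd_cong:
  assumes "(s, t) \<in> S" "has_pd e f D s t" "\<And>s t. (s, t) \<in> S \<Longrightarrow> f s t = f' s t"
  shows "has_pd e f' D s t"
proof (cases e)
  case True
  then show ?thesis using assms(1,2) has_field_derivative_transform_within[of "f s" D t "{t0..t1}" 1 "f' s"] assms(3)
    by (auto simp: has_pd_def)
next
  case False
  then show ?thesis using assms(1,2) has_field_derivative_transform_within[of "\<lambda>\<sigma>. f \<sigma> t" D s "{a..b}" 1 "\<lambda>\<sigma>. f' \<sigma> t"] assms(3)
    by (auto simp: has_pd_def)
qed

lemma g_commute: "(s, t) \<in> S \<Longrightarrow> g X Y s t = g Y X s t"
  by (rule ip_commute[OF chart_at_surface])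

lemma P_commute: "(s, t) \<in> S \<Longrightarrow> P X Y s t = P Y X s t"
  by (rule schouten_form_commute[OF chart_at_surface])

text \<open>Fields need only agree in the charts of the atlas around the point at hand, because their values
  elsewhere carry no meaning.\<close>

lemma covd_cong:
  assumes X: "smooth_field X" and c: "c \<in> Atlas M" and st: "(s, t) \<in> S" "\<Gamma> s t \<in> fst c"
    and eq: "\<And>s t c. (s, t) \<in> S \<Longrightarrow> c \<in> Atlas M \<Longrightarrow> \<Gamma> s t \<in> fst c \<Longrightarrow> X s t c = Y s t c"
  shows "covd e X s t c = covd e Y s t c"
proof -
  obtain N F Xh where N: "(s, t) \<in> N" "chart_ext c N F" "smooth_ext N Xh (\<lambda>s t. X s t c)"
    using field_ext[OF X c st] .
  have "smooth_ext N Xh (\<lambda>s t. Y s t c)"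
    unfolding smooth_ext_def
  proof (intro conjI allI impI)
    fix s t assume q: "(s, t) \<in> S \<inter> N"
    then have "X s t c = Y s t c" using N(2) by (intro eq c) (auto simp: chart_ext_def)
    moreover have "Xh (s, t) = X s t c" using N(3) q unfolding smooth_ext_def by blast
    ultimately show "Xh (s, t) = Y s t c" by simp
  qed (use N in \<open>auto simp: smooth_ext_def\<close>)
  then show ?thesis
    using covd_ext[where X=X and c=c, OF N(2,3)] covd_ext[where X=Y and c=c, OF N(2)] N(1) st by simp
qed

text \<open>\<open>R(V,U)X\<close> for the coordinate fields of the variation.\<close>

definition Rcurv :: "(real \<Rightarrow> real \<Rightarrow> ('m, 'n) tvec) \<Rightarrow> real \<Rightarrow> real \<Rightarrow> ('m, 'n) tvec" where
  "Rcurv X s t c = curv (Metric M c) (snd c (\<Gamma> s t)) (V s t c) (U s t c) (X s t c)"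

lemma Rcurv_skew:
  assumes "(s, t) \<in> S"
  shows "g (Rcurv X) Y s t + g X (Rcurv Y) s t = 0"
  unfolding ip_chart_at Rcurv_def
  by (rule metric_patch.curv_skew[OF metric_patch_chart]) (use chart_at_surface[OF assms] in auto)

lemma ip_cong:
  assumes st: "(s, t) \<in> S" and "\<And>c. c \<in> Atlas M \<Longrightarrow> \<Gamma> s t \<in> fst c \<Longrightarrow> X c = X' c"
  shows "ip M (\<Gamma> s t) X Y = ip M (\<Gamma> s t) X' Y" "ip M (\<Gamma> s t) Y X = ip M (\<Gamma> s t) Y X'"
    "schouten_form M (\<Gamma> s t) X Y = schouten_form M (\<Gamma> s t) X' Y" "schouten_form M (\<Gamma> s t) Y X = schouten_form M (\<Gamma> s t) Y X'"
  using assms(2)[OF chart_at_surface[OF st]] by (simp_all add: ip_chart_at schouten_form_chart_at)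

lemma ip_s_vel:
  assumes st: "(s, t) \<in> S"
  shows "g X (Ds U) s t = g X (Dt V) s t" "P X (Ds U) s t = P X (Dt V) s t"
  by (rule ip_cong(2,4)[OF st]; rule covd_vel[OF st, symmetric]; assumption)+

text \<open>\<open>\<nabla>\<^sub>V A = \<nabla>\<^sub>U \<nabla>\<^sub>V U + R(V,U)U\<close>, and \<open>\<nabla>\<^sub>V U = \<nabla>\<^sub>U V\<close>.\<close>

lemma ip_s_accel:
  assumes st: "(s, t) \<in> S"
  shows "g X (Ds A) s t = g X (Dt (Dt V)) s t + g X (Rcurv U) s t"
proof -
  have "Ds A s t c = Dt (Dt V) s t c + Rcurv U s t c" if c: "c \<in> Atlas M" "\<Gamma> s t \<in> fst c" for c
  proof -
    have "Dt (Ds U) s t c = Dt (Dt V) s t c"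
      by (rule covd_cong[OF _ c(1) st c(2)]) (auto intro: smooth_field_intros covd_vel[symmetric])
    then show ?thesis using covd_commute[OF smooth_field_vel st c, of True] by (simp add: Rcurv_def)
  qed
  then have "g X (Ds A) s t = ip M (\<Gamma> s t) (X s t) (\<lambda>c. Dt (Dt V) s t c + Rcurv U s t c)"
    by (rule ip_cong(2)[OF st])
  then show ?thesis by (simp only: ip_algebra)
qed

text \<open>A direct computation would produce a derivative of the curvature. It is avoided by
  differentiating \<open>\<langle>U, \<nabla>\<^sub>V A\<rangle> = \<langle>U, \<nabla>\<^sub>U \<nabla>\<^sub>U V\<rangle>\<close> along the curve, an equality that holds because
  \<open>\<langle>U, R(V,U)U\<rangle> = 0\<close>.\<close>

lemma ip_U_s_jerk:
  assumes st: "(s, t) \<in> S"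
  shows "g U (Ds (Dt A)) s t = g U (Dt (Dt (Dt V))) s t - 2 * g A (Rcurv U) s t"
proof -
  note sf = smooth_field_intros
  have UR: "g U (Rcurv U) s t = 0" if "(s, t) \<in> S" for s t
    using Rcurv_skew[OF that, of U U] g_commute[OF that, of "Rcurv U" U] by simp
  have "has_pd True (g U (Ds A)) (g A (Ds A) s t + g U (Dt (Ds A)) s t) s t"
    by (rule has_pd_ip(1)[OF _ _ st]) (intro sf)+
  moreover have "has_pd True (g U (Ds A)) (g A (Dt (Dt V)) s t + g U (Dt (Dt (Dt V))) s t) s t"
  proof (rule has_pd_cong[OF st has_pd_ip(1)[OF _ _ st]])
    fix s t assume "(s, t) \<in> S"
    then show "g U (Dt (Dt V)) s t = g U (Ds A) s t" by (simp add: ip_s_accel UR)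
  qed (intro sf)+
  ultimately have 1: "g A (Ds A) s t + g U (Dt (Ds A)) s t = g A (Dt (Dt V)) s t + g U (Dt (Dt (Dt V))) s t"
    by (rule has_pd_unique[OF st])
  have "g U (Ds (Dt A)) s t = ip M (\<Gamma> s t) (U s t) (\<lambda>c. Dt (Ds A) s t c + Rcurv A s t c)"
    by (rule ip_cong(2)[OF st]) (simp add: covd_commute[OF _ st] sf Rcurv_def)
  also have "\<dots> = g U (Dt (Ds A)) s t + g U (Rcurv A) s t" by (simp only: ip_algebra)
  also have "g U (Rcurv A) s t = - g A (Rcurv U) s t"
    using Rcurv_skew[OF st, of U A] g_commute[OF st, of "Rcurv U" A] by simp
  finally show ?thesis using 1 ip_s_accel[OF st, of A] by simp
qed

end

locale nonnull_surface = surface +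
  assumes nonnull: "(s, t) \<in> S \<Longrightarrow> g U U s t \<noteq> 0"
begin

abbreviation B where "B \<equiv> covd True (covd True (vel True))"
abbreviation iu where "iu s t \<equiv> inverse (g U U s t)"

lemma accel_eq: "acceleration M T (\<Gamma> s) t = A s t"
  by (simp add: acceleration_def covd_def vel_def[abs_def])

lemma jerk_eq: "cov_deriv M T (\<Gamma> s) (acceleration M T (\<Gamma> s)) t = B s t"
  by (simp add: covd_def accel_eq[abs_def, symmetric])

lemma velocity_eq: "velocity T (\<Gamma> s) t = U s t"
  by (simp add: vel_def)

definition L where "L s t = iu s t * g U B s t - 3 * (iu s t)\<^sup>2 * (g U A s t)\<^sup>2 + 3 / 2 * iu s t * g A A s t + P U U s t"

lemma ip_E:
  assumes st: "(s, t) \<in> S"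
  shows "ip M (\<Gamma> s t) X (conf_geodesic_E M T (\<Gamma> s) t) = ip M (\<Gamma> s t) X (B s t)
    - 3 * g U A s t * iu s t * ip M (\<Gamma> s t) X (A s t) + 3 / 2 * g A A s t * iu s t * ip M (\<Gamma> s t) X (U s t)
    - g U U s t * schouten_form M (\<Gamma> s t) X (U s t) + 2 * P U U s t * ip M (\<Gamma> s t) X (U s t)"
  unfolding conf_geodesic_E_def Let_def accel_eq jerk_eq velocity_eq
  unfolding ip_algebra ip_schouten_sharp[OF chart_at_surface[OF st]] divide_inverse inverse_mult_distrib
  by simp

lemma lagrangian_eq:
  assumes st: "(s, t) \<in> S"
  shows "lagrangian M T (\<Gamma> s) t = L s t"
proof -
  have "(b - 3 * al * inverse u * al + 3 / 2 * be * inverse u * u - u * p + 2 * p * u) / u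
     = inverse u * b - 3 * (inverse u)\<^sup>2 * al\<^sup>2 + 3 / 2 * inverse u * be + p" if "u \<noteq> 0" for u b al be p :: real
    using that by (simp add: field_simps power2_eq_square)
  from this[OF nonnull[OF st]] show ?thesis unfolding lagrangian_def velocity_eq ip_E[OF st] L_def .
qed

lemma smooth_iu: "smooth_scalar iu"
  by (intro smooth_scalar_inverse smooth_scalar_ip smooth_field_intros nonnull)

lemma smooth_L: "smooth_scalar L"
  unfolding L_def[abs_def] power2_eq_square
  by (intro smooth_scalar_add smooth_scalar_diff smooth_scalar_mult smooth_scalar_const smooth_iu smooth_scalar_ip smooth_field_intros)

definition conf_D where "conf_D X s t = op_D M T (\<Gamma> s) (X s) t"

lemma conf_D_eq: "conf_D X s t c = Dt X s t c + iu s t *\<^sub>R (g A X s t *\<^sub>R U s t c - g U X s t *\<^sub>R A s t c - g A U s t *\<^sub>R X s t c)"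
  by (simp add: conf_D_def op_D_def Let_def accel_eq velocity_eq covd_def divide_inverse)

lemma smooth_conf_D: "smooth_field X \<Longrightarrow> smooth_field (conf_D X)"
proof -
  assume X: "smooth_field X"
  have "smooth_field (\<lambda>s t c. Dt X s t c + iu s t *\<^sub>R (g A X s t *\<^sub>R U s t c - g U X s t *\<^sub>R A s t c - g A U s t *\<^sub>R X s t c))"
    by (intro smooth_field_add smooth_field_scaleR smooth_field_diff smooth_iu smooth_scalar_ip X smooth_field_intros)
  then show ?thesis by (simp add: conf_D_eq[abs_def])
qed

lemma ip_conf_D:
  "ip M (\<Gamma> s t) Y (conf_D X s t) = ip M (\<Gamma> s t) Y (Dt X s t) + iu s t * (g A X s t * ip M (\<Gamma> s t) Y (U s t)
    - g U X s t * ip M (\<Gamma> s t) Y (A s t) - g A U s t * ip M (\<Gamma> s t) Y (X s t))"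
  "schouten_form M (\<Gamma> s t) Y (conf_D X s t) = schouten_form M (\<Gamma> s t) Y (Dt X s t) + iu s t * (g A X s t * schouten_form M (\<Gamma> s t) Y (U s t)
    - g U X s t * schouten_form M (\<Gamma> s t) Y (A s t) - g A U s t * schouten_form M (\<Gamma> s t) Y (X s t))"
  by (simp_all add: conf_D_eq[abs_def] ip_algebra schouten_form_algebra algebra_simps)

lemma has_pd_iu:
  assumes st: "(s, t) \<in> S"
  shows "has_pd True iu (- 2 * g U A s t * (iu s t)\<^sup>2) s t"
  using has_pd_ip(1)[OF smooth_field_vel smooth_field_vel st, of True True True] nonnull[OF st] g_commute[OF st, of A U]
  by (auto simp: has_pd_def power2_eq_square intro!: derivative_eq_intros)

text \<open>The operator \<open>conf_D\<close> annihilates \<open>U\<close> and is compatible with the rescaled product \<open>|U|\<^bsup>-2\<^esup>\<langle>_,_\<rangle>\<close>. Therefore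
  each application of it next to \<open>U\<close> is a derivative of a scalar.\<close>

lemma has_pd_iu_ip:
  assumes X: "smooth_field X" and st: "(s, t) \<in> S"
  shows "has_pd True (\<lambda>s t. iu s t * g U X s t) (iu s t * g U (conf_D X) s t) s t"
proof -
  have "has_pd True (\<lambda>s t. iu s t * g U X s t) (- 2 * g U A s t * (iu s t)\<^sup>2 * g U X s t + (g A X s t + g U (Dt X) s t) * iu s t) s t"
    using DERIV_mult[OF has_pd_iu[OF st, unfolded has_pd_def if_True] has_pd_ip(1)[OF smooth_field_vel X st, of True True, unfolded has_pd_def if_True]]
    by (simp add: has_pd_def)
  moreover have "- 2 * g U A s t * (iu s t)\<^sup>2 * g U X s t + (g A X s t + g U (Dt X) s t) * iu s t = iu s t * g U (conf_D X) s t"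
    using nonnull[OF st] unfolding ip_conf_D g_commute[OF st, of A U] by (simp add: algebra_simps power2_eq_square)
  ultimately show ?thesis by simp
qed

lemma L_derivative:
  assumes "has_pd e (g U U) du s t" "has_pd e (g U B) dub s t" "has_pd e (g U A) dal s t" "has_pd e (g A A) dbe s t" "has_pd e (P U U) dpi s t"
    and st: "(s, t) \<in> S"
  shows "has_pd e L (- (iu s t)\<^sup>2 * du * g U B s t + iu s t * dub + 6 * (iu s t)^3 * du * (g U A s t)\<^sup>2 - 6 * (iu s t)\<^sup>2 * g U A s t * dal
     - 3 / 2 * (iu s t)\<^sup>2 * du * g A A s t + 3 / 2 * iu s t * dbe + dpi) s t"
proof -
  show ?thesis
    using assms(1-5) lagrangian_derivative_real[where J=T and u="g U U s" and ub="g U B s" and al="g U A s" and be="g A A s" and pi="P U U s", OF _ _ _ _ _ nonnull[OF st]]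
      lagrangian_derivative_real[where J="{a..b}" and u="\<lambda>\<sigma>. g U U \<sigma> t" and ub="\<lambda>\<sigma>. g U B \<sigma> t" and al="\<lambda>\<sigma>. g U A \<sigma> t"
        and be="\<lambda>\<sigma>. g A A \<sigma> t" and pi="\<lambda>\<sigma>. P U U \<sigma> t", OF _ _ _ _ _ nonnull[OF st]]
    unfolding has_pd_def L_def[abs_def] by (cases e) simp_all
qed

abbreviation "p k s t \<equiv> g U ((covd True ^^ k) V) s t"
abbreviation "q k s t \<equiv> g A ((covd True ^^ k) V) s t"
abbreviation "r k s t \<equiv> g B ((covd True ^^ k) V) s t"

lemma smooth_iterated: "smooth_field ((covd True ^^ k) V)"
  by (induction k) (auto intro: smooth_field_intros)

lemma has_pd_atoms:
  assumes st: "(s, t) \<in> S"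
  shows "has_pd True iu (- 2 * g U A s t * (iu s t)\<^sup>2) s t"
    "has_pd True (g U A) (g A A s t + g U B s t) s t"
    "has_pd True (g A A) (2 * g A B s t) s t"
    "has_pd True (p k) (q k s t + p (Suc k) s t) s t"
    "has_pd True (q k) (r k s t + q (Suc k) s t) s t"
  using has_pd_iu[OF st] has_pd_ip(1)[OF smooth_field_vel smooth_field_covd[OF smooth_field_vel] st, of True True True True]
    has_pd_ip(1)[OF smooth_field_covd[OF smooth_field_vel] smooth_field_covd[OF smooth_field_vel] st, of True True True True True] g_commute[OF st, of B A]
    has_pd_ip(1)[OF smooth_field_vel smooth_iterated st, of True True k] has_pd_ip(1)[OF smooth_field_covd[OF smooth_field_vel] smooth_iterated st, of True True True k]
  by simp_all

lemma iu_U_DV: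
  assumes st: "(s, t) \<in> S"
  shows "iu s t * g U (conf_D V) s t = iu s t * (q 0 s t + p 1 s t) - 2 * g U A s t * (iu s t)\<^sup>2 * p 0 s t"
  using nonnull[OF st] unfolding ip_conf_D g_commute[OF st, of A U] by (simp add: algebra_simps power2_eq_square)

text \<open>By \<open>has_pd_iu_ip\<close> the left-hand side is the derivative of the expression in \<open>iu_U_DV\<close>.\<close>

lemma iu_U_DDV:
  assumes st: "(s, t) \<in> S"
  shows "iu s t * g U (conf_D (conf_D V)) s t = - 2 * (g A A s t + g U B s t) * (iu s t)\<^sup>2 * p 0 s t + 8 * (g U A s t)\<^sup>2 * (iu s t)^3 * p 0 s t
     - 4 * g U A s t * (iu s t)\<^sup>2 * (q 0 s t + p 1 s t) + iu s t * (r 0 s t + 2 * q 1 s t + p 2 s t)" (is "_ = ?e2")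
proof (rule has_pd_unique[OF st])
  show "has_pd True (\<lambda>s t. iu s t * g U (conf_D V) s t) (iu s t * g U (conf_D (conf_D V)) s t) s t"
    by (rule has_pd_iu_ip[OF smooth_conf_D[OF smooth_field_vel] st])
  show "has_pd True (\<lambda>s t. iu s t * g U (conf_D V) s t) ?e2 s t"
  proof (rule has_pd_cong[OF st _ iu_U_DV[symmetric]])
    show "has_pd True (\<lambda>s t. iu s t * (q 0 s t + p 1 s t) - 2 * g U A s t * (iu s t)\<^sup>2 * p 0 s t) ?e2 s t"
      using second_D_derivative_real[where i="iu s" and al="g U A s" and be="g A A s" and J=T and x=t and pa="p 0 s" and qa="q 0 s" and pb="p 1 s" and ub="g U B s t" and ra="r 0 s t"
          and qb="q 1 s t" and pc="p 2 s t"] has_pd_atoms(1,2)[OF st] has_pd_atoms(4)[OF st, of 0] has_pd_atoms(4)[OF st, of 1] has_pd_atoms(5)[OF st, of 0]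
      unfolding has_pd_def if_True by (simp add: numeral_2_eq_2)
  qed
qed

text \<open>The boundary term in terms of inner products, see \<open>boundary_B_eq\<close>.\<close>

definition bdry where "bdry s t = - 1 / 2 * g A A s t * (iu s t)\<^sup>2 * p 0 s t + 2 * (g U A s t)\<^sup>2 * (iu s t)^3 * p 0 s t - g U A s t * (iu s t)\<^sup>2 * q 0 s t
   - 4 * g U A s t * (iu s t)\<^sup>2 * p 1 s t + 2 * iu s t * q 1 s t + iu s t * p 2 s t + P V U s t"

lemma ip_EL:
  assumes st: "(s, t) \<in> S"
  shows "ip M (\<Gamma> s t) (E_minus_2LU M T (\<Gamma> s) t) X = ip M (\<Gamma> s t) (B s t) X
    - 3 * g U A s t * iu s t * ip M (\<Gamma> s t) (A s t) X + (3 / 2 * g A A s t * iu s t + 2 * P U U s t - 2 * L s t) * ip M (\<Gamma> s t) (U s t) X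
    - g U U s t * schouten_form M (\<Gamma> s t) (U s t) X"
proof -
  note c = ip_commute[OF chart_at_surface[OF st]] schouten_form_commute[OF chart_at_surface[OF st]]
  have "ip M (\<Gamma> s t) X (E_minus_2LU M T (\<Gamma> s) t) = ip M (\<Gamma> s t) X (conf_geodesic_E M T (\<Gamma> s) t) - 2 * L s t * ip M (\<Gamma> s t) X (U s t)"
    unfolding E_minus_2LU_def lagrangian_eq[OF st] velocity_eq ip_algebra ..
  then show ?thesis unfolding ip_E[OF st] c(1)[of _ X] c(2)[of _ X] by (simp add: algebra_simps)
qed

text \<open>The products with the derivative of \<open>A\<close> cancel between the two parts of the boundary term, and \<open>P(U,U)\<close>
  cancels inside \<open>E - 2LU\<close>; hence \<open>bdry\<close> contains only products with \<open>U\<close> and \<open>A\<close> and the single term \<open>P(V,U)\<close>.\<close>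

lemma boundary_B_eq:
  assumes st: "(s, t) \<in> S"
  shows "boundary_B M T (\<Gamma> s) (V s) t = bdry s t"
proof -
  have 1: "op_D M T (\<Gamma> s) (V s) = conf_D V s" by (simp add: conf_D_def[abs_def])
  have "boundary_B M T (\<Gamma> s) (V s) t = iu s t * g U (conf_D (conf_D V)) s t - iu s t * ip M (\<Gamma> s t) (E_minus_2LU M T (\<Gamma> s) t) (V s t)"
    unfolding boundary_B_def velocity_eq 1 by (simp add: conf_D_def divide_inverse algebra_simps)
  also have "\<dots> = bdry s t"
    using nonnull[OF st] unfolding iu_U_DDV[OF st] ip_EL[OF st] L_def bdry_def P_commute[OF st, of V U]
    by (simp add: algebra_simps power2_eq_square power3_eq_cube)
  finally show ?thesis .
qed

abbreviation nabP where "nabP X Y Z s t \<equiv> nab (Metric M (chart_at M (\<Gamma> s t))) (schouten (Metric M (chart_at M (\<Gamma> s t)))) (snd (chart_at M (\<Gamma> s t)) (\<Gamma> s t))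
   (X s t (chart_at M (\<Gamma> s t))) (Y s t (chart_at M (\<Gamma> s t))) (Z s t (chart_at M (\<Gamma> s t)))"

text \<open>The total derivative of \<open>bdry\<close>, see \<open>has_pd_bdry\<close>.\<close>

definition bdry_deriv where "bdry_deriv s t =
   - g A B s t * (iu s t)\<^sup>2 * p 0 s t + 2 * g A A s t * g U A s t * (iu s t)^3 * p 0 s t - 1 / 2 * g A A s t * (iu s t)\<^sup>2 * (q 0 s t + p 1 s t)
   + 4 * g U A s t * (g A A s t + g U B s t) * (iu s t)^3 * p 0 s t - 12 * (g U A s t)^3 * (iu s t)^4 * p 0 s t + 2 * (g U A s t)\<^sup>2 * (iu s t)^3 * (q 0 s t + p 1 s t)
   - (g A A s t + g U B s t) * (iu s t)\<^sup>2 * q 0 s t + 4 * (g U A s t)\<^sup>2 * (iu s t)^3 * q 0 s t - g U A s t * (iu s t)\<^sup>2 * (r 0 s t + q 1 s t)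
   - 4 * (g A A s t + g U B s t) * (iu s t)\<^sup>2 * p 1 s t + 16 * (g U A s t)\<^sup>2 * (iu s t)^3 * p 1 s t - 4 * g U A s t * (iu s t)\<^sup>2 * (q 1 s t + p 2 s t)
   - 4 * g U A s t * (iu s t)\<^sup>2 * q 1 s t + 2 * iu s t * (r 1 s t + q 2 s t) - 2 * g U A s t * (iu s t)\<^sup>2 * p 2 s t + iu s t * (q 2 s t + p 3 s t)
   + (nabP U V U s t + P U (covd True V) s t + P A V s t)"

lemma has_pd_bdry:
  assumes st: "(s, t) \<in> S"
  shows "has_pd True bdry (bdry_deriv s t) s t"
proof -
  have PV: "has_pd True (P V U) (nabP U V U s t + P U (covd True V) s t + P A V s t) s t"
    using has_pd_ip(2)[OF smooth_field_vel smooth_field_vel st refl, of True False True]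
    by (simp only: P_commute[OF st, of "covd True V" U] P_commute[OF st, of V A])
  show ?thesis
    using boundary_derivative_real[where i="iu s" and al="g U A s" and be="g A A s" and J=T and x=t and pa="p 0 s" and qa="q 0 s" and pb="p 1 s" and qb="q 1 s" and pc="p 2 s" and ub="g U B s t"
        and ab="g A B s t" and ra="r 0 s t" and rb="r 1 s t" and qc="q 2 s t" and pd="p 3 s t" and P="P V U s" and dP="nabP U V U s t + P U (covd True V) s t + P A V s t"]
      has_pd_atoms(1,2,3)[OF st] has_pd_atoms(4)[OF st, of 0] has_pd_atoms(4)[OF st, of 1] has_pd_atoms(4)[OF st, of 2] has_pd_atoms(5)[OF st, of 0] has_pd_atoms(5)[OF st, of 1] PV
    unfolding has_pd_def if_True bdry_def[abs_def] bdry_deriv_def by (simp add: numeral_2_eq_2 numeral_3_eq_3)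
qed

lemma ip_K:
  assumes st: "(s, t) \<in> S"
  shows "ip M (\<Gamma> s t) (vector_K M T (\<Gamma> s) t) (V s t) = g A (Rcurv U) s t
    - (g U U s t * P A V s t - g U A s t * P U V s t - g V U s t * P A U s t + g A V s t * P U U s t)
    + g U U s t * (nabP V U U s t - nabP U V U s t)"
proof -
  let ?c = "chart_at M (\<Gamma> s t)"
  note c = chart_at_surface[OF st]
  have "ip M (\<Gamma> s t) (V s t) (vector_K M T (\<Gamma> s) t) = g A (Rcurv U) s t
    - (g U U s t * P A V s t - g U A s t * P U V s t - g V U s t * P A U s t + g A V s t * P U U s t)
    + g U U s t * (nabP V U U s t - nabP U V U s t)"
    unfolding ip_chart_at schouten_form_chart_at Rcurv_def
    by (rule metric_patch.K_contraction[OF metric_patch_chart[OF c(1)] _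
        vector_K_def[THEN fun_cong, unfolded Let_def accel_eq velocity_eq] ])
      (use c in \<open>auto simp: ip_chart_at velocity_eq accel_eq\<close>)
  then show ?thesis by (simp only: ip_commute[OF c])
qed

definition var_integrand where "var_integrand s t = 1 / g U U s t * (ip M (\<Gamma> s t) (vector_K M T (\<Gamma> s) t) (V s t)
    - ip M (\<Gamma> s t) (E_minus_2LU M T (\<Gamma> s) t) (op_D M T (\<Gamma> s) (V s) t))"

lemma has_pd_s_atoms:
  assumes st: "(s, t) \<in> S"
  shows "has_pd False (g U U) (2 * p 1 s t) s t"
    "has_pd False (g U B) (r 1 s t + p 3 s t - 2 * g A (Rcurv U) s t) s t"
    "has_pd False (g U A) (q 1 s t + p 2 s t) s t"
    "has_pd False (g A A) (2 * q 2 s t + 2 * g A (Rcurv U) s t) s t"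
    "has_pd False (P U U) (nabP V U U s t + 2 * P U (covd True V) s t) s t"
proof -
  note sf = smooth_field_intros
  have UR: "g U (Rcurv U) s t = 0"
    using Rcurv_skew[OF st, of U U] g_commute[OF st, of "Rcurv U" U] by simp
  show "has_pd False (g U U) (2 * p 1 s t) s t"
    using has_pd_ip(1)[OF sf(1) sf(1) st, of False True True] by (simp add: g_commute[OF st, of "Ds U"] ip_s_vel[OF st])
  show "has_pd False (g U B) (r 1 s t + p 3 s t - 2 * g A (Rcurv U) s t) s t"
    using has_pd_ip(1)[OF sf(1) sf(2)[OF sf(2)[OF sf(1)]] st, of False True True True True]
    by (simp add: g_commute[OF st, of "Ds U"] ip_s_vel[OF st] ip_U_s_jerk[OF st] numeral_3_eq_3 add_diff_eq)
  show "has_pd False (g U A) (q 1 s t + p 2 s t) s t"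
    using has_pd_ip(1)[OF sf(1) sf(2)[OF sf(1)] st, of False True True True]
    by (simp add: g_commute[OF st, of "Ds U"] ip_s_vel[OF st] ip_s_accel[OF st] UR numeral_2_eq_2)
  show "has_pd False (g A A) (2 * q 2 s t + 2 * g A (Rcurv U) s t) s t"
    using has_pd_ip(1)[OF sf(2)[OF sf(1)] sf(2)[OF sf(1)] st, of False True True True True]
    by (simp add: g_commute[OF st, of "Ds A"] ip_s_accel[OF st] numeral_2_eq_2)
  show "has_pd False (P U U) (nabP V U U s t + 2 * P U (covd True V) s t) s t"
    using has_pd_ip(2)[OF sf(1) sf(1) st refl, of False True True]
    by (simp add: P_commute[OF st, of "Ds U"] ip_s_vel[OF st] add_ac)
qed

text \<open>The first variation formula before integration. With all derivatives known, both sides are polynomials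
  in the inner products, the Schouten terms and \<open>i = |U|\<^bsup>-2\<^esup>\<close>, equal modulo the relation \<open>|U|\<^sup>2 i = 1\<close>.\<close>

lemma first_variation_pointwise:
  assumes st: "(s, t) \<in> S"
  shows "has_pd False L (var_integrand s t + bdry_deriv s t) s t"
proof -
  note d = has_pd_s_atoms[OF st]
  define u i where "u = g U U s t" and "i = inverse u"
  have ui: "u * i = 1" using nonnull[OF st] by (simp add: u_def i_def)
  have [simp]: "u * (i * x) = x" "i * (u * x) = x" for x
    using ui by (simp_all add: mult.assoc[symmetric] mult.commute[of i])
  have 1: "op_D M T (\<Gamma> s) (V s) t = conf_D V s t" by (simp add: conf_D_def)
  have "var_integrand s t + bdry_deriv s t = (- (iu s t)\<^sup>2 * (2 * p 1 s t) * g U B s t + iu s t * (r 1 s t + p 3 s t - 2 * g A (Rcurv U) s t)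
     + 6 * (iu s t)^3 * (2 * p 1 s t) * (g U A s t)\<^sup>2 - 6 * (iu s t)\<^sup>2 * g U A s t * (q 1 s t + p 2 s t)
     - 3 / 2 * (iu s t)\<^sup>2 * (2 * p 1 s t) * g A A s t + 3 / 2 * iu s t * (2 * q 2 s t + 2 * g A (Rcurv U) s t) + (nabP V U U s t + 2 * P U (covd True V) s t))"
    unfolding var_integrand_def 1 ip_EL[OF st] ip_K[OF st] ip_conf_D bdry_deriv_def L_def
      g_commute[OF st, of A U] g_commute[OF st, of B U] g_commute[OF st, of B A] g_commute[OF st, of V U] P_commute[OF st, of A U] P_commute[OF st, of V U]
      divide_inverse[of 1] u_def[symmetric] i_def[symmetric]
    by (simp add: algebra_simps power2_eq_square power3_eq_cube power4_eq_xxxx)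
  with L_derivative[OF d st] show ?thesis by simp
qed

end

section \<open>The first variation of the action\<close>

lemma vector_derivative_within_cong:
  assumes "t \<in> T" "\<And>\<tau>. \<tau> \<in> T \<Longrightarrow> f \<tau> = h \<tau>"
  shows "vector_derivative f (at t within T) = vector_derivative h (at t within T)"
proof -
  have "(f has_vector_derivative y) (at t within T) \<longleftrightarrow> (h has_vector_derivative y) (at t within T)" for y
    using assms has_vector_derivative_transform[OF assms(1), of h f y] has_vector_derivative_transform[OF assms(1), of f h y]
    by auto
  then show ?thesis by (simp add: vector_derivative_def)
qed

context
  fixes T :: "real set" and \<gamma> \<eta> :: "real \<Rightarrow> 'm" and M :: "('m, 'n::finite) metric_manifold"
  assumes eq: "\<And>t. t \<in> T \<Longrightarrow> \<gamma> t = \<eta> t"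
begin

lemma velocity_cong: "t \<in> T \<Longrightarrow> velocity T \<gamma> t = (velocity T \<eta> t :: ('m, 'n) tvec)"
  unfolding velocity_def by (rule ext, rule vector_derivative_within_cong) (simp_all add: eq)

lemma cov_deriv_cong:
  assumes "t \<in> T" "\<And>\<tau>. \<tau> \<in> T \<Longrightarrow> X \<tau> = Y \<tau>"
  shows "cov_deriv M T \<gamma> X t = cov_deriv M T \<eta> Y t"
proof
  fix c
  have "vector_derivative (\<lambda>\<tau>. X \<tau> c) (at t within T) = vector_derivative (\<lambda>\<tau>. Y \<tau> c) (at t within T)"
    by (rule vector_derivative_within_cong) (simp_all add: assms)
  then show "cov_deriv M T \<gamma> X t c = cov_deriv M T \<eta> Y t c"
    by (simp add: cov_deriv_def velocity_cong[OF assms(1)] eq[OF assms(1)] assms(2)[OF assms(1)])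
qed

lemma acceleration_cong: "t \<in> T \<Longrightarrow> acceleration M T \<gamma> t = acceleration M T \<eta> t"
  unfolding acceleration_def by (rule cov_deriv_cong) (simp_all add: velocity_cong)

lemma conf_geodesic_E_cong: "t \<in> T \<Longrightarrow> conf_geodesic_E M T \<gamma> t = conf_geodesic_E M T \<eta> t"
  unfolding conf_geodesic_E_def
  using cov_deriv_cong[of t "acceleration M T \<gamma>" "acceleration M T \<eta>"]
  by (simp add: velocity_cong acceleration_cong eq)

lemma lagrangian_cong: "t \<in> T \<Longrightarrow> lagrangian M T \<gamma> t = lagrangian M T \<eta> t"
  by (simp add: lagrangian_def velocity_cong conf_geodesic_E_cong eq)

lemma op_D_cong:
  assumes "t \<in> T" "\<And>\<tau>. \<tau> \<in> T \<Longrightarrow> X \<tau> = Y \<tau>"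
  shows "op_D M T \<gamma> X t = op_D M T \<eta> Y t"
  unfolding op_D_def using cov_deriv_cong[of t X Y] assms
  by (simp add: velocity_cong acceleration_cong eq)

lemma vector_K_cong: "t \<in> T \<Longrightarrow> vector_K M T \<gamma> t = vector_K M T \<eta> t"
  by (simp add: vector_K_def velocity_cong acceleration_cong eq)

lemma E_minus_2LU_cong: "t \<in> T \<Longrightarrow> E_minus_2LU M T \<gamma> t = E_minus_2LU M T \<eta> t"
  by (simp add: E_minus_2LU_def velocity_cong lagrangian_cong conf_geodesic_E_cong)

lemma boundary_B_cong:
  assumes "t \<in> T" "\<And>\<tau>. \<tau> \<in> T \<Longrightarrow> X \<tau> = Y \<tau>"
  shows "boundary_B M T \<gamma> X t = boundary_B M T \<eta> Y t"
  unfolding boundary_B_def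
  using op_D_cong[OF assms(1), of "op_D M T \<gamma> X" "op_D M T \<eta> Y"] op_D_cong[of _ X Y] assms
  by (simp add: velocity_cong E_minus_2LU_cong eq)

end

lemma smooth_map_on_subset: "smooth_map_on M S f \<Longrightarrow> S' \<subseteq> S \<Longrightarrow> smooth_map_on M S' f"
  unfolding smooth_map_on_def
proof
  fix p assume *: "\<forall>p\<in>S. \<exists>c\<in>Atlas M. \<exists>N F. open N \<and> p \<in> N \<and> f ` (S \<inter> N) \<subseteq> fst c \<and>
        smooth_on N F \<and> (\<forall>q\<in>S \<inter> N. F q = snd c (f q))" and S': "S' \<subseteq> S" "p \<in> S'"
  then obtain c N F where "c \<in> Atlas M" "open N" "p \<in> N" "f ` (S \<inter> N) \<subseteq> fst c" "smooth_on N F" "\<forall>q\<in>S \<inter> N. F q = snd c (f q)"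
    by blast
  moreover from this have "f ` (S' \<inter> N) \<subseteq> fst c" "\<forall>q\<in>S' \<inter> N. F q = snd c (f q)" using S'(1) by auto
  ultimately show "\<exists>c\<in>Atlas M. \<exists>N F. open N \<and> p \<in> N \<and> f ` (S' \<inter> N) \<subseteq> fst c \<and>
        smooth_on N F \<and> (\<forall>q\<in>S' \<inter> N. F q = snd c (f q))" by blast
qed

text \<open>Differentiation under the integral sign; the total derivative in \<open>first_variation_pointwise\<close> integrates
  to the boundary term.\<close>

lemma (in nonnull_surface) first_variation:
  assumes "a < 0" "0 < b"
  shows "((\<lambda>s. action M t0 t1 (\<Gamma> s)) has_real_derivative
     integral T (var_integrand 0) + (bdry 0 t1 - bdry 0 t0)) (at 0)"
proof -
  define dL where "dL s t = var_integrand s t + bdry_deriv s t" for s t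
  have dL: "has_pd False L (dL s t) s t" if "(s, t) \<in> S" for s t
    unfolding dL_def by (rule first_variation_pointwise[OF that])
  have cL: "continuous_on S (\<lambda>q. L (fst q) (snd q))" by (rule smooth_scalar_continuous_on[OF smooth_L])
  have cdL: "continuous_on S (\<lambda>q. dL (fst q) (snd q))"
    by (rule smooth_scalar_continuous_on[OF smooth_scalar_has_pd[OF smooth_L dL]])
  have slice: "f s integrable_on T" if "continuous_on S (\<lambda>q. f (fst q) (snd q))" "s \<in> {a..b}" for f :: "real \<Rightarrow> real \<Rightarrow> real" and s
  proof -
    have "continuous_on T (\<lambda>t. (\<lambda>q. f (fst q) (snd q)) (s, t))"
      by (rule continuous_on_compose2[OF that(1)]) (use that(2) in \<open>auto intro!: continuous_intros\<close>)
    then show ?thesis by (simp add: integrable_continuous_real)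
  qed
  \<comment> \<open>On the open interval the two-sided derivative at \<open>0\<close> is the one within the interval.\<close>
  have "((\<lambda>s. integral (cbox t0 t1) (L s)) has_field_derivative integral (cbox t0 t1) (dL 0)) (at 0 within {a<..<b})"
  proof (rule leibniz_rule_field_derivative[where U="{a<..<b}"])
    fix s t assume "s \<in> {a<..<b}" "t \<in> cbox t0 t1"
    then have "((\<lambda>s. L s t) has_field_derivative dL s t) (at s within {a..b})"
      using dL[of s t] by (simp add: has_pd_def)
    then show "((\<lambda>s. L s t) has_field_derivative dL s t) (at s within {a<..<b})"
      by (rule DERIV_subset) auto
  next
    have "continuous_on ({a<..<b} \<times> cbox t0 t1) (\<lambda>q. dL (fst q) (snd q))"
      by (rule continuous_on_subset[OF cdL]) auto
    then show "continuous_on ({a<..<b} \<times> cbox t0 t1) (\<lambda>(s, t). dL s t)"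
      by (simp add: case_prod_beta')
  qed (use assms slice[OF cL] in auto)
  then have "((\<lambda>s. integral T (L s)) has_real_derivative integral T (dL 0)) (at 0)"
    using assms by (simp add: at_within_open[of 0 "{a<..<b}"])
  then have D: "((\<lambda>s. action M t0 t1 (\<Gamma> s)) has_real_derivative integral T (dL 0)) (at 0)"
  proof (rule has_field_derivative_transform_within_open[of _ _ _ "{a<..<b}"])
    fix s assume "s \<in> {a<..<b}"
    then show "integral T (L s) = action M t0 t1 (\<Gamma> s)"
      unfolding action_def by (intro integral_cong lagrangian_eq[symmetric]) auto
  qed (use assms in auto)
  have "(bdry_deriv 0 has_integral bdry 0 t1 - bdry 0 t0) T"
  proof (rule fundamental_theorem_of_calculus)
    fix t assume "t \<in> T"
    then show "(bdry 0 has_vector_derivative bdry_deriv 0 t) (at t within T)"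
      using has_pd_bdry[of 0 t] assms by (simp add: has_pd_def has_real_derivative_iff_has_vector_derivative)
  qed (use t01 in simp)
  moreover have "(dL 0 has_integral integral T (dL 0)) T"
    using slice[OF cdL, of 0] assms by (simp add: integrable_integral)
  ultimately have "((\<lambda>t. dL 0 t - bdry_deriv 0 t) has_integral integral T (dL 0) - (bdry 0 t1 - bdry 0 t0)) T"
    by (rule has_integral_diff[rotated])
  then have "(var_integrand 0 has_integral integral T (dL 0) - (bdry 0 t1 - bdry 0 t0)) T" by (simp add: dL_def)
  then have "integral T (var_integrand 0) + (bdry 0 t1 - bdry 0 t0) = integral T (dL 0)" by (simp add: integral_unique)
  with D show ?thesis by simp
qed

theorem theorem4p1:
  fixes M :: "('m, 'n::finite) metric_manifold"
    and \<gamma> :: "real \<Rightarrow> 'm" and \<Gamma> :: "real \<Rightarrow> real \<Rightarrow> 'm" and t0 t1 :: real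
  assumes "pseudo_riemannian_manifold M"
    and "CARD('n) \<ge> 3"
    and "t0 < t1"
    and "smooth_map_on M {t0..t1} \<gamma>"
    and "\<And>t. t \<in> {t0..t1} \<Longrightarrow>
           ip M (\<gamma> t) (velocity {t0..t1} \<gamma> t) (velocity {t0..t1} \<gamma> t) \<noteq> 0"
    and "is_variation M t0 t1 \<gamma> \<Gamma>"
  shows "let T = {t0..t1}; U = velocity T \<gamma>; V = variation_field \<Gamma>;
             K = vector_K M T \<gamma>; B = boundary_B M T \<gamma> V
         in ((\<lambda>s. action M t0 t1 (\<Gamma> s)) has_real_derivative
               integral T (\<lambda>t. 1 / ip M (\<gamma> t) (U t) (U t) *
                  (ip M (\<gamma> t) (K t) (V t)
                   - ip M (\<gamma> t) (E_minus_2LU M T \<gamma> t) (op_D M T \<gamma> V t)))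
               + (B t1 - B t0)) (at 0)"
proof -
  let ?T = "{t0..t1}"
  have eq: "\<gamma> t = \<Gamma> 0 t" if "t \<in> ?T" for t using assms(6) that by (simp add: is_variation_def)
  have sm: "smooth_map_on M ({-1..1} \<times> ?T) (\<lambda>(s, t). \<Gamma> s t)" using assms(6) by (simp add: is_variation_def)
  interpret S1: surface M "-1" 1 t0 t1 \<Gamma> by unfold_locales (use assms sm in auto)
  define u where "u q = ip M (\<Gamma> (fst q) (snd q)) (velocity ?T (\<Gamma> (fst q)) (snd q)) (velocity ?T (\<Gamma> (fst q)) (snd q))" for q
  have cu: "continuous_on ({-1..1} \<times> ?T) u"
    using S1.smooth_scalar_continuous_on[OF S1.smooth_scalar_ip(1)[OF S1.smooth_field_vel[of True] S1.smooth_field_vel[of True]]]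
    by (simp add: u_def[abs_def] S1.vel_def)
  have vel: "velocity ?T \<gamma> t = (velocity ?T (\<Gamma> 0) t :: ('m, 'n) tvec)" if "t \<in> ?T" for t
    by (rule velocity_cong[OF eq that])
  have u0: "u (0, t) \<noteq> 0" if "t \<in> ?T" for t
    using assms(5)[OF that] by (simp add: u_def eq[OF that] vel[OF that])
  \<comment> \<open>The curves \<open>\<Gamma> s\<close> are non-null for small \<open>s\<close>, uniformly in \<open>t\<close> by compactness; the bound \<open>d \<le> 1\<close>
      keeps \<open>s\<close> inside the domain of the variation.\<close>
  obtain d where d: "0 < d" "d \<le> 1" and nz: "\<And>s t. \<lbrakk>\<bar>s\<bar> \<le> d; t \<in> ?T\<rbrakk> \<Longrightarrow> u (s, t) \<noteq> 0"
  proof -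
    have "compact ((\<lambda>t. \<bar>u (0, t)\<bar>) ` ?T)"
      by (intro compact_continuous_image continuous_on_compose2[OF cu] continuous_intros) auto
    then obtain m where m: "m \<in> ?T" "\<And>t. t \<in> ?T \<Longrightarrow> \<bar>u (0, m)\<bar> \<le> \<bar>u (0, t)\<bar>"
      using compact_attains_inf[of "(\<lambda>t. \<bar>u (0, t)\<bar>) ` ?T"] assms(3) by fastforce
    have "uniformly_continuous_on ({-1..1} \<times> ?T) u"
      by (intro compact_uniformly_continuous cu compact_Times compact_Icc)
    then obtain e where e: "e > 0" "\<And>q q'. \<lbrakk>q \<in> {-1..1} \<times> ?T; q' \<in> {-1..1} \<times> ?T; dist q' q < e\<rbrakk> \<Longrightarrow> dist (u q') (u q) < \<bar>u (0, m)\<bar>"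
      unfolding uniformly_continuous_on_def using u0[OF m(1)] by (metis zero_less_abs_iff)
    show ?thesis
    proof (rule that[of "min (1/2) (e / 2)"])
      fix s t assume st: "\<bar>s\<bar> \<le> min (1/2) (e / 2)" "t \<in> ?T"
      then have "dist (u (s, t)) (u (0, t)) < \<bar>u (0, m)\<bar>"
        using e(1) by (intro e(2)) (auto simp: dist_Pair_Pair dist_real_def)
      then show "u (s, t) \<noteq> 0" using m(2)[OF st(2)] by (auto simp: dist_real_def)
    qed (use e in auto)
  qed
  interpret S2: surface M "-d" d t0 t1 \<Gamma>
  proof unfold_locales
    show "smooth_map_on M ({-d..d} \<times> ?T) (\<lambda>(s, t). \<Gamma> s t)"
      by (rule smooth_map_on_subset[OF sm]) (use d in auto)
  qed (use d assms in auto)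
  interpret nonnull_surface M "-d" d t0 t1 \<Gamma>
  proof unfold_locales
    fix s t assume "(s, t) \<in> {-d..d} \<times> ?T"
    then show "ip M (\<Gamma> s t) (S2.vel True s t) (S2.vel True s t) \<noteq> 0"
      using nz[of s t] by (auto simp: u_def S2.vel_def abs_le_iff)
  qed
  have V: "variation_field \<Gamma> t = S2.V 0 t" for t
  proof -
    have "at (0::real) within {-d..d} = at 0" by (rule at_within_interior) (use d in simp)
    then show ?thesis unfolding variation_field_def S2.vel_def velocity_def by simp
  qed
  have e1: "1 / ip M (\<gamma> t) (velocity ?T \<gamma> t) (velocity ?T \<gamma> t) * (ip M (\<gamma> t) (vector_K M ?T \<gamma> t) (variation_field \<Gamma> t)
       - ip M (\<gamma> t) (E_minus_2LU M ?T \<gamma> t) (op_D M ?T \<gamma> (variation_field \<Gamma>) t)) = var_integrand 0 t" if "t \<in> ?T" for t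
  proof -
    have K: "vector_K M ?T \<gamma> t = vector_K M ?T (\<Gamma> 0) t" by (rule vector_K_cong[OF eq that])
    have E: "E_minus_2LU M ?T \<gamma> t = E_minus_2LU M ?T (\<Gamma> 0) t" by (rule E_minus_2LU_cong[OF eq that])
    have D: "op_D M ?T \<gamma> (variation_field \<Gamma>) t = op_D M ?T (\<Gamma> 0) (S2.V 0) t" by (rule op_D_cong[OF eq that V])
    show ?thesis unfolding var_integrand_def eq[OF that] vel[OF that] K E D V velocity_eq ..
  qed
  have e2: "boundary_B M ?T \<gamma> (variation_field \<Gamma>) t = bdry 0 t" if "t \<in> ?T" for t
  proof -
    have "boundary_B M ?T \<gamma> (variation_field \<Gamma>) t = boundary_B M ?T (\<Gamma> 0) (S2.V 0) t"
      by (rule boundary_B_cong[OF eq that V])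
    then show ?thesis using boundary_B_eq[of 0 t] d that by simp
  qed
  have I: "integral ?T (\<lambda>t. 1 / ip M (\<gamma> t) (velocity ?T \<gamma> t) (velocity ?T \<gamma> t) * (ip M (\<gamma> t) (vector_K M ?T \<gamma> t) (variation_field \<Gamma> t)
       - ip M (\<gamma> t) (E_minus_2LU M ?T \<gamma> t) (op_D M ?T \<gamma> (variation_field \<Gamma>) t))) = integral ?T (var_integrand 0)"
    by (rule integral_cong) (rule e1)
  show ?thesis
    unfolding Let_def I
    using first_variation d(1) assms(3) by (simp add: e2)
qed

end
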